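(* For every $q>2$ and $\kappa>0$ there exist constants $0<c,c',C<\infty$, depending only on $\kappa$ and $q$, such that the following holds. Let $d,N\ge 1$ be integers and let $\delta\in(0,1)$ satisfy $\delta\ge e^{-c'N}$. Then there exists a mean estimator, i.e. a measurable function $\widehat{\mu}_N:(\mathbb{R}^d)^N\to\mathbb{R}^d$ (which may depend on $\delta,\kappa,q$ but not on the unknown distribution), such that whenever $X_1,\dots,X_N$ are i.i.d. random vectors in $\mathbb{R}^d$, distributed as $X$, with mean $\mu$ and covariance matrix $\Sigma$ with eigenvalues $\lambda_1\ge\lambda_2\ge\cdots\ge\lambda_d\ge 0$, and satisfying $$\left(\mathbb{E}|\langle X-\mu,u\rangle|^q\right)^{1/q}\le\kappa\left(\mathbb{E}\langle X-\mu,u\rangle^2\right)^{1/2}\qquad\text{for all }u\in S^{d-1},$$ then, with probability at least $1-\delta$, writing $\widehat{\mu}_N=\widehat{\mu}_N(X_1,\dots,X_N)$, $$\forall u\in S^{d-1}:\quad \langle\widehat{\mu}_N-\mu,u\rangle\le C\left(\sqrt{\frac{\sigma^2(u)\log(1/\delta)}{N}}+\sqrt{\frac{\sum_{i=c\log(1/\delta)}^d\lambda_i}{N}}\right).$$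
   Context: $S^{d-1}=\{x\in\mathbb{R}^d:\|x\|=1\}$ is the Euclidean unit sphere, $\langle\cdot,\cdot\rangle$ the standard inner product, $\Sigma=\mathbb{E}(X-\mu)(X-\mu)^T$ and $\sigma^2(u)=\mathrm{Var}(\langle X,u\rangle)$. The sum $\sum_{i=c\log(1/\delta)}^d\lambda_i$ is over integers $1\le i\le d$ with $i\ge c\log(1/\delta)$. Standing assumption: the distribution of $X$ is absolutely continuous with respect to Lebesgue measure on $\mathbb{R}^d$. *)

theory Defs
  imports "HOL-Probability.Probability" "Jordan_Normal_Form.Char_Poly"
begin

text \<open>
  The dimension is quantified inside the theorem, after the constants, so it cannot be a type.
  A vector of dimension \<open>d\<close> is a function on \<open>{..<d}\<close>, extended by \<open>undefined\<close>; \<open>Rd d\<close> is the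
  corresponding Borel space and \<open>lebesgue_Rd d\<close> is Lebesgue measure on it.
\<close>

definition Rd :: "nat \<Rightarrow> (nat \<Rightarrow> real) measure" where
  "Rd d = (\<Pi>\<^sub>M i\<in>{..<d}. borel)"

definition lebesgue_Rd :: "nat \<Rightarrow> (nat \<Rightarrow> real) measure" where
  "lebesgue_Rd d = (\<Pi>\<^sub>M i\<in>{..<d}. lborel)"

definition ip :: "nat \<Rightarrow> (nat \<Rightarrow> real) \<Rightarrow> (nat \<Rightarrow> real) \<Rightarrow> real" where
  "ip d x y = (\<Sum>i<d. x i * y i)"

definition usphere :: "nat \<Rightarrow> (nat \<Rightarrow> real) set" where
  "usphere d = {u \<in> space (Rd d). sqrt (ip d u u) = 1}"

definition vdiff :: "nat \<Rightarrow> (nat \<Rightarrow> real) \<Rightarrow> (nat \<Rightarrow> real) \<Rightarrow> (nat \<Rightarrow> real)" where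
  "vdiff d x y = (\<lambda>i\<in>{..<d}. x i - y i)"

text \<open>
  The measure \<open>P\<close> below is the distribution of the random vector \<open>X\<close>. Square integrability of the
  coordinates is what it means for the mean and the covariance matrix to exist.
\<close>

definition ac_square_integrable_law :: "nat \<Rightarrow> (nat \<Rightarrow> real) measure \<Rightarrow> bool" where
  "ac_square_integrable_law d P \<longleftrightarrow>
     prob_space P \<and> sets P = sets (Rd d) \<and>
     absolutely_continuous (lebesgue_Rd d) P \<and>
     (\<forall>i<d. integrable P (\<lambda>x. (x i)\<^sup>2))"

definition mean_vec :: "nat \<Rightarrow> (nat \<Rightarrow> real) measure \<Rightarrow> (nat \<Rightarrow> real)" where
  "mean_vec d P = (\<lambda>i\<in>{..<d}. \<integral>x. x i \<partial>P)"

definition cov_mat :: "nat \<Rightarrow> (nat \<Rightarrow> real) measure \<Rightarrow> real mat" where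
  "cov_mat d P =
     Matrix.mat d d (\<lambda>(i, j). \<integral>x. (x i - mean_vec d P i) * (x j - mean_vec d P j) \<partial>P)"

definition dir_var :: "nat \<Rightarrow> (nat \<Rightarrow> real) measure \<Rightarrow> (nat \<Rightarrow> real) \<Rightarrow> real" where
  "dir_var d P u = prob_space.variance P (\<lambda>x. ip d x u)"

text \<open>
  \<open>lam 1 \<ge> \<dots> \<ge> lam d \<ge> 0\<close> are the eigenvalues of \<open>A\<close>, repeated according to multiplicity.
\<close>

definition ordered_eigenvalues :: "nat \<Rightarrow> real mat \<Rightarrow> (nat \<Rightarrow> real) \<Rightarrow> bool" where
  "ordered_eigenvalues d A lam \<longleftrightarrow>
     char_poly A = (\<Prod>i\<in>{1..d}. [:- lam i, 1:]) \<and>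
     (\<forall>i\<in>{1..d}. \<forall>j\<in>{1..d}. i \<le> j \<longrightarrow> lam j \<le> lam i) \<and>
     (\<forall>i\<in>{1..d}. 0 \<le> lam i)"

text \<open>
  The integrability conjunct expresses that the left-hand side of the moment inequality is finite;
  without it a divergent integral would count as \<open>0\<close>.
\<close>

definition moment_equivalence ::
    "nat \<Rightarrow> real \<Rightarrow> real \<Rightarrow> (nat \<Rightarrow> real) measure \<Rightarrow> bool" where
  "moment_equivalence d q \<kappa> P \<longleftrightarrow>
     (\<forall>u\<in>usphere d.
        integrable P (\<lambda>x. \<bar>ip d (vdiff d x (mean_vec d P)) u\<bar> powr q) \<and>
        (\<integral>x. \<bar>ip d (vdiff d x (mean_vec d P)) u\<bar> powr q \<partial>P) powr (1 / q)
          \<le> \<kappa> * sqrt (\<integral>x. (ip d (vdiff d x (mean_vec d P)) u)\<^sup>2 \<partial>P))"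

definition sample_space :: "nat \<Rightarrow> nat \<Rightarrow> (nat \<Rightarrow> nat \<Rightarrow> real) measure" where
  "sample_space d N = (\<Pi>\<^sub>M k\<in>{..<N}. Rd d)"

definition iid_law :: "nat \<Rightarrow> (nat \<Rightarrow> real) measure \<Rightarrow> (nat \<Rightarrow> nat \<Rightarrow> real) measure" where
  "iid_law N P = (\<Pi>\<^sub>M k\<in>{..<N}. P)"

text \<open>
  \<open>iid_law N P\<close> is the joint distribution of any independent random vectors
  \<open>X 0, \<dots>, X (N - 1)\<close> with distribution \<open>P\<close>, on any probability space. Working with laws
  keeps the type of the probability space out of the statement.
\<close>

lemma distr_iid_sample:
  assumes "prob_space M" and "N \<ge> 1"
    and "prob_space.indep_vars M (\<lambda>_. Rd d) X {..<N}"
    and "\<And>k. k < N \<Longrightarrow> distr M (Rd d) (X k) = P"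
  shows "distr M (sample_space d N) (\<lambda>\<omega>. \<lambda>k\<in>{..<N}. X k \<omega>) = iid_law N P"
proof -
  interpret prob_space M by fact
  have ne: "{..<N} \<noteq> {}" using assms(2) by (auto simp: lessThan_empty_iff)
  have rv: "\<And>k. k \<in> {..<N} \<Longrightarrow> random_variable (Rd d) (X k)"
    using assms(3) by (simp add: indep_vars_def)
  have "distr M (\<Pi>\<^sub>M k\<in>{..<N}. Rd d) (\<lambda>\<omega>. \<lambda>k\<in>{..<N}. X k \<omega>)
      = (\<Pi>\<^sub>M k\<in>{..<N}. distr M (Rd d) (X k))"
    using indep_vars_iff_distr_eq_PiM'[where M' = "\<lambda>_. Rd d" and X = X, OF ne rv] assms(3) by simp
  also have "\<dots> = (\<Pi>\<^sub>M k\<in>{..<N}. P)"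
    by (rule PiM_cong) (use assms(4) in auto)
  finally show ?thesis by (simp add: sample_space_def iid_law_def)
qed

end

theory Submission
  imports Defs "HOL-Library.Function_Algebras" "Jordan_Normal_Form.Schur_Decomposition"
begin

text \<open>
  For \<open>\<delta> \<ge> 1 / 2\<close> Chebyshev's inequality for the empirical mean suffices. For smaller \<open>\<delta>\<close> the sample is
  divided into \<open>n\<close> blocks, with \<open>n\<close> of the order of \<open>ln (1 / \<delta>)\<close>, and only the block means are used.
  The standard deviation of a block mean in direction \<open>u\<close> is of the order of the first term of the
  error bound, so it remains to estimate the common mean of \<open>n\<close> independent vectors up to a multiple
  of their standard deviation and of the second term \<open>r\<close>, with a failure probability that is
  exponentially small in \<open>n\<close>.

  The estimator is a Tukey median with slack (\<open>slack_depth_estimator\<close>): a point \<open>w\<close> with the least \<open>s\<close>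
  such that in each direction \<open>u\<close> a fixed fraction of the block means has an inner product with \<open>u\<close> of
  at least \<open>ip d w u - s * nrm d u\<close>. It needs no knowledge of the covariance matrix. On the event of
  \<open>uniform_counts\<close> the true mean \<open>\<mu>\<close> has slack of order \<open>r\<close>, hence so has the estimator. Since all but a
  smaller fraction of the block means exceed \<open>\<mu>\<close> in direction \<open>u\<close> by at most a multiple of the standard
  deviation plus \<open>r\<close>, some block mean lies close above \<open>\<mu>\<close> and not below the estimator
  (\<open>slack_depth_deterministic\<close>).

  The counting statements are uniform over all directions. The expected supremum of the empirical
  process is bounded by symmetrisation and contraction (\<open>expected_empirical_sup\<close>); with
  \<open>\<Sigma>\<close> the covariance matrix of a block mean, the relevant complexity is the trace of
  \<open>(\<Sigma> + r\<^sup>2 I)\<^bsup>-1\<^esup> \<Sigma>\<close> (\<open>resolvent_form\<close>), to which each of the large eigenvalues contributes at most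
  one and the small ones contribute at most their sum over \<open>r\<^sup>2\<close>. Concentration around the expectation
  follows from bounded differences (\<open>bounded_differences_tail\<close>). The equivalence of the moments of
  order \<open>q\<close> and \<open>2\<close> enters only through a lower bound for the first absolute moment
  (\<open>first_moment_ge\<close>), which passes to block means (\<open>PiM_abs_sum_ge\<close>) and shows that a block mean exceeds
  \<open>\<mu>\<close> in a given direction with probability bounded below (\<open>small_ball_one_sided\<close>).
\<close>

section \<open>Vectors and rational directions\<close>

text \<open>
  The Euclidean norm of the first \<open>d\<close> coordinates. Values at indices \<open>\<ge> d\<close> play no role in
  \<open>ip\<close> and \<open>nrm\<close>, so vectors need not be extensional.
\<close>

definition nrm :: "nat \<Rightarrow> (nat \<Rightarrow> real) \<Rightarrow> real" where
  "nrm d x = sqrt (ip d x x)"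

lemma nrm_L2_set: "nrm d x = L2_set x {..<d}"
  by (simp add: nrm_def ip_def L2_set_def power2_eq_square)

lemma nrm_nonneg [simp]: "0 \<le> nrm d x"
  by (simp add: nrm_L2_set)

lemma nrm_sq: "(nrm d x)\<^sup>2 = ip d x x"
  by (simp add: nrm_def ip_def sum_nonneg)

lemma abs_ip_le: "\<bar>ip d x y\<bar> \<le> nrm d x * nrm d y"
proof -
  have "\<bar>ip d x y\<bar> \<le> (\<Sum>i<d. \<bar>x i\<bar> * \<bar>y i\<bar>)"
    unfolding ip_def by (rule order_trans[OF sum_abs]) (simp add: abs_mult)
  also have "\<dots> \<le> nrm d x * nrm d y" unfolding nrm_L2_set by (rule L2_set_mult_ineq)
  finally show ?thesis .
qed

lemma ip_le: "ip d x y \<le> nrm d x * nrm d y"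
  using abs_ip_le[of d x y] by linarith

lemma abs_coord_le_nrm: "i < d \<Longrightarrow> \<bar>x i\<bar> \<le> nrm d x"
  using member_le_L2_set[of "{..<d}" i "\<lambda>i. \<bar>x i\<bar>"] by (simp add: nrm_L2_set L2_set_def)

lemma ip_diff_left: "ip d (\<lambda>i. x i - y i) u = ip d x u - ip d y u"
  by (simp add: ip_def algebra_simps sum_subtractf)

lemma ip_cong: "(\<And>i. i < d \<Longrightarrow> x i = y i) \<Longrightarrow> (\<And>i. i < d \<Longrightarrow> u i = v i) \<Longrightarrow> ip d x u = ip d y v"
  by (simp add: ip_def)

lemma nrm_cong: "(\<And>i. i < d \<Longrightarrow> x i = y i) \<Longrightarrow> nrm d x = nrm d y"
  unfolding nrm_def by (simp add: ip_cong[of d x y x y])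

lemma ip_vdiff: "ip d (vdiff d x y) u = ip d x u - ip d y u"
  by (simp add: ip_def vdiff_def left_diff_distrib sum_subtractf)

lemma nrm_parallelogram:
  "(nrm d (\<lambda>i. x i - y i))\<^sup>2 = 2 * (nrm d x)\<^sup>2 + 2 * (nrm d y)\<^sup>2 - 4 * (nrm d (\<lambda>i. (x i + y i) / 2))\<^sup>2"
  unfolding nrm_sq ip_def sum_distrib_left sum.distrib[symmetric] sum_subtractf[symmetric]
  by (intro sum.cong refl) (simp add: field_simps)

text \<open>
  Vectors with rational coordinates: a countable dense set, which keeps all suprema and infima
  over vectors measurable.
\<close>

definition rat_vecs :: "nat \<Rightarrow> (nat \<Rightarrow> real) set" where
  "rat_vecs d = PiE {..<d} (\<lambda>_. \<rat>)"

text \<open>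
  The nonzero rational vectors. Inequalities that are positively homogeneous in the direction are
  tested on this countable set instead of on the unit sphere.
\<close>

definition rat_dirs :: "nat \<Rightarrow> (nat \<Rightarrow> real) set" where
  "rat_dirs d = {u \<in> rat_vecs d. 0 < nrm d u}"

lemma countable_rat_vecs: "countable (rat_vecs d)"
  unfolding rat_vecs_def by (intro countable_PiE) (auto simp: countable_rat)

lemma countable_rat_dirs: "countable (rat_dirs d)"
  using countable_rat_vecs[of d] by (rule countable_subset[rotated]) (auto simp: rat_dirs_def)

lemma rat_vecs_dense:
  assumes "0 < e"
  obtains w where "w \<in> rat_vecs d" "nrm d (\<lambda>i. x i - w i) < e"
proof -
  define e' where "e' = e / (real d + 1)"
  have e': "0 < e'" using assms by (simp add: e'_def)
  have "\<exists>r\<in>\<rat>. x i - e' < r \<and> r < x i" for i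
    using Rats_dense_in_real[of "x i - e'" "x i"] e' by simp
  then obtain r where r: "\<And>i. r i \<in> \<rat>" "\<And>i. x i - e' < r i" "\<And>i. r i < x i" by metis
  define w where "w = (\<lambda>i\<in>{..<d}. r i)"
  have "nrm d (\<lambda>i. x i - w i) \<le> (\<Sum>i<d. \<bar>x i - w i\<bar>)"
    unfolding nrm_L2_set by (rule L2_set_le_sum_abs)
  also have "\<dots> \<le> (\<Sum>i<d. e')"
  proof (rule sum_mono)
    fix i assume "i \<in> {..<d}"
    with r(2)[of i] r(3)[of i] show "\<bar>x i - w i\<bar> \<le> e'" by (simp add: w_def)
  qed
  also have "\<dots> < e" using assms by (simp add: e'_def field_simps)
  finally have "nrm d (\<lambda>i. x i - w i) < e" .
  moreover have "w \<in> rat_vecs d" using r(1) by (auto simp: w_def rat_vecs_def)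
  ultimately show ?thesis using that by blast
qed

lemma rat_dirs_minus: "u \<in> rat_dirs d \<Longrightarrow> (\<lambda>i\<in>{..<d}. - u i) \<in> rat_dirs d"
  and ip_restrict_minus: "ip d x (\<lambda>i\<in>{..<d}. - u i) = - ip d x u"
  and nrm_restrict_minus: "nrm d (\<lambda>i\<in>{..<d}. - u i) = nrm d u"
proof -
  show "ip d x (\<lambda>i\<in>{..<d}. - u i) = - ip d x u" for x u by (simp add: ip_def sum_negf)
  show n: "nrm d (\<lambda>i\<in>{..<d}. - u i) = nrm d u" for u by (simp add: ip_def nrm_def)
  show "u \<in> rat_dirs d \<Longrightarrow> (\<lambda>i\<in>{..<d}. - u i) \<in> rat_dirs d"
    using n by (auto simp: rat_dirs_def rat_vecs_def PiE_iff)
qed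

text \<open>
  The \<open>k\<close>-th standard basis vector.
\<close>

definition coord_dir :: "nat \<Rightarrow> nat \<Rightarrow> nat \<Rightarrow> real" where
  "coord_dir d k = (\<lambda>i\<in>{..<d}. if i = k then 1 else 0)"

lemma ip_coord_dir: "k < d \<Longrightarrow> ip d x (coord_dir d k) = x k"
  by (simp add: ip_def coord_dir_def if_distrib[of "\<lambda>t. _ * t"] cong: if_cong)

lemma nrm_coord_dir: "k < d \<Longrightarrow> nrm d (coord_dir d k) = 1"
  by (simp add: nrm_def ip_coord_dir) (simp add: coord_dir_def)

lemma coord_dir_rat_dirs: "k < d \<Longrightarrow> coord_dir d k \<in> rat_dirs d"
  by (auto simp: rat_dirs_def nrm_coord_dir) (auto simp: rat_vecs_def coord_dir_def)

lemma rat_dirs_nonempty: "1 \<le> d \<Longrightarrow> rat_dirs d \<noteq> {}"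
  using coord_dir_rat_dirs[of 0 d] by auto

lemma lim_inverse_Suc: "(\<lambda>k. 1 / real (k + 1)) \<longlonglongrightarrow> 0"
  using LIMSEQ_ignore_initial_segment[OF lim_1_over_n, of 1] by simp

lemma rat_dirs_normalized:
  assumes "u \<in> rat_dirs d"
  obtains w where "w \<in> usphere d" "\<And>i. i < d \<Longrightarrow> w i = u i / nrm d u"
proof -
  have n: "0 < nrm d u" using assms by (simp add: rat_dirs_def)
  define w where "w = (\<lambda>i\<in>{..<d}. u i / nrm d u)"
  have wi: "w i = u i / nrm d u" if "i < d" for i using that by (simp add: w_def)
  have "ip d w w = ip d u u / (nrm d u)\<^sup>2"
    by (simp add: ip_def wi power2_eq_square sum_divide_distrib)
  then have "ip d w w = 1" using n by (simp add: nrm_sq[symmetric])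
  then have "w \<in> usphere d" by (auto simp: usphere_def Rd_def space_PiM w_def)
  with wi that show ?thesis by blast
qed

lemma usphere_from_rat_dirs:
  fixes S :: "nat \<Rightarrow> nat \<Rightarrow> real"
  assumes le: "\<And>u. u \<in> rat_dirs d \<Longrightarrow>
      ip d v u \<le> a * sqrt (\<Sum>i<d. \<Sum>j<d. S i j * u i * u j) + b * nrm d u"
    and u: "nrm d u = 1"
  shows "ip d v u \<le> a * sqrt (\<Sum>i<d. \<Sum>j<d. S i j * u i * u j) + b"
proof -
  have "\<exists>w. w \<in> rat_vecs d \<and> nrm d (\<lambda>i. u i - w i) < 1 / real (k + 2)" for k
    using rat_vecs_dense[of "1 / real (k + 2)" d u] by auto
  then obtain w where w: "\<And>k. w k \<in> rat_vecs d" "\<And>k. nrm d (\<lambda>i. u i - w k i) < 1 / real (k + 2)"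
    by metis
  have dir: "w k \<in> rat_dirs d" for k
  proof -
    have "nrm d u = nrm d (\<lambda>i. (u i - w k i) + w k i)" by simp
    also have "\<dots> \<le> nrm d (\<lambda>i. u i - w k i) + nrm d (w k)"
      unfolding nrm_L2_set by (rule L2_set_triangle_ineq)
    finally have "1 < 1 / real (k + 2) + nrm d (w k)" using u w(2)[of k] by linarith
    moreover have "1 / real (k + 2) \<le> 1" by simp
    ultimately have "0 < nrm d (w k)" by linarith
    then show ?thesis using w(1) by (simp add: rat_dirs_def)
  qed
  have lim: "(\<lambda>k. w k i) \<longlonglongrightarrow> u i" if i: "i < d" for i
  proof -
    have "(\<lambda>k. u i - w k i) \<longlonglongrightarrow> 0"
    proof (rule Lim_null_comparison)
      have "norm (u i - w k i) \<le> 1 / real (k + 2)" for k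
        using abs_coord_le_nrm[OF i, of "\<lambda>i. u i - w k i"] w(2)[of k] by simp
      then show "\<forall>\<^sub>F k in sequentially. norm (u i - w k i) \<le> 1 / real (k + 2)" by simp
      show "(\<lambda>k. 1 / real (k + 2)) \<longlonglongrightarrow> 0"
        using LIMSEQ_ignore_initial_segment[OF lim_1_over_n, of 2] by simp
    qed
    from tendsto_diff[OF tendsto_const[of "u i"] this] show ?thesis by simp
  qed
  have "(\<lambda>k. ip d v (w k)) \<longlonglongrightarrow> ip d v u"
    unfolding ip_def by (intro tendsto_intros lim) auto
  moreover have "(\<lambda>k. a * sqrt (\<Sum>i<d. \<Sum>j<d. S i j * w k i * w k j) + b * nrm d (w k))
     \<longlonglongrightarrow> a * sqrt (\<Sum>i<d. \<Sum>j<d. S i j * u i * u j) + b * nrm d u"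
    unfolding nrm_def ip_def by (intro tendsto_intros lim) auto
  ultimately have "ip d v u \<le> a * sqrt (\<Sum>i<d. \<Sum>j<d. S i j * u i * u j) + b * nrm d u"
    by (rule LIMSEQ_le) (use le[OF dir] in auto)
  then show ?thesis using u by simp
qed

text \<open>
  The error bound is continuous in the direction and, after multiplication of the constant term by
  the norm, positively homogeneous. Hence it may be checked on rational directions.
\<close>

lemma usphere_iff_rat_dirs:
  fixes S :: "nat \<Rightarrow> nat \<Rightarrow> real"
  shows "(\<forall>u\<in>usphere d. ip d v u \<le> a * sqrt (\<Sum>i<d. \<Sum>j<d. S i j * u i * u j) + b)
    \<longleftrightarrow> (\<forall>u\<in>rat_dirs d. ip d v u \<le> a * sqrt (\<Sum>i<d. \<Sum>j<d. S i j * u i * u j) + b * nrm d u)"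
    (is "?l \<longleftrightarrow> ?r")
proof
  assume ?r
  then show ?l using usphere_from_rat_dirs[of d v a S b] by (auto simp: usphere_def nrm_def)
next
  assume l: ?l
  show ?r
  proof
    fix u assume u: "u \<in> rat_dirs d"
    then have n: "0 < nrm d u" by (simp add: rat_dirs_def)
    obtain w where w: "w \<in> usphere d" and wi: "\<And>i. i < d \<Longrightarrow> w i = u i / nrm d u"
      using rat_dirs_normalized[OF u] by blast
    from w l have le: "ip d v w \<le> a * sqrt (\<Sum>i<d. \<Sum>j<d. S i j * w i * w j) + b" by blast
    have ipw: "ip d v w = ip d v u / nrm d u" by (simp add: ip_def wi sum_divide_distrib)
    have "(\<Sum>i<d. \<Sum>j<d. S i j * w i * w j) = (\<Sum>i<d. \<Sum>j<d. S i j * u i * u j) / (nrm d u)\<^sup>2"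
      by (simp add: wi power2_eq_square sum_divide_distrib)
    then have "sqrt (\<Sum>i<d. \<Sum>j<d. S i j * w i * w j) = sqrt (\<Sum>i<d. \<Sum>j<d. S i j * u i * u j) / nrm d u"
      using n by (simp add: real_sqrt_divide)
    with le ipw have "ip d v u / nrm d u \<le> a * (sqrt (\<Sum>i<d. \<Sum>j<d. S i j * u i * u j) / nrm d u) + b" by simp
    then have "ip d v u / nrm d u * nrm d u
        \<le> (a * (sqrt (\<Sum>i<d. \<Sum>j<d. S i j * u i * u j) / nrm d u) + b) * nrm d u"
      using n by (intro mult_right_mono) auto
    then show "ip d v u \<le> a * sqrt (\<Sum>i<d. \<Sum>j<d. S i j * u i * u j) + b * nrm d u"
      using n by (simp add: distrib_right)
  qed
qed

section \<open>The trace of a regularised inverse\<close>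

text \<open>
  The trace of a \<open>d \<times> d\<close> matrix.
\<close>

definition mat_tr :: "nat \<Rightarrow> real mat \<Rightarrow> real" where
  "mat_tr d M = (\<Sum>i<d. M $$ (i, i))"

lemma mat_tr_comm:
  assumes "M \<in> carrier_mat d d" "N \<in> carrier_mat d d"
  shows "mat_tr d (M * N) = mat_tr d (N * M)"
proof -
  have "mat_tr d (M * N) = (\<Sum>i<d. \<Sum>j<d. M $$ (i, j) * N $$ (j, i))"
    using assms by (simp add: mat_tr_def scalar_prod_def atLeast0LessThan)
  also have "\<dots> = (\<Sum>j<d. \<Sum>i<d. N $$ (j, i) * M $$ (i, j))"
    by (subst sum.swap) (simp add: mult.commute)
  also have "\<dots> = mat_tr d (N * M)"
    using assms by (simp add: mat_tr_def scalar_prod_def atLeast0LessThan)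
  finally show ?thesis .
qed

text \<open>
  Only triangularisation is used below, never an orthonormal eigenbasis: the traces of interest are
  invariant under similarity.
\<close>

lemma schur_ordered_eigenvalues:
  assumes S: "S \<in> carrier_mat d d" and ev: "ordered_eigenvalues d S lam"
  obtains B P Q where "S = P * B * Q" "P * Q = 1\<^sub>m d" "Q * P = 1\<^sub>m d"
    "B \<in> carrier_mat d d" "P \<in> carrier_mat d d" "Q \<in> carrier_mat d d"
    "upper_triangular B" "\<And>i. i < d \<Longrightarrow> B $$ (i, i) = lam (Suc i)"
proof -
  define es where "es = map lam [1..<Suc d]"
  have "char_poly S = (\<Prod>e\<leftarrow>es. [:- e, 1:])"
    using ev unfolding ordered_eigenvalues_def es_def
    by (simp add: prod.distinct_set_conv_list[symmetric] comp_def atLeastLessThanSuc_atLeastAtMost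
        del: upt_Suc)
  moreover obtain B P Q where BPQ: "schur_decomposition S es = (B, P, Q)"
    by (cases "schur_decomposition S es") auto
  ultimately have sim: "similar_mat_wit S B P Q" and ut: "upper_triangular B" and dg: "diag_mat B = es"
    using schur_decomposition[OF S] by auto
  note D = similar_mat_witD2[OF S sim]
  have "B $$ (i, i) = lam (Suc i)" if "i < d" for i
  proof -
    have "diag_mat B ! i = B $$ (i, i)" using D that by (simp add: diag_mat_def)
    moreover have "es ! i = lam (Suc i)" using that by (simp add: es_def del: upt_Suc)
    ultimately show ?thesis using dg by simp
  qed
  with D ut that show ?thesis by blast
qed

lemma mat_tr_eigenvalues:
  assumes S: "S \<in> carrier_mat d d" and ev: "ordered_eigenvalues d S lam"
  shows "mat_tr d S = (\<Sum>i\<in>{1..d}. lam i)"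
proof -
  obtain B P Q where D: "S = P * B * Q" "P * Q = 1\<^sub>m d" "Q * P = 1\<^sub>m d"
    "B \<in> carrier_mat d d" "P \<in> carrier_mat d d" "Q \<in> carrier_mat d d"
    and dg: "\<And>i. i < d \<Longrightarrow> B $$ (i, i) = lam (Suc i)"
    using schur_ordered_eigenvalues[OF S ev] by metis
  have "mat_tr d S = mat_tr d (P * (B * Q))" using D by (simp add: assoc_mult_mat[of _ d d _ d _ d])
  also have "\<dots> = mat_tr d (B * Q * P)" using D by (intro mat_tr_comm) auto
  also have "B * Q * P = B" using D by (simp add: assoc_mult_mat[of _ d d _ d _ d])
  also have "mat_tr d B = (\<Sum>i<d. lam (Suc i))" by (simp add: mat_tr_def dg)
  also have "\<dots> = (\<Sum>i\<in>{1..d}. lam i)"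
    by (metis One_nat_def sum.atLeast1_atMost_eq)
  finally show ?thesis .
qed

text \<open>If \<open>T\<close> is the shift \<open>B + r\<close> of an upper triangular matrix, then the solution \<open>Y\<close> of
  \<open>T * Y = B\<close> is upper triangular as well (back substitution), so its diagonal can be read off.\<close>

lemma upper_triangular_solution_diag:
  fixes T B Y :: "real mat"
  assumes T: "T \<in> carrier_mat d d" and B: "B \<in> carrier_mat d d" and Y: "Y \<in> carrier_mat d d"
    and uT: "upper_triangular T" and uB: "upper_triangular B"
    and nz: "\<And>i. i < d \<Longrightarrow> T $$ (i, i) \<noteq> 0" and eq: "T * Y = B"
    and j: "j < d"
  shows "Y $$ (j, j) = B $$ (j, j) / T $$ (j, j)"
proof -
  have ent: "B $$ (i, k) = T $$ (i, i) * Y $$ (i, k) + (\<Sum>l\<in>{Suc i..<d}. T $$ (i, l) * Y $$ (l, k))"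
    if "i < d" "k < d" for i k
  proof -
    have "B $$ (i, k) = (\<Sum>l\<in>{0..<d}. T $$ (i, l) * Y $$ (l, k))"
      using that T Y by (simp add: eq[symmetric] scalar_prod_def)
    also have "\<dots> = (\<Sum>l\<in>{i..<d}. T $$ (i, l) * Y $$ (l, k))"
      using that T uT by (intro sum.mono_neutral_right) auto
    also have "\<dots> = T $$ (i, i) * Y $$ (i, k) + (\<Sum>l\<in>{Suc i..<d}. T $$ (i, l) * Y $$ (l, k))"
      using that by (simp add: sum.atLeast_Suc_lessThan)
    finally show ?thesis .
  qed
  have low: "j < i \<Longrightarrow> i < d \<Longrightarrow> Y $$ (i, j) = 0" for i
  proof (induction "d - i" arbitrary: i rule: less_induct)
    case less
    have "(\<Sum>l\<in>{Suc i..<d}. T $$ (i, l) * Y $$ (l, j)) = 0"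
      using less by (intro sum.neutral) auto
    moreover have "B $$ (i, j) = 0" using less uB B by auto
    ultimately show ?case using ent[of i j] nz[of i] less j by simp
  qed
  have "(\<Sum>l\<in>{Suc j..<d}. T $$ (j, l) * Y $$ (l, j)) = 0"
    using low by (intro sum.neutral) auto
  with ent[of j j] nz[of j] j show ?thesis by simp
qed

lemma psd_Cauchy_Schwarz:
  fixes B :: "nat \<Rightarrow> nat \<Rightarrow> real"
  assumes sym: "\<And>i j. i < d \<Longrightarrow> j < d \<Longrightarrow> B i j = B j i"
    and psd: "\<And>v. 0 \<le> (\<Sum>i<d. \<Sum>j<d. B i j * v i * v j)"
  shows "(\<Sum>i<d. \<Sum>j<d. B i j * z i * u j)\<^sup>2
     \<le> (\<Sum>i<d. \<Sum>j<d. B i j * z i * z j) * (\<Sum>i<d. \<Sum>j<d. B i j * u i * u j)"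
proof -
  define b where "b = (\<lambda>z u. \<Sum>i<d. \<Sum>j<d. B i j * z i * u j)"
  have bsym: "b u z = b z u"
    unfolding b_def
    by (subst sum.swap) (intro sum.cong refl, use sym in \<open>auto simp: mult_ac\<close>)
  have expand: "b (\<lambda>i. s * z i + t * u i) (\<lambda>i. s * z i + t * u i)
     = s * s * b z z + 2 * s * t * b z u + t * t * b u u" for s t
  proof -
    have "b (\<lambda>i. s * z i + t * u i) (\<lambda>i. s * z i + t * u i)
       = s * s * b z z + s * t * b z u + s * t * b u z + t * t * b u u"
      unfolding b_def sum_distrib_left sum.distrib[symmetric]
      by (intro sum.cong refl) (simp add: algebra_simps)
    then show ?thesis by (simp add: bsym)
  qed
  have nn: "0 \<le> s * s * b z z + 2 * s * t * b z u + t * t * b u u" for s t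
    using psd[of "\<lambda>i. s * z i + t * u i"] expand[of s t] by (simp add: b_def)
  have "(b z u)\<^sup>2 \<le> b z z * b u u"
  proof (cases "b u u = 0")
    case False
    then have pos: "0 < b u u" using nn[of 0 1] by simp
    from nn[of "b u u" "- b z u"] have "0 \<le> b u u * (b u u * b z z - b z u * b z u)"
      by (simp add: algebra_simps)
    with pos show ?thesis by (simp add: zero_le_mult_iff power2_eq_square mult.commute)
  next
    case True
    have "b z u = 0"
    proof (rule ccontr)
      assume n: "b z u \<noteq> 0"
      from nn[of 1 "- (b z z + 1) / (2 * b z u)"] True n show False
        by (simp add: field_simps) 
    qed
    with True show ?thesis by simp
  qed
  then show ?thesis by (simp add: b_def)
qed

text \<open>
  The matrix \<open>G\<close> is the inverse of \<open>S + r I\<close>. By the Cauchy-Schwarz inequality for the form of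
  \<open>S + r I\<close>, the form of \<open>G\<close> bounds all normalised linear functionals at once. If \<open>S\<close> is a covariance
  matrix, the sum in the last conclusion is the expected value of the form of \<open>G\<close> at the centred
  random vector; for any set of eigenvalues, it is at most their number plus the sum of the others
  over \<open>r\<close>.
\<close>

lemma resolvent_form:
  fixes S :: "real mat" and r :: real
  assumes S: "S \<in> carrier_mat d d" and ev: "ordered_eigenvalues d S lam" and r: "0 < r"
    and sym: "\<And>i j. i < d \<Longrightarrow> j < d \<Longrightarrow> S $$ (i, j) = S $$ (j, i)"
    and psd: "\<And>v. 0 \<le> (\<Sum>i<d. \<Sum>j<d. S $$ (i, j) * v i * v j)"
  obtains G :: "nat \<Rightarrow> nat \<Rightarrow> real" where
    "\<And>w. 0 \<le> (\<Sum>i<d. \<Sum>j<d. G i j * w i * w j)"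
    "\<And>w u. (ip d w u)\<^sup>2 \<le> (\<Sum>i<d. \<Sum>j<d. G i j * w i * w j)
        * ((\<Sum>i<d. \<Sum>j<d. S $$ (i, j) * u i * u j) + r * ip d u u)"
    "(\<Sum>i<d. \<Sum>j<d. G i j * S $$ (i, j)) = (\<Sum>i\<in>{1..d}. lam i / (lam i + r))"
proof -
  define A where "A = S + r \<cdot>\<^sub>m 1\<^sub>m d"
  have A: "A \<in> carrier_mat d d" using S by (simp add: A_def)
  have Aij: "A $$ (i, j) = S $$ (i, j) + (if i = j then r else 0)" if "i < d" "j < d" for i j
    using that S by (simp add: A_def)
  have form: "(\<Sum>i<d. \<Sum>j<d. A $$ (i, j) * u i * u j)
      = (\<Sum>i<d. \<Sum>j<d. S $$ (i, j) * u i * u j) + r * ip d u u" for u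
  proof -
    have "(\<Sum>j<d. A $$ (i, j) * u i * u j)
        = (\<Sum>j<d. S $$ (i, j) * u i * u j) + r * (u i * u i)" if "i < d" for i
    proof -
      have "(\<Sum>j<d. A $$ (i, j) * u i * u j)
        = (\<Sum>j<d. S $$ (i, j) * u i * u j + (if j = i then r * (u i * u i) else 0))"
        using that by (intro sum.cong refl) (auto simp: Aij algebra_simps)
      also have "\<dots> = (\<Sum>j<d. S $$ (i, j) * u i * u j) + r * (u i * u i)"
        using that by (simp add: sum.distrib)
      finally show ?thesis .
    qed
    then have "(\<Sum>i<d. \<Sum>j<d. A $$ (i, j) * u i * u j)
        = (\<Sum>i<d. (\<Sum>j<d. S $$ (i, j) * u i * u j) + r * (u i * u i))"
      by simp
    also have "\<dots> = (\<Sum>i<d. \<Sum>j<d. S $$ (i, j) * u i * u j) + r * ip d u u"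
      by (simp add: ip_def sum.distrib sum_distrib_left)
    finally show ?thesis .
  qed
  have ipnn: "0 \<le> ip d u u" for u by (simp add: ip_def sum_nonneg)
  have Apsd: "0 \<le> (\<Sum>i<d. \<Sum>j<d. A $$ (i, j) * u i * u j)" for u
    unfolding form using psd[of u] ipnn[of u] r by (simp add: mult_nonneg_nonneg)
  have "det A \<noteq> 0"
  proof
    assume "det A = 0"
    then obtain v where v: "v \<in> carrier_vec d" "v \<noteq> 0\<^sub>v d" "A *\<^sub>v v = 0\<^sub>v d"
      using det_0_iff_vec_prod_zero_field[OF A] by auto
    have "(\<Sum>j<d. A $$ (i, j) * v $ j) = 0" if "i < d" for i
    proof -
      have "(A *\<^sub>v v) $ i = (\<Sum>j<d. A $$ (i, j) * v $ j)"
        using that A v(1) by (simp add: scalar_prod_def atLeast0LessThan)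
      then show ?thesis using v(3) that by simp
    qed
    then have "(\<Sum>i<d. \<Sum>j<d. A $$ (i, j) * v $ i * v $ j) = 0"
      by (simp add: mult.commute mult.left_commute sum_distrib_left[symmetric])
    with form[of "\<lambda>i. v $ i"] psd[of "\<lambda>i. v $ i"] ipnn[of "\<lambda>i. v $ i"] r
    have "ip d (\<lambda>i. v $ i) (\<lambda>i. v $ i) = 0"
      by (smt (verit) mult_pos_pos)
    then have "v $ i = 0" if "i < d" for i
      using that unfolding ip_def by (subst (asm) sum_nonneg_eq_0_iff) auto
    then have "v = 0\<^sub>v d" using v(1) by (intro eq_vecI) auto
    with v show False by simp
  qed
  from det_non_zero_imp_unit[OF A this, of undefined]
  obtain G where GA: "G * A = 1\<^sub>m d" and AG: "A * G = 1\<^sub>m d" and G: "G \<in> carrier_mat d d"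
    unfolding Units_def ring_mat_def by auto
  define z where "z = (\<lambda>w i. \<Sum>j<d. G $$ (i, j) * w j)"
  have Az: "(\<Sum>j<d. A $$ (i, j) * z w j) = w i" if "i < d" for i w
  proof -
    have "(\<Sum>j<d. A $$ (i, j) * z w j) = (\<Sum>j<d. \<Sum>k<d. A $$ (i, j) * G $$ (j, k) * w k)"
      by (simp add: z_def sum_distrib_left mult.assoc)
    also have "\<dots> = (\<Sum>k<d. (\<Sum>j<d. A $$ (i, j) * G $$ (j, k)) * w k)"
      by (subst sum.swap) (simp add: sum_distrib_right)
    also have "\<dots> = (\<Sum>k<d. (A * G) $$ (i, k) * w k)"
      using that A G by (intro sum.cong refl) (simp add: scalar_prod_def atLeast0LessThan)
    also have "\<dots> = (\<Sum>k<d. if k = i then w k else 0)"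
      unfolding AG using that by (intro sum.cong refl) auto
    finally show ?thesis using that by simp
  qed
  have Asym: "A $$ (i, j) = A $$ (j, i)" if "i < d" "j < d" for i j
    using that sym by (simp add: Aij)
  have Bzu: "(\<Sum>i<d. \<Sum>j<d. A $$ (i, j) * z w i * u j) = ip d w u" for w u
  proof -
    have "(\<Sum>i<d. \<Sum>j<d. A $$ (i, j) * z w i * u j) = (\<Sum>j<d. \<Sum>i<d. A $$ (j, i) * z w i * u j)"
      by (subst sum.swap) (intro sum.cong refl, use Asym in auto)
    also have "\<dots> = (\<Sum>j<d. (\<Sum>i<d. A $$ (j, i) * z w i) * u j)"
      by (simp add: sum_distrib_right)
    finally show ?thesis by (simp add: Az ip_def)
  qed
  have Gw: "(\<Sum>i<d. \<Sum>j<d. G $$ (i, j) * w i * w j) = ip d w (z w)" for w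
    by (simp add: ip_def z_def sum_distrib_left mult_ac)
  show ?thesis
  proof (rule that[of "\<lambda>i j. G $$ (i, j)"])
    show "0 \<le> (\<Sum>i<d. \<Sum>j<d. G $$ (i, j) * w i * w j)" for w
      unfolding Gw Bzu[symmetric] by (rule Apsd)
    show "(ip d w u)\<^sup>2 \<le> (\<Sum>i<d. \<Sum>j<d. G $$ (i, j) * w i * w j)
        * ((\<Sum>i<d. \<Sum>j<d. S $$ (i, j) * u i * u j) + r * ip d u u)" for w u
      using psd_Cauchy_Schwarz[of d "\<lambda>i j. A $$ (i, j)" "z w" u] Asym Apsd
      unfolding Gw form[symmetric] Bzu by simp
    obtain B P Q where D: "S = P * B * Q" "P * Q = 1\<^sub>m d" "Q * P = 1\<^sub>m d"
      "B \<in> carrier_mat d d" "P \<in> carrier_mat d d" "Q \<in> carrier_mat d d" "upper_triangular B"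
      and dg: "\<And>i. i < d \<Longrightarrow> B $$ (i, i) = lam (Suc i)"
      using schur_ordered_eigenvalues[OF S ev] by metis
    define Y where "Y = Q * (G * S * P)"
    define T where "T = B + r \<cdot>\<^sub>m 1\<^sub>m d"
    have T: "T \<in> carrier_mat d d" and Y: "Y \<in> carrier_mat d d"
      using D G S by (auto simp: T_def Y_def)
    have uT: "upper_triangular T" using D by (auto simp: T_def upper_triangular_def)
    have QSP: "Q * S * P = B"
    proof -
      have "Q * S * P = (Q * P) * B * (Q * P)"
        unfolding D(1) using D(4,5,6) by (simp add: assoc_mult_mat[of _ d d _ d _ d])
      then show ?thesis using D by simp
    qed
    have QAP: "Q * A * P = T"
    proof -
      have "Q * A * P = Q * S * P + r \<cdot>\<^sub>m (Q * P)"
        unfolding A_def using D(5,6) S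
        by (simp add: mult_add_distrib_mat[of _ d d _ d] add_mult_distrib_mat[of _ d d]
            mult_smult_distrib[of _ d d _ d] mult_smult_assoc_mat[of _ d d _ d])
      then show ?thesis using D QSP by (simp add: T_def)
    qed
    have "T * Y = Q * A * (P * Q) * (G * S * P)"
      unfolding QAP[symmetric] Y_def using D(5,6) A G S
      by (simp add: assoc_mult_mat[of _ d d _ d _ d])
    also have "\<dots> = Q * (A * G) * S * P"
      using D(2,5,6) A G S by (simp add: assoc_mult_mat[of _ d d _ d _ d])
    also have "\<dots> = B" using AG D QSP by simp
    finally have TY: "T * Y = B" .
    have lamnn: "0 \<le> lam (Suc i)" if "i < d" for i using ev that by (auto simp: ordered_eigenvalues_def)
    have Tii: "T $$ (i, i) = lam (Suc i) + r" if "i < d" for i using that D dg by (simp add: T_def)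
    have Yii: "Y $$ (i, i) = lam (Suc i) / (lam (Suc i) + r)" if "i < d" for i
      using upper_triangular_solution_diag[OF T D(4) Y uT D(7) _ TY that] Tii lamnn r dg that
      by (simp add: add_nonneg_eq_0_iff less_imp_neq)
    have "mat_tr d Y = mat_tr d (G * S * P * Q)"
      unfolding Y_def using D G S by (intro mat_tr_comm) auto
    also have "G * S * P * Q = G * S"
      using D(2,5,6) G S by (simp add: assoc_mult_mat[of _ d d _ d _ d])
    also have "mat_tr d (G * S) = (\<Sum>i<d. \<Sum>j<d. G $$ (i, j) * S $$ (j, i))"
      using G S by (simp add: mat_tr_def scalar_prod_def atLeast0LessThan)
    also have "\<dots> = (\<Sum>i<d. \<Sum>j<d. G $$ (i, j) * S $$ (i, j))"
      using sym by (intro sum.cong refl) auto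
    finally have "(\<Sum>i<d. \<Sum>j<d. G $$ (i, j) * S $$ (i, j)) = (\<Sum>i<d. lam (Suc i) / (lam (Suc i) + r))"
      by (simp add: mat_tr_def Yii)
    also have "\<dots> = (\<Sum>i\<in>{1..d}. lam i / (lam i + r))"
      by (metis (no_types, lifting) One_nat_def sum.atLeast1_atMost_eq sum.cong)
    finally show "(\<Sum>i<d. \<Sum>j<d. G $$ (i, j) * S $$ (i, j)) = (\<Sum>i\<in>{1..d}. lam i / (lam i + r))" .
  qed
qed

section \<open>Bounded differences\<close>

text \<open>
  McDiarmid's method: the coordinates are integrated out one at a time, and each step is an instance
  of Hoeffding's lemma. The crude range \<open>[-1, 1]\<close> of the centred increments is used instead of an
  interval of length one, which costs a factor four in the exponent.
\<close>

lemma bounded_differences_mgf: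
  fixes f :: "(nat \<Rightarrow> 'a) \<Rightarrow> real" and l :: real
  assumes Q: "prob_space Q" and l: "0 < l"
    and meas: "f \<in> borel_measurable (\<Pi>\<^sub>M j\<in>{..<n}. Q)"
    and bdd: "\<And>x. x \<in> space (\<Pi>\<^sub>M j\<in>{..<n}. Q) \<Longrightarrow> \<bar>f x\<bar> \<le> B"
    and diff: "\<And>x j z. x \<in> space (\<Pi>\<^sub>M j\<in>{..<n}. Q) \<Longrightarrow> j < n \<Longrightarrow> z \<in> space Q \<Longrightarrow>
        \<bar>f (x(j := z)) - f x\<bar> \<le> 1"
  shows "(\<integral>x. exp (l * f x) \<partial>(\<Pi>\<^sub>M j\<in>{..<n}. Q))
     \<le> exp (l * (\<integral>x. f x \<partial>(\<Pi>\<^sub>M j\<in>{..<n}. Q)) + real n * l\<^sup>2 / 2)"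
  using meas bdd diff
proof (induction n arbitrary: f)
  case 0
  interpret P: prob_space "\<Pi>\<^sub>M j\<in>{..<0::nat}. Q" by (intro prob_space_PiM Q)
  define x0 :: "nat \<Rightarrow> 'a" where "x0 = (\<lambda>_. undefined)"
  have sp: "x = x0" if "x \<in> space (\<Pi>\<^sub>M j\<in>{..<0::nat}. Q)" for x
    using that by (simp add: space_PiM x0_def)
  have "(\<integral>x. h x \<partial>(\<Pi>\<^sub>M j\<in>{..<0::nat}. Q)) = h x0" for h :: "(nat \<Rightarrow> 'a) \<Rightarrow> real"
  proof -
    have "(\<integral>x. h x \<partial>(\<Pi>\<^sub>M j\<in>{..<0::nat}. Q)) = (\<integral>x. h x0 \<partial>(\<Pi>\<^sub>M j\<in>{..<0::nat}. Q))"
      by (rule Bochner_Integration.integral_cong[OF refl]) (drule sp, simp)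
    then show ?thesis by (simp add: P.prob_space del: lessThan_0)
  qed
  from this[of "\<lambda>x. exp (l * f x)"] this[of f] show ?case by simp
next
  case (Suc n)
  interpret Q: prob_space Q by fact
  interpret S: product_sigma_finite "\<lambda>_. Q" ..
  let ?P = "\<Pi>\<^sub>M j\<in>{..<n}. Q" and ?P' = "\<Pi>\<^sub>M j\<in>{..<Suc n}. Q"
  interpret P: prob_space ?P by (intro prob_space_PiM Q)
  interpret P': prob_space ?P' by (intro prob_space_PiM Q)
  interpret PQ: pair_prob_space ?P Q ..
  have ins: "{..<Suc n} = insert n {..<n}" by auto
  note [measurable] = Suc.prems(1)
  have upd[measurable]: "(\<lambda>(x, z). x(n := z)) \<in> ?P \<Otimes>\<^sub>M Q \<rightarrow>\<^sub>M ?P'"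
    unfolding ins by (rule measurable_add_dim)
  have upds: "x(n := z) \<in> space ?P'" if "x \<in> space ?P" "z \<in> space Q" for x z
    using that by (auto simp: space_PiM PiE_iff extensional_def)
  have fm[measurable]: "(\<lambda>(x, z). f (x(n := z))) \<in> borel_measurable (?P \<Otimes>\<^sub>M Q)"
    using measurable_compose[OF upd Suc.prems(1)] by (simp add: case_prod_beta)
  define g where "g = (\<lambda>x. \<integral>z. f (x(n := z)) \<partial>Q)"
  have gm[measurable]: "g \<in> borel_measurable ?P"
    unfolding g_def by (rule Q.borel_measurable_lebesgue_integral[OF fm])
  have fx[measurable]: "(\<lambda>z. f (x(n := z))) \<in> borel_measurable Q" if "x \<in> space ?P" for x
    using measurable_compose[OF measurable_Pair1'[OF that] fm] by simp
  have int_fx: "integrable Q (\<lambda>z. f (x(n := z)))" if "x \<in> space ?P" for x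
    using Suc.prems(2)[OF upds[OF that]] fx[OF that]
    by (intro Q.integrable_const_bound[of _ B] AE_I2) (auto simp del: fun_upd_apply)
  have gb: "\<bar>g x\<bar> \<le> B" if "x \<in> space ?P" for x
  proof -
    have "\<bar>g x\<bar> \<le> (\<integral>z. \<bar>f (x(n := z))\<bar> \<partial>Q)" unfolding g_def by (rule integral_abs_bound)
    also have "\<dots> \<le> (\<integral>z. B \<partial>Q)"
      using Suc.prems(2)[OF upds[OF that]] int_fx[OF that]
      by (intro integral_mono) (auto simp del: fun_upd_apply)
    finally show ?thesis by (simp add: Q.prob_space)
  qed
  have gd: "\<bar>g (x(j := z)) - g x\<bar> \<le> 1" if x: "x \<in> space ?P" and j: "j < n" and z: "z \<in> space Q" for x j z
  proof -
    have x': "x(j := z) \<in> space ?P" using x j z by (auto simp: space_PiM PiE_iff extensional_def)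
    have "g (x(j := z)) - g x = (\<integral>y. f ((x(j := z))(n := y)) - f (x(n := y)) \<partial>Q)"
      unfolding g_def using int_fx[OF x] int_fx[OF x'] by simp
    also have "\<bar>\<dots>\<bar> \<le> (\<integral>y. \<bar>f ((x(j := z))(n := y)) - f (x(n := y))\<bar> \<partial>Q)" by (rule integral_abs_bound)
    also have "\<dots> \<le> (\<integral>y. 1 \<partial>Q)"
    proof (rule integral_mono)
      fix y assume "y \<in> space Q"
      with Suc.prems(3)[OF upds[OF x this], of j z] j z
      show "\<bar>f ((x(j := z))(n := y)) - f (x(n := y))\<bar> \<le> 1" by (simp add: fun_upd_twist del: fun_upd_apply)
    qed (use int_fx[OF x] int_fx[OF x'] in auto)
    finally show ?thesis by (simp add: Q.prob_space)
  qed
  have inner: "(\<integral>z. exp (l * f (x(n := z))) \<partial>Q) \<le> exp (l * g x) * exp (l\<^sup>2 / 2)" if x: "x \<in> space ?P" for x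
  proof -
    have rng: "\<bar>f (x(n := z)) - g x\<bar> \<le> 1" if z: "z \<in> space Q" for z
    proof -
      have "f (x(n := z)) - g x = (\<integral>y. f (x(n := z)) - f (x(n := y)) \<partial>Q)"
        unfolding g_def using int_fx[OF x] by (simp add: Q.prob_space)
      also have "\<bar>\<dots>\<bar> \<le> (\<integral>y. \<bar>f (x(n := z)) - f (x(n := y))\<bar> \<partial>Q)" by (rule integral_abs_bound)
      also have "\<dots> \<le> (\<integral>y. 1 \<partial>Q)"
      proof (rule integral_mono)
        fix y assume "y \<in> space Q"
        with Suc.prems(3)[OF upds[OF x this], of n z] z
        show "\<bar>f (x(n := z)) - f (x(n := y))\<bar> \<le> 1"
          by (simp del: fun_upd_apply)
      qed (use int_fx[OF x] in auto)
      finally show ?thesis by (simp add: Q.prob_space)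
    qed
    interpret I: interval_bounded_random_variable Q "\<lambda>z. f (x(n := z)) - g x" "-1" 1
    proof
      show "(\<lambda>z. f (x(n := z)) - g x) \<in> borel_measurable Q" using fx[OF x] by simp
      have "f (x(n := z)) - g x \<in> {-1..1}" if "z \<in> space Q" for z
        using rng[OF that] unfolding abs_le_iff atLeastAtMost_iff by linarith
      then show "AE z in Q. f (x(n := z)) - g x \<in> {-1..1}" by (rule AE_I2)
    qed
    have z0: "Q.expectation (\<lambda>z. f (x(n := z)) - g x) = 0"
      using int_fx[OF x] by (simp add: g_def Q.prob_space)
    have "(\<integral>\<^sup>+z. exp (l * (f (x(n := z)) - g x)) \<partial>Q) \<le> ennreal (exp (l\<^sup>2 * (1 - (-1))\<^sup>2 / 8))"
      by (rule I.Hoeffdings_lemma_nn_integral_0[OF l z0])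
    then have "(\<integral>z. exp (l * (f (x(n := z)) - g x)) \<partial>Q) \<le> exp (l\<^sup>2 * (1 - (-1))\<^sup>2 / 8)"
      using fx[OF x] by (subst integral_eq_nn_integral) (auto intro!: enn2real_leI)
    then have "(\<integral>z. exp (l * (f (x(n := z)) - g x)) \<partial>Q) \<le> exp (l\<^sup>2 / 2)" by simp
    moreover have "(\<integral>z. exp (l * f (x(n := z))) \<partial>Q)
        = (\<integral>z. exp (l * g x) * exp (l * (f (x(n := z)) - g x)) \<partial>Q)"
      by (simp add: mult_exp_exp algebra_simps)
    ultimately show ?thesis by simp
  qed
  have ef_int: "integrable ?P' (\<lambda>x. exp (l * f x))"
    using Suc.prems(2) l by (intro P'.integrable_const_bound[of _ "exp (l * B)"] AE_I2) (auto simp: abs_le_iff)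
  have f_int: "integrable ?P' f"
    using Suc.prems(2) by (intro P'.integrable_const_bound[of _ B] AE_I2) auto
  have eg_int: "integrable ?P (\<lambda>x. exp (l * g x))"
    using gb l by (intro P.integrable_const_bound[of _ "exp (l * B)"] AE_I2) (auto simp: abs_le_iff)
  have "(\<integral>x. exp (l * f x) \<partial>?P') = (\<integral>x. (\<integral>z. exp (l * f (x(n := z))) \<partial>Q) \<partial>?P)"
    using ef_int unfolding ins by (subst S.product_integral_insert) auto
  also have "\<dots> \<le> (\<integral>x. exp (l * g x) * exp (l\<^sup>2 / 2) \<partial>?P)"
  proof (rule integral_mono')
    show "integrable ?P (\<lambda>x. exp (l * g x) * exp (l\<^sup>2 / 2))" using eg_int by simp
  qed (use inner in auto)
  also have "\<dots> = exp (l\<^sup>2 / 2) * (\<integral>x. exp (l * g x) \<partial>?P)" by simp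
  also have "(\<integral>x. exp (l * g x) \<partial>?P) \<le> exp (l * (\<integral>x. g x \<partial>?P) + real n * l\<^sup>2 / 2)"
    by (rule Suc.IH[OF gm gb gd])
  also have "(\<integral>x. g x \<partial>?P) = (\<integral>x. f x \<partial>?P')"
    using f_int unfolding ins g_def by (subst S.product_integral_insert) auto
  also have "exp (l\<^sup>2 / 2) * exp (l * (\<integral>x. f x \<partial>?P') + real n * l\<^sup>2 / 2)
      = exp (l * (\<integral>x. f x \<partial>?P') + real (Suc n) * l\<^sup>2 / 2)"
    by (simp add: mult_exp_exp field_simps)
  finally show ?case by simp
qed

lemma bounded_differences_tail:
  fixes f :: "(nat \<Rightarrow> 'a) \<Rightarrow> real" and t :: real
  assumes Q: "prob_space Q" and t: "0 < t"
    and meas: "f \<in> borel_measurable (\<Pi>\<^sub>M j\<in>{..<n}. Q)"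
    and bdd: "\<And>x. x \<in> space (\<Pi>\<^sub>M j\<in>{..<n}. Q) \<Longrightarrow> \<bar>f x\<bar> \<le> B"
    and diff: "\<And>x j z. x \<in> space (\<Pi>\<^sub>M j\<in>{..<n}. Q) \<Longrightarrow> j < n \<Longrightarrow> z \<in> space Q \<Longrightarrow>
        \<bar>f (x(j := z)) - f x\<bar> \<le> 1"
  shows "\<P>(x in (\<Pi>\<^sub>M j\<in>{..<n}. Q). (\<integral>x. f x \<partial>(\<Pi>\<^sub>M j\<in>{..<n}. Q)) + real n * t \<le> f x)
     \<le> exp (- real n * t\<^sup>2 / 2)"
proof -
  let ?P = "\<Pi>\<^sub>M j\<in>{..<n}. Q"
  interpret P: prob_space ?P by (intro prob_space_PiM Q)
  note [measurable] = meas
  define E where "E = (\<integral>x. f x \<partial>?P)"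
  have int: "integrable ?P (\<lambda>x. exp (t * f x))"
    using bdd t by (intro P.integrable_const_bound[of _ "exp (t * B)"] AE_I2) (auto simp: abs_le_iff)
  have "\<P>(x in ?P. E + real n * t \<le> f x) = \<P>(x in ?P. exp (t * (E + real n * t)) \<le> exp (t * f x))"
    using t by simp
  also have "\<dots> \<le> (\<integral>x. exp (t * f x) \<partial>?P) / exp (t * (E + real n * t))"
    using int by (intro integral_Markov_inequality_measure[where A = "{}"]) auto
  also have "\<dots> \<le> exp (t * E + real n * t\<^sup>2 / 2) / exp (t * (E + real n * t))"
    using bounded_differences_mgf[OF Q t meas bdd diff] by (intro divide_right_mono) (auto simp: E_def)
  also have "\<dots> = exp (- real n * t\<^sup>2 / 2)"
    by (simp add: exp_diff[symmetric] algebra_simps power2_eq_square)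
  finally show ?thesis by (simp add: E_def)
qed

section \<open>Suprema of empirical processes\<close>

lemma (in prob_space) expectation_unit_interval:
  fixes f :: "'a \<Rightarrow> real"
  assumes "f \<in> borel_measurable M" "\<And>x. 0 \<le> f x" "\<And>x. f x \<le> 1"
  shows "integrable M f" "0 \<le> expectation f" "expectation f \<le> 1"
proof -
  show i: "integrable M f" using assms by (intro integrable_const_bound[of _ 1] AE_I2) auto
  show "0 \<le> expectation f" using assms by (intro Bochner_Integration.integral_nonneg) auto
  have "expectation f \<le> expectation (\<lambda>x. 1)" by (rule integral_mono) (use i assms in auto)
  then show "expectation f \<le> 1" by (simp add: prob_space)
qed

lemma abs_cSUP_le:
  fixes a :: "'i \<Rightarrow> real"
  assumes "U \<noteq> {}" "\<And>u. u \<in> U \<Longrightarrow> \<bar>a u\<bar> \<le> B"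
  shows "\<bar>SUP u\<in>U. a u\<bar> \<le> B" "bdd_above (a ` U)"
proof -
  show bdd: "bdd_above (a ` U)" by (rule bdd_aboveI[of _ B]) (use assms(2) in \<open>force simp: abs_le_iff\<close>)
  have "(SUP u\<in>U. a u) \<le> B" by (rule cSUP_least) (use assms in \<open>auto simp: abs_le_iff\<close>)
  moreover obtain u where u: "u \<in> U" using assms(1) by auto
  have "a u \<le> (SUP u\<in>U. a u)" by (rule cSUP_upper[OF u bdd])
  ultimately show "\<bar>SUP u\<in>U. a u\<bar> \<le> B" using assms(2)[OF u] by (simp add: abs_le_iff)
qed

text \<open>
  The contraction principle for a single random sign. Both suprema on the left are approached at a
  pair of indices \<open>u\<close>, \<open>v\<close>, and \<open>\<psi> (y u) - \<psi> (y v)\<close> is dominated by \<open>K * (y u - y v)\<close> or by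
  \<open>K * (y v - y u)\<close>, both of which the right-hand side takes into account.
\<close>

lemma contraction_two_signs:
  fixes h y :: "'i \<Rightarrow> real" and \<psi> :: "real \<Rightarrow> real"
  assumes U: "U \<noteq> {}"
    and b1: "bdd_above ((\<lambda>u. h u + K * y u) ` U)" and b2: "bdd_above ((\<lambda>u. h u - K * y u) ` U)"
    and lip: "\<And>a b. \<bar>\<psi> a - \<psi> b\<bar> \<le> K * \<bar>a - b\<bar>"
  shows "(SUP u\<in>U. h u + \<psi> (y u)) + (SUP u\<in>U. h u - \<psi> (y u))
     \<le> (SUP u\<in>U. h u + K * y u) + (SUP u\<in>U. h u - K * y u)" (is "?A + ?B \<le> ?R")
proof -
  have pair: "(h u + \<psi> (y u)) + (h v - \<psi> (y v)) \<le> ?R" if u: "u \<in> U" and v: "v \<in> U" for u v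
  proof -
    have "h u + K * y u + (h v - K * y v) \<le> ?R" 
      by (rule add_mono[OF cSUP_upper[OF u b1] cSUP_upper[OF v b2]])
    moreover have "h v + K * y v + (h u - K * y u) \<le> ?R" 
      by (rule add_mono[OF cSUP_upper[OF v b1] cSUP_upper[OF u b2]])
    moreover have "\<psi> (y u) - \<psi> (y v) \<le> K * \<bar>y u - y v\<bar>"
      using lip[of "y u" "y v"] by (simp add: abs_le_iff)
    moreover have "K * \<bar>y u - y v\<bar> = K * y u - K * y v \<or> K * \<bar>y u - y v\<bar> = K * y v - K * y u"
      by (simp add: abs_if right_diff_distrib)
    ultimately show ?thesis by linarith
  qed
  have "?A \<le> ?R - (h v - \<psi> (y v))" if v: "v \<in> U" for v
    using pair[OF _ v] by (intro cSUP_least[OF U]) (simp add: algebra_simps)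
  then have "?B \<le> ?R - ?A"
    by (intro cSUP_least[OF U]) (simp add: algebra_simps)
  then show ?thesis by simp
qed

text \<open>
  Symmetrisation and contraction for one observation. Splitting the supremum into two halves makes a
  ghost sample superfluous: the half that contains the means is bounded by Jensen's inequality.
\<close>

lemma symmetrization_one_step:
  fixes h :: "'i \<Rightarrow> real" and y :: "'i \<Rightarrow> 'a \<Rightarrow> real" and \<psi> :: "real \<Rightarrow> real"
  assumes Q: "prob_space Q" and U: "countable U" "U \<noteq> {}"
    and h: "\<And>u. u \<in> U \<Longrightarrow> \<bar>h u\<bar> \<le> H"
    and ym: "\<And>u. u \<in> U \<Longrightarrow> y u \<in> borel_measurable Q"
    and yG: "\<And>u z. u \<in> U \<Longrightarrow> z \<in> space Q \<Longrightarrow> \<bar>y u z\<bar> \<le> G z" and G: "integrable Q G"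
    and pm[measurable]: "\<psi> \<in> borel_measurable borel" and p01: "\<And>t. 0 \<le> \<psi> t" "\<And>t. \<psi> t \<le> 1"
    and lip: "\<And>a b. \<bar>\<psi> a - \<psi> b\<bar> \<le> L * \<bar>a - b\<bar>" and L: "0 \<le> L"
  shows "(\<integral>z. (SUP u\<in>U. h u + (\<psi> (y u z) - (\<integral>z. \<psi> (y u z) \<partial>Q))) \<partial>Q)
     \<le> ((\<integral>z. (SUP u\<in>U. h u + 2 * L * y u z) \<partial>Q) + (\<integral>z. (SUP u\<in>U. h u - 2 * L * y u z) \<partial>Q)) / 2"
proof -
  interpret Q: prob_space Q by fact
  note [measurable] = ym
  define E where "E = (\<lambda>u. \<integral>z. \<psi> (y u z) \<partial>Q)"
  note unit = Q.expectation_unit_interval[OF measurable_compose[OF ym pm] p01]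
  have pint: "integrable Q (\<lambda>z. \<psi> (y u z))" if "u \<in> U" for u using unit(1)[OF that] .
  have E01: "0 \<le> E u" "E u \<le> 1" if "u \<in> U" for u unfolding E_def using unit(2,3)[OF that] by auto
  have bp: "\<bar>h u + 2 * \<psi> (y u z)\<bar> \<le> H + 2" "\<bar>h u - 2 * \<psi> (y u z)\<bar> \<le> H + 2"
    "\<bar>h u + (\<psi> (y u z) - E u)\<bar> \<le> H + 2" "\<bar>h u - 2 * E u\<bar> \<le> H + 2" if "u \<in> U" for u z
    using h[OF that] p01[of "y u z"] E01[OF that] by (auto simp: abs_le_iff)
  have by1: "\<bar>h u + 2 * L * y u z\<bar> \<le> H + 2 * L * G z" "\<bar>h u - 2 * L * y u z\<bar> \<le> H + 2 * L * G z"
    if "u \<in> U" "z \<in> space Q" for u z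
  proof -
    have "\<bar>2 * L * y u z\<bar> \<le> 2 * L * G z" using yG[OF that] L by (simp add: abs_mult mult_left_mono)
    with h[OF that(1)] show "\<bar>h u + 2 * L * y u z\<bar> \<le> H + 2 * L * G z" "\<bar>h u - 2 * L * y u z\<bar> \<le> H + 2 * L * G z"
      by (auto simp: abs_le_iff)
  qed
  note SB = abs_cSUP_le[OF U(2)]
  have i1: "integrable Q (\<lambda>z. SUP u\<in>U. h u + 2 * \<psi> (y u z))"
    using SB[OF bp(1)] U by (intro Q.integrable_const_bound[of _ "H + 2"] AE_I2 borel_measurable_cSUP) auto
  have i2: "integrable Q (\<lambda>z. SUP u\<in>U. h u - 2 * \<psi> (y u z))"
    using SB[OF bp(2)] U by (intro Q.integrable_const_bound[of _ "H + 2"] AE_I2 borel_measurable_cSUP) auto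
  have i3: "integrable Q (\<lambda>z. SUP u\<in>U. h u + (\<psi> (y u z) - E u))"
    using SB[OF bp(3)] U by (intro Q.integrable_const_bound[of _ "H + 2"] AE_I2 borel_measurable_cSUP) auto
  have iG: "integrable Q (\<lambda>z. H + 2 * L * G z)" using G by simp
  have i4: "integrable Q (\<lambda>z. SUP u\<in>U. h u + 2 * L * y u z)"
  proof (rule Bochner_Integration.integrable_bound[OF iG])
    show "AE z in Q. norm (SUP u\<in>U. h u + 2 * L * y u z) \<le> norm (H + 2 * L * G z)"
      by (rule AE_I2) (use SB(1)[OF by1(1)] in force)
  qed (use U SB(2)[OF by1(1)] in \<open>intro borel_measurable_cSUP, auto\<close>)
  have i5: "integrable Q (\<lambda>z. SUP u\<in>U. h u - 2 * L * y u z)"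
  proof (rule Bochner_Integration.integrable_bound[OF iG])
    show "AE z in Q. norm (SUP u\<in>U. h u - 2 * L * y u z) \<le> norm (H + 2 * L * G z)"
      by (rule AE_I2) (use SB(1)[OF by1(2)] in force)
  qed (use U SB(2)[OF by1(2)] in \<open>intro borel_measurable_cSUP, auto\<close>)
  have bd1: "bdd_above ((\<lambda>u. h u + 2 * \<psi> (y u z)) ` U)"
    and bd2: "bdd_above ((\<lambda>u. h u - 2 * \<psi> (y u z)) ` U)"
    and bd4: "bdd_above ((\<lambda>u. h u - 2 * E u) ` U)" for z
    by (rule SB(2)[OF bp(1)] SB(2)[OF bp(2)] SB(2)[OF bp(4)], assumption)+
  define R where "R = (SUP u\<in>U. h u - 2 * E u)"
  \<comment> \<open>half of \<open>h\<close> goes with \<open>\<psi> (y u z)\<close>, the other half with the mean\<close>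
  have half: "2 * (SUP u\<in>U. h u + (\<psi> (y u z) - E u)) \<le> (SUP u\<in>U. h u + 2 * \<psi> (y u z)) + R" for z
  proof -
    have "(SUP u\<in>U. h u + (\<psi> (y u z) - E u)) \<le> ((SUP u\<in>U. h u + 2 * \<psi> (y u z)) + R) / 2"
    proof (rule cSUP_least[OF U(2)])
      fix u assume u: "u \<in> U"
      from cSUP_upper[OF u bd1[of z]] cSUP_upper[OF u bd4]
      show "h u + (\<psi> (y u z) - E u) \<le> ((SUP u\<in>U. h u + 2 * \<psi> (y u z)) + R) / 2"
        unfolding R_def by simp
    qed
    then show ?thesis by simp
  qed
  have jensen: "R \<le> (\<integral>z. (SUP u\<in>U. h u - 2 * \<psi> (y u z)) \<partial>Q)"
    unfolding R_def
  proof (rule cSUP_least[OF U(2)])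
    fix u assume u: "u \<in> U"
    have "h u - 2 * E u = (\<integral>z. h u - 2 * \<psi> (y u z) \<partial>Q)"
      using pint[OF u] by (simp add: E_def Q.prob_space)
    also have "\<dots> \<le> (\<integral>z. (SUP u\<in>U. h u - 2 * \<psi> (y u z)) \<partial>Q)"
      using pint[OF u] i2 cSUP_upper[OF u bd2] by (intro integral_mono) auto
    finally show "h u - 2 * E u \<le> (\<integral>z. (SUP u\<in>U. h u - 2 * \<psi> (y u z)) \<partial>Q)" .
  qed
  have "2 * (\<integral>z. (SUP u\<in>U. h u + (\<psi> (y u z) - E u)) \<partial>Q)
      = (\<integral>z. 2 * (SUP u\<in>U. h u + (\<psi> (y u z) - E u)) \<partial>Q)" by simp
  also have "\<dots> \<le> (\<integral>z. (SUP u\<in>U. h u + 2 * \<psi> (y u z)) + R \<partial>Q)"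
    using i1 i3 half by (intro integral_mono) auto
  also have "\<dots> = (\<integral>z. (SUP u\<in>U. h u + 2 * \<psi> (y u z)) \<partial>Q) + R"
    using i1 by (simp add: Q.prob_space)
  also have "\<dots> \<le> (\<integral>z. (SUP u\<in>U. h u + 2 * \<psi> (y u z)) + (SUP u\<in>U. h u - 2 * \<psi> (y u z)) \<partial>Q)"
    using jensen i1 i2 by simp
  also have "\<dots> \<le> (\<integral>z. (SUP u\<in>U. h u + 2 * L * y u z) + (SUP u\<in>U. h u - 2 * L * y u z) \<partial>Q)"
  proof (rule integral_mono)
    fix z assume z: "z \<in> space Q"
    have lip2: "\<bar>2 * \<psi> a - 2 * \<psi> b\<bar> \<le> 2 * L * \<bar>a - b\<bar>" for a b
      using lip[of a b] by (simp add: abs_le_iff)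
    show "(SUP u\<in>U. h u + 2 * \<psi> (y u z)) + (SUP u\<in>U. h u - 2 * \<psi> (y u z))
       \<le> (SUP u\<in>U. h u + 2 * L * y u z) + (SUP u\<in>U. h u - 2 * L * y u z)"
      by (rule contraction_two_signs[OF U(2) SB(2)[OF by1(1)] SB(2)[OF by1(2)], where \<psi> = "\<lambda>t. 2 * \<psi> t"])
        (use z lip2 in auto)
  qed (use i1 i2 i4 i5 in auto)
  also have "\<dots> = (\<integral>z. (SUP u\<in>U. h u + 2 * L * y u z) \<partial>Q) + (\<integral>z. (SUP u\<in>U. h u - 2 * L * y u z) \<partial>Q)"
    using i4 i5 by simp
  finally show ?thesis by (simp add: E_def)
qed

lemma (in prob_space) expectation_sqrt_le:
  assumes "integrable M f" "\<And>x. x \<in> space M \<Longrightarrow> 0 \<le> f x"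
  shows "integrable M (\<lambda>x. sqrt (f x))" "expectation (\<lambda>x. sqrt (f x)) \<le> sqrt (expectation f)"
proof -
  show i: "integrable M (\<lambda>x. sqrt (f x))"
  proof (rule Bochner_Integration.integrable_bound)
    show "integrable M (\<lambda>x. 1 + f x)" using assms by simp
    have "sqrt t \<le> 1 + t" if "0 \<le> t" for t :: real
      by (rule real_le_lsqrt) (use that in \<open>auto simp: power2_eq_square algebra_simps\<close>)
    then show "AE x in M. norm (sqrt (f x)) \<le> norm (1 + f x)" by (intro AE_I2) (use assms(2) in force)
  qed (use assms in auto)
  have "(expectation (\<lambda>x. sqrt (f x)))\<^sup>2 \<le> expectation (\<lambda>x. (sqrt (f x))\<^sup>2)"
  proof -
    have sq: "expectation (\<lambda>x. (sqrt (f x))\<^sup>2) = expectation f" "integrable M (\<lambda>x. (sqrt (f x))\<^sup>2)"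
      using assms by (auto cong: Bochner_Integration.integral_cong Bochner_Integration.integrable_cong)
    have "0 \<le> variance (\<lambda>x. sqrt (f x))" by simp
    also have "\<dots> = expectation (\<lambda>x. (sqrt (f x))\<^sup>2) - (expectation (\<lambda>x. sqrt (f x)))\<^sup>2"
      by (rule variance_eq[OF i sq(2)])
    finally show ?thesis by simp
  qed
  also have "\<dots> = expectation f" using assms by (auto cong: Bochner_Integration.integral_cong)
  finally show "expectation (\<lambda>x. sqrt (f x)) \<le> sqrt (expectation f)" by (rule real_le_rsqrt)
qed

lemma (in pair_prob_space) integrable_snd_only:
  fixes g :: "'b \<Rightarrow> real"
  assumes "integrable M2 g"
  shows "integrable (M1 \<Otimes>\<^sub>M M2) (\<lambda>(x, z). g z)"
proof (rule Fubini_integrable)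
  show "(\<lambda>(x, z). g z) \<in> borel_measurable (M1 \<Otimes>\<^sub>M M2)" using assms by measurable
qed (use assms in auto)

text \<open>
  Here \<open>e u\<close> are linear functionals that are dominated by the square root of a quadratic form \<open>q\<close>;
  the latter is only required to satisfy the parallelogram law. The induction on the sample size
  replaces one observation after the other by a symmetrised linear term, which is absorbed into the
  free vector \<open>w\<close>; averaging over the two signs of this term, the parallelogram law increases \<open>q w\<close>
  by the mean of \<open>q (c z)\<close> exactly.
\<close>

lemma expected_empirical_sup:
  fixes e :: "'i \<Rightarrow> 'w::ab_group_add \<Rightarrow> real" and q :: "'w \<Rightarrow> real" and c :: "'a \<Rightarrow> 'w"
    and \<psi> :: "real \<Rightarrow> real"
  assumes Q: "prob_space Q" and U: "countable U" "U \<noteq> {}"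
    and add: "\<And>u v w. u \<in> U \<Longrightarrow> e u (v + w) = e u v + e u w"
    and q0: "\<And>w. 0 \<le> q w" and par: "\<And>v w. q (v + w) + q (v - w) = 2 * q v + 2 * q w"
    and eq: "\<And>u w. u \<in> U \<Longrightarrow> e u w \<le> sqrt (q w)"
    and em: "\<And>u. u \<in> U \<Longrightarrow> (\<lambda>z. e u (c z)) \<in> borel_measurable Q"
    and qm: "\<And>w. (\<lambda>z. q (w + c z)) \<in> borel_measurable Q"
    and qi: "integrable Q (\<lambda>z. q (c z))"
    and pm: "\<psi> \<in> borel_measurable borel" and p01: "\<And>t. 0 \<le> \<psi> t" "\<And>t. \<psi> t \<le> 1"
    and lip: "\<And>a b. \<bar>\<psi> a - \<psi> b\<bar> \<le> L * \<bar>a - b\<bar>" and L: "0 \<le> L"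
  shows "(\<integral>x. (SUP u\<in>U. 2 * L * e u w + (\<Sum>j<n. \<psi> (e u (c (x j))) - (\<integral>z. \<psi> (e u (c z)) \<partial>Q))) \<partial>(\<Pi>\<^sub>M j\<in>{..<n}. Q))
     \<le> 2 * L * sqrt (q w + real n * (\<integral>z. q (c z) \<partial>Q))"
proof -
  interpret Q: prob_space Q by fact
  interpret S: product_sigma_finite "\<lambda>_. Q" ..
  note [measurable] = em qm pm
  define E where "E = (\<lambda>u. \<integral>z. \<psi> (e u (c z)) \<partial>Q)"
  define \<tau> where "\<tau> = (\<integral>z. q (c z) \<partial>Q)"
  define D where "D = (\<lambda>(n::nat) w (x :: nat \<Rightarrow> 'a). SUP u\<in>U. 2 * L * e u w + (\<Sum>j<n. \<psi> (e u (c (x j))) - E u))"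
  have q_0: "q 0 = 0" using par[of 0 0] by simp
  have q_minus: "q (- w) = q w" for w using par[of 0 w] q_0 by simp
  have e_0: "e u 0 = 0" if "u \<in> U" for u using add[OF that, of 0 0] by simp
  have e_minus: "e u (- w) = - e u w" if "u \<in> U" for u w
    using add[OF that, of w "- w"] e_0[OF that] by simp
  have e_diff: "e u (v - w) = e u v - e u w" if "u \<in> U" for u v w
    using add[OF that, of v "- w"] e_minus[OF that] by simp
  have eabs: "\<bar>e u w\<bar> \<le> sqrt (q w)" if "u \<in> U" for u w
    using eq[OF that, of w] eq[OF that, of "- w"] e_minus[OF that, of w] q_minus[of w] by (simp add: abs_le_iff)
  have qm2[measurable]: "(\<lambda>z. q (w - c z)) \<in> borel_measurable Q" for w
  proof -
    have eq: "q (w - c z) = 2 * q w + 2 * q (0 + c z) - q (w + c z)" for z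
      using par[of w "c z"] by simp
    show ?thesis
      unfolding eq by (intro borel_measurable_diff borel_measurable_add borel_measurable_times borel_measurable_const qm)
  qed
  have qb: "q (w + v) \<le> 2 * q w + 2 * q v" "q (w - v) \<le> 2 * q w + 2 * q v" for w v
    using par[of w v] q0[of "w + v"] q0[of "w - v"] by auto
  have qi2: "integrable Q (\<lambda>z. q (w + c z))" "integrable Q (\<lambda>z. q (w - c z))" for w
  proof -
    have i: "integrable Q (\<lambda>z. 2 * q w + 2 * q (c z))" using qi by simp
    show "integrable Q (\<lambda>z. q (w + c z))"
      by (rule Bochner_Integration.integrable_bound[OF i]) (use qb(1) q0 in \<open>auto intro!: AE_I2\<close>)
    show "integrable Q (\<lambda>z. q (w - c z))"
      by (rule Bochner_Integration.integrable_bound[OF i]) (use qb(2) q0 in \<open>auto intro!: AE_I2\<close>)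
  qed
  have E01: "0 \<le> E u" "E u \<le> 1" if "u \<in> U" for u
    unfolding E_def using Q.expectation_unit_interval[OF measurable_compose[OF em[OF that] pm] p01] by auto
  have sumb: "\<bar>\<Sum>j<m. \<psi> (e u (c (x j))) - E u\<bar> \<le> real m" if "u \<in> U" for u m and x :: "nat \<Rightarrow> 'a"
  proof -
    have "\<bar>\<psi> (e u (c (x j))) - E u\<bar> \<le> 1" for j
      using p01[of "e u (c (x j))"] E01[OF that] by (auto simp: abs_le_iff)
    then have "(\<Sum>j<m. \<bar>\<psi> (e u (c (x j))) - E u\<bar>) \<le> (\<Sum>j<m. 1)" by (intro sum_mono) auto
    also have "(\<Sum>j<m. 1) = real m" by simp
    finally show ?thesis by (rule order_trans[OF sum_abs])
  qed
  have Db0: "\<bar>2 * L * e u v + (\<Sum>j<m. \<psi> (e u (c (x j))) - E u)\<bar> \<le> 2 * L * sqrt (q v) + real m"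
    if "u \<in> U" for u v m and x :: "nat \<Rightarrow> 'a"
  proof -
    have "\<bar>2 * L * e u v\<bar> \<le> 2 * L * sqrt (q v)"
      using eabs[OF that, of v] L by (simp add: abs_mult mult_left_mono)
    with sumb[OF that, of x m] show ?thesis by (auto simp: abs_le_iff)
  qed
  have Db: "\<bar>D m v x\<bar> \<le> 2 * L * sqrt (q v) + real m"
    and Dbdd: "bdd_above ((\<lambda>u. 2 * L * e u v + (\<Sum>j<m. \<psi> (e u (c (x j))) - E u)) ` U)" for m v and x :: "nat \<Rightarrow> 'a"
    unfolding D_def by (rule abs_cSUP_le[OF U(2)], erule Db0)+
  have Dmeas: "D m v \<in> borel_measurable (\<Pi>\<^sub>M j\<in>{..<m}. Q)" for m v
    unfolding D_def
  proof (rule borel_measurable_cSUP[OF U(1) _ Dbdd])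
    fix u assume u: "u \<in> U"
    note [measurable] = em[OF u]
    show "(\<lambda>x. 2 * L * e u v + (\<Sum>j<m. \<psi> (e u (c (x j))) - E u)) \<in> borel_measurable (\<Pi>\<^sub>M j\<in>{..<m}. Q)"
      by measurable
  qed
  have main: "integral\<^sup>L (\<Pi>\<^sub>M j\<in>{..<n}. Q) (D n w) \<le> 2 * L * sqrt (q w + real n * \<tau>)" for n w
  proof (induction n arbitrary: w)
    case 0
    interpret P: prob_space "\<Pi>\<^sub>M j\<in>{..<0::nat}. Q" by (intro prob_space_PiM Q)
    have c: "D 0 w = (\<lambda>_. D 0 w undefined)" by (simp add: D_def)
    have "integral\<^sup>L (\<Pi>\<^sub>M j\<in>{..<0::nat}. Q) (D 0 w) = D 0 w undefined"
      by (subst c) (simp add: P.prob_space del: lessThan_0)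
    also have "\<dots> \<le> 2 * L * sqrt (q w)" using Db[of 0 w undefined] by (simp add: abs_le_iff)
    finally show ?case by simp
  next
    case (Suc n)
    let ?P = "\<Pi>\<^sub>M j\<in>{..<n}. Q" and ?P' = "\<Pi>\<^sub>M j\<in>{..<Suc n}. Q"
    interpret P: prob_space ?P by (intro prob_space_PiM Q)
    interpret P': prob_space ?P' by (intro prob_space_PiM Q)
    interpret PQ: pair_prob_space ?P Q ..
    have ins: "{..<Suc n} = insert n {..<n}" by auto
    have meas': "D (Suc n) w \<in> borel_measurable ?P'"
      by (rule Dmeas)
    have Dint: "integrable ?P' (D (Suc n) w)"
      by (rule P'.integrable_const_bound[OF _ meas', of "2 * L * sqrt (q w) + real (Suc n)"])
        (rule AE_I2, use Db[of "Suc n" w] in simp)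
    have Dn_int: "integrable ?P (D n v)" for v
    proof (rule P.integrable_const_bound[of _ "2 * L * sqrt (q v) + real n"])
      show "D n v \<in> borel_measurable ?P"
        by (rule Dmeas)
    qed (rule AE_I2, use Db[of n v] in simp)
    have pairm: "(\<lambda>(x, z). D n (f z) x) \<in> borel_measurable (?P \<Otimes>\<^sub>M Q)"
      if f: "f = (\<lambda>z. w + c z) \<or> f = (\<lambda>z. w - c z)" for f
    proof -
      have "(\<lambda>p. SUP u\<in>U. 2 * L * e u (f (snd p)) + (\<Sum>j<n. \<psi> (e u (c (fst p j))) - E u))
          \<in> borel_measurable (?P \<Otimes>\<^sub>M Q)"
      proof (intro borel_measurable_cSUP U Dbdd)
        fix u assume u: "u \<in> U"
        have [measurable]: "(\<lambda>z. e u (f z)) \<in> borel_measurable Q"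
          using f em[OF u] by (auto simp: add[OF u] e_diff[OF u])
        note [measurable] = em[OF u]
        show "(\<lambda>p. 2 * L * e u (f (snd p)) + (\<Sum>j<n. \<psi> (e u (c (fst p j))) - E u))
           \<in> borel_measurable (?P \<Otimes>\<^sub>M Q)" by measurable
      qed
      then show ?thesis by (simp add: D_def case_prod_beta)
    qed
    have sq_int: "integrable Q (\<lambda>z. sqrt (q (f z) + r))" "integrable Q (\<lambda>z. sqrt (q (f z)))"
      if f: "f = (\<lambda>z. w + c z) \<or> f = (\<lambda>z. w - c z)" and r: "0 \<le> r" for f r
    proof -
      have "integrable Q (\<lambda>z. q (f z))" using f qi2 by auto
      then show "integrable Q (\<lambda>z. sqrt (q (f z) + r))" "integrable Q (\<lambda>z. sqrt (q (f z)))"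
        using q0 r by (auto intro!: Q.expectation_sqrt_le(1))
    qed
    have pairi: "integrable (?P \<Otimes>\<^sub>M Q) (\<lambda>(x, z). D n (f z) x)"
      if f: "f = (\<lambda>z. w + c z) \<or> f = (\<lambda>z. w - c z)" for f
    proof (rule Bochner_Integration.integrable_bound[OF _ pairm[OF f]])
      have "integrable Q (\<lambda>z. 2 * L * sqrt (q (f z)) + real n)" using sq_int(2)[OF f order_refl] by simp
      then show "integrable (?P \<Otimes>\<^sub>M Q) (\<lambda>(x, z). 2 * L * sqrt (q (f z)) + real n)"
        by (rule PQ.integrable_snd_only)
      have "norm (D n (f z) x) \<le> norm (2 * L * sqrt (q (f z)) + real n)" for x z
        using Db[of n "f z" x] unfolding real_norm_def by linarith
      then show "AE p in ?P \<Otimes>\<^sub>M Q. norm (case p of (x, z) \<Rightarrow> D n (f z) x)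
          \<le> norm (case p of (x, z) \<Rightarrow> 2 * L * sqrt (q (f z)) + real n)"
        by (intro AE_I2) (simp add: case_prod_beta)
    qed
    have tau0: "0 \<le> \<tau>" unfolding \<tau>_def using q0 by (intro Bochner_Integration.integral_nonneg) auto
    have half: "(\<integral>x. (\<integral>z. D n (f z) x \<partial>Q) \<partial>?P) \<le> 2 * L * (\<integral>z. sqrt (q (f z) + real n * \<tau>) \<partial>Q)"
      if f: "f = (\<lambda>z. w + c z) \<or> f = (\<lambda>z. w - c z)" for f
    proof -
      have "(\<integral>x. (\<integral>z. D n (f z) x \<partial>Q) \<partial>?P) = (\<integral>z. (\<integral>x. D n (f z) x \<partial>?P) \<partial>Q)"
        using PQ.Fubini_integral[OF pairi[OF f]] by simp
      also have "\<dots> \<le> (\<integral>z. 2 * L * sqrt (q (f z) + real n * \<tau>) \<partial>Q)"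
      proof (rule integral_mono)
        show "integrable Q (\<lambda>z. \<integral>x. D n (f z) x \<partial>?P)" using PQ.integrable_snd[OF pairi[OF f]] .
        show "integrable Q (\<lambda>z. 2 * L * sqrt (q (f z) + real n * \<tau>))"
          using sq_int(1)[OF f, of "real n * \<tau>"] tau0 by simp
      qed (rule Suc.IH)
      finally show ?thesis by simp
    qed
    have one: "(\<integral>z. D (Suc n) w (x(n := z)) \<partial>Q)
       \<le> ((\<integral>z. D n (w + c z) x \<partial>Q) + (\<integral>z. D n (w - c z) x \<partial>Q)) / 2" for x
    proof -
      define h where "h = (\<lambda>u. 2 * L * e u w + (\<Sum>j<n. \<psi> (e u (c (x j))) - E u))"
      have "(\<integral>z. (SUP u\<in>U. h u + (\<psi> (e u (c z)) - (\<integral>z. \<psi> (e u (c z)) \<partial>Q))) \<partial>Q)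
         \<le> ((\<integral>z. (SUP u\<in>U. h u + 2 * L * e u (c z)) \<partial>Q) + (\<integral>z. (SUP u\<in>U. h u - 2 * L * e u (c z)) \<partial>Q)) / 2"
      proof (rule symmetrization_one_step[OF Q U, where H = "2 * L * sqrt (q w) + real n" and G = "\<lambda>z. sqrt (q (c z))"])
        show "integrable Q (\<lambda>z. sqrt (q (c z)))" using qi q0 by (intro Q.expectation_sqrt_le(1))
      qed (use Db0 em eabs pm p01 lip L in \<open>auto simp: h_def\<close>)
      moreover have "D (Suc n) w (x(n := z)) = (SUP u\<in>U. h u + (\<psi> (e u (c z)) - (\<integral>z. \<psi> (e u (c z)) \<partial>Q)))" for z
        by (simp add: D_def h_def E_def add.assoc)
      moreover have "D n (w + c z) x = (SUP u\<in>U. h u + 2 * L * e u (c z))" for z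
        unfolding D_def h_def by (intro SUP_cong refl) (simp add: add algebra_simps)
      moreover have "D n (w - c z) x = (SUP u\<in>U. h u - 2 * L * e u (c z))" for z
        unfolding D_def h_def by (intro SUP_cong refl) (simp add: e_diff algebra_simps)
      ultimately show ?thesis by simp
    qed
    have iP: "integrable ?P (\<lambda>x. \<integral>z. D n (f z) x \<partial>Q)"
      if f: "f = (\<lambda>z. w + c z) \<or> f = (\<lambda>z. w - c z)" for f
      using PQ.integrable_fst[OF pairi[OF f]] .
    let ?fp = "\<lambda>z. w + c z" and ?fm = "\<lambda>z. w - c z"
    have "integral\<^sup>L ?P' (D (Suc n) w) = (\<integral>x. (\<integral>z. D (Suc n) w (x(n := z)) \<partial>Q) \<partial>?P)"
      using Dint unfolding ins by (subst S.product_integral_insert) auto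
    also have "\<dots> \<le> (\<integral>x. ((\<integral>z. D n (w + c z) x \<partial>Q) + (\<integral>z. D n (w - c z) x \<partial>Q)) / 2 \<partial>?P)"
    proof (rule integral_mono)
      have "integrable (?P \<Otimes>\<^sub>M Q) (\<lambda>(x, z). D (Suc n) w (x(n := z)))"
      proof (rule PQ.integrable_const_bound[of _ "2 * L * sqrt (q w) + real (Suc n)"])
        have "(\<lambda>(x, z). x(n := z)) \<in> ?P \<Otimes>\<^sub>M Q \<rightarrow>\<^sub>M ?P'"
          unfolding ins by (rule measurable_add_dim)
        from measurable_compose[OF this meas']
        show "(\<lambda>(x, z). D (Suc n) w (x(n := z))) \<in> borel_measurable (?P \<Otimes>\<^sub>M Q)"
          by (simp add: case_prod_beta)
      qed (rule AE_I2, use Db[of "Suc n" w] in \<open>simp add: case_prod_beta\<close>)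
      from PQ.integrable_fst[OF this]
      show "integrable ?P (\<lambda>x. \<integral>z. D (Suc n) w (x(n := z)) \<partial>Q)" .
      show "integrable ?P (\<lambda>x. ((\<integral>z. D n (w + c z) x \<partial>Q) + (\<integral>z. D n (w - c z) x \<partial>Q)) / 2)"
        using iP[of ?fp] iP[of ?fm] by simp
    qed (rule one)
    also have "\<dots> = ((\<integral>x. (\<integral>z. D n (w + c z) x \<partial>Q) \<partial>?P) + (\<integral>x. (\<integral>z. D n (w - c z) x \<partial>Q) \<partial>?P)) / 2"
      using iP[of ?fp] iP[of ?fm] by simp
    also have "\<dots> \<le> (2 * L * (\<integral>z. sqrt (q (w + c z) + real n * \<tau>) \<partial>Q)
        + 2 * L * (\<integral>z. sqrt (q (w - c z) + real n * \<tau>) \<partial>Q)) / 2"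
      using half[of ?fp] half[of ?fm] by simp
    also have "\<dots> = 2 * L * (\<integral>z. (sqrt (q (w + c z) + real n * \<tau>) + sqrt (q (w - c z) + real n * \<tau>)) / 2 \<partial>Q)"
      using sq_int(1)[of ?fp "real n * \<tau>"] sq_int(1)[of ?fm "real n * \<tau>"] tau0
      by (simp add: algebra_simps add_divide_distrib)
    also have "\<dots> \<le> 2 * L * (\<integral>z. sqrt (q w + real n * \<tau> + q (c z)) \<partial>Q)"
    proof (intro mult_left_mono integral_mono)
      fix z
      have conc: "(sqrt a + sqrt b) / 2 \<le> sqrt ((a + b) / 2)" if "0 \<le> a" "0 \<le> b" for a b :: real
      proof (rule real_le_rsqrt)
        have "0 \<le> (sqrt a - sqrt b)\<^sup>2" by simp
        then show "((sqrt a + sqrt b) / 2)\<^sup>2 \<le> (a + b) / 2"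
          using that by (simp add: power2_sum power2_diff power_divide)
      qed
      have avg: "(q (w + c z) + real n * \<tau> + (q (w - c z) + real n * \<tau>)) / 2 = q w + real n * \<tau> + q (c z)"
        using par[of w "c z"] by (simp add: field_simps)
      have "0 \<le> q (w + c z) + real n * \<tau>" "0 \<le> q (w - c z) + real n * \<tau>" using q0 tau0 by simp_all
      from conc[OF this]
      show "(sqrt (q (w + c z) + real n * \<tau>) + sqrt (q (w - c z) + real n * \<tau>)) / 2
          \<le> sqrt (q w + real n * \<tau> + q (c z))" unfolding avg .
    next
      show "integrable Q (\<lambda>z. (sqrt (q (w + c z) + real n * \<tau>) + sqrt (q (w - c z) + real n * \<tau>)) / 2)"
        using sq_int(1)[of ?fp "real n * \<tau>"] sq_int(1)[of ?fm "real n * \<tau>"] tau0 by simp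
      show "integrable Q (\<lambda>z. sqrt (q w + real n * \<tau> + q (c z)))"
        using qi q0 tau0 by (intro Q.expectation_sqrt_le(1)) auto
    qed (use L in simp)
    also have "\<dots> \<le> 2 * L * sqrt (\<integral>z. q w + real n * \<tau> + q (c z) \<partial>Q)"
      using qi q0 tau0 L by (intro mult_left_mono Q.expectation_sqrt_le(2)) auto
    also have "(\<integral>z. q w + real n * \<tau> + q (c z) \<partial>Q) = q w + real (Suc n) * \<tau>"
      using qi by (simp add: \<tau>_def Q.prob_space algebra_simps)
    finally show ?case .
  qed
  show ?thesis using main[of n w] by (simp add: D_def E_def \<tau>_def)
qed

text \<open>
  The supremum of the empirical process changes by at most one when a single observation changes, so
  it concentrates around its expectation.
\<close>

lemma uniform_deviation:
  fixes e :: "'i \<Rightarrow> 'w::ab_group_add \<Rightarrow> real" and q :: "'w \<Rightarrow> real" and c :: "'a \<Rightarrow> 'w"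
    and \<psi> :: "real \<Rightarrow> real"
  assumes Q: "prob_space Q" and U: "countable U" "U \<noteq> {}"
    and add: "\<And>u v w. u \<in> U \<Longrightarrow> e u (v + w) = e u v + e u w"
    and q0: "\<And>w. 0 \<le> q w" and par: "\<And>v w. q (v + w) + q (v - w) = 2 * q v + 2 * q w"
    and eq: "\<And>u w. u \<in> U \<Longrightarrow> e u w \<le> sqrt (q w)"
    and em: "\<And>u. u \<in> U \<Longrightarrow> (\<lambda>z. e u (c z)) \<in> borel_measurable Q"
    and qm: "\<And>w. (\<lambda>z. q (w + c z)) \<in> borel_measurable Q"
    and qi: "integrable Q (\<lambda>z. q (c z))"
    and pm: "\<psi> \<in> borel_measurable borel" and p01: "\<And>t. 0 \<le> \<psi> t" "\<And>t. \<psi> t \<le> 1"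
    and lip: "\<And>a b. \<bar>\<psi> a - \<psi> b\<bar> \<le> L * \<bar>a - b\<bar>" and L: "0 \<le> L" and t: "0 < t"
  shows "{x \<in> space (\<Pi>\<^sub>M j\<in>{..<n}. Q). \<exists>u\<in>U. real n * (\<integral>z. \<psi> (e u (c z)) \<partial>Q)
        + 2 * L * sqrt (real n * (\<integral>z. q (c z) \<partial>Q)) + real n * t < (\<Sum>j<n. \<psi> (e u (c (x j))))}
        \<in> sets (\<Pi>\<^sub>M j\<in>{..<n}. Q)" (is "?A \<in> _")
    and "\<P>(x in (\<Pi>\<^sub>M j\<in>{..<n}. Q). \<exists>u\<in>U. real n * (\<integral>z. \<psi> (e u (c z)) \<partial>Q)
        + 2 * L * sqrt (real n * (\<integral>z. q (c z) \<partial>Q)) + real n * t < (\<Sum>j<n. \<psi> (e u (c (x j)))))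
      \<le> exp (- real n * t\<^sup>2 / 2)"
proof -
  interpret Q: prob_space Q by fact
  let ?P = "\<Pi>\<^sub>M j\<in>{..<n}. Q"
  interpret P: prob_space ?P by (intro prob_space_PiM Q)
  note [measurable] = pm
  define E where "E = (\<lambda>u. \<integral>z. \<psi> (e u (c z)) \<partial>Q)"
  define h where "h = (\<lambda>(x :: nat \<Rightarrow> 'a) u. \<Sum>j<n. \<psi> (e u (c (x j))) - E u)"
  define f where "f = (\<lambda>x. SUP u\<in>U. h x u)"
  have q_0: "q 0 = 0" using par[of 0 0] by simp
  have e_0: "e u 0 = 0" if "u \<in> U" for u using add[OF that, of 0 0] by simp
  have E01: "0 \<le> E u" "E u \<le> 1" if "u \<in> U" for u
    unfolding E_def using Q.expectation_unit_interval[OF measurable_compose[OF em[OF that] pm] p01] by auto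
  have hb: "\<bar>h x u\<bar> \<le> real n" if "u \<in> U" for u x
  proof -
    have "\<bar>\<psi> (e u (c (x j))) - E u\<bar> \<le> 1" for j
      using p01[of "e u (c (x j))"] E01[OF that] by (auto simp: abs_le_iff)
    then have "(\<Sum>j<n. \<bar>\<psi> (e u (c (x j))) - E u\<bar>) \<le> (\<Sum>j<n. 1)" by (intro sum_mono) auto
    also have "(\<Sum>j<n. 1) = real n" by simp
    finally show ?thesis unfolding h_def by (rule order_trans[OF sum_abs])
  qed
  have fb: "\<bar>f x\<bar> \<le> real n" and bdd: "bdd_above (h x ` U)" for x
    unfolding f_def by (rule abs_cSUP_le[OF U(2)], erule hb)+
  have hm: "(\<lambda>x. h x u) \<in> borel_measurable ?P" if u: "u \<in> U" for u
  proof -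
    note [measurable] = em[OF u]
    show ?thesis unfolding h_def by measurable
  qed
  have fm: "f \<in> borel_measurable ?P"
    unfolding f_def by (rule borel_measurable_cSUP[OF U(1) hm bdd])
  have upd: "f (x(j := z)) \<le> f x + 1" if j: "j < n" for x j z
    unfolding f_def
  proof (rule cSUP_least[OF U(2)])
    fix u assume u: "u \<in> U"
    have "h (x(j := z)) u - h x u = (\<Sum>i<n. if i = j then \<psi> (e u (c z)) - \<psi> (e u (c (x j))) else 0)"
      unfolding h_def sum_subtractf[symmetric] by (intro sum.cong refl) auto
    also have "\<dots> = \<psi> (e u (c z)) - \<psi> (e u (c (x j)))" using j by simp
    also have "\<dots> \<le> 1" using p01(2)[of "e u (c z)"] p01(1)[of "e u (c (x j))"] by linarith
    finally show "h (x(j := z)) u \<le> (SUP u\<in>U. h x u) + 1"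
      using cSUP_upper[OF u bdd[of x]] by linarith
  qed
  have diff: "\<bar>f (x(j := z)) - f x\<bar> \<le> 1" if j: "j < n" for x j z
    using upd[OF j, of x z] upd[OF j, of "x(j := z)" "x j"] by (simp add: abs_le_iff)
  have Ef: "(\<integral>x. f x \<partial>?P) \<le> 2 * L * sqrt (real n * (\<integral>z. q (c z) \<partial>Q))"
    using expected_empirical_sup[where w = 0 and n = n, OF Q U add q0 par eq em qm qi pm p01 lip L]
    by (simp add: f_def h_def E_def e_0 q_0 cong: SUP_cong)
  have tail: "\<P>(x in ?P. (\<integral>x. f x \<partial>?P) + real n * t \<le> f x) \<le> exp (- real n * t\<^sup>2 / 2)"
    by (rule bounded_differences_tail[OF Q t fm fb diff])
  have sub: "?A \<subseteq> {x\<in>space ?P. (\<integral>x. f x \<partial>?P) + real n * t \<le> f x}"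
  proof (rule subsetI)
    fix x assume "x \<in> ?A"
    then obtain u where x: "x \<in> space ?P" and u: "u \<in> U"
      and less: "real n * (\<integral>z. \<psi> (e u (c z)) \<partial>Q) + 2 * L * sqrt (real n * (\<integral>z. q (c z) \<partial>Q)) + real n * t
        < (\<Sum>j<n. \<psi> (e u (c (x j))))" by blast
    have "h x u = (\<Sum>j<n. \<psi> (e u (c (x j)))) - real n * E u"
      by (simp add: h_def sum_subtractf)
    moreover have "h x u \<le> f x" unfolding f_def by (rule cSUP_upper[OF u bdd])
    ultimately have "(\<integral>x. f x \<partial>?P) + real n * t \<le> f x" using less Ef by (simp add: E_def)
    with x show "x \<in> {x\<in>space ?P. (\<integral>x. f x \<partial>?P) + real n * t \<le> f x}" by simp
  qed
  have Aeq: "?A = (\<Union>u\<in>U. {x\<in>space ?P. real n * (\<integral>z. \<psi> (e u (c z)) \<partial>Q)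
        + 2 * L * sqrt (real n * (\<integral>z. q (c z) \<partial>Q)) + real n * t < (\<Sum>j<n. \<psi> (e u (c (x j))))})" by auto
  show "?A \<in> sets ?P"
    unfolding Aeq
  proof (rule sets.countable_UN''[OF U(1)])
    fix u assume u: "u \<in> U"
    note [measurable] = em[OF u]
    show "{x\<in>space ?P. real n * (\<integral>z. \<psi> (e u (c z)) \<partial>Q)
        + 2 * L * sqrt (real n * (\<integral>z. q (c z) \<partial>Q)) + real n * t < (\<Sum>j<n. \<psi> (e u (c (x j))))} \<in> sets ?P"
      by measurable
  qed
  show "\<P>(x in ?P. \<exists>u\<in>U. real n * (\<integral>z. \<psi> (e u (c z)) \<partial>Q)
        + 2 * L * sqrt (real n * (\<integral>z. q (c z) \<partial>Q)) + real n * t < (\<Sum>j<n. \<psi> (e u (c (x j)))))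
      \<le> exp (- real n * t\<^sup>2 / 2)"
  proof (rule order_trans[OF P.finite_measure_mono[OF sub] tail])
    show "{x\<in>space ?P. (\<integral>x. f x \<partial>?P) + real n * t \<le> f x} \<in> sets ?P" using fm by measurable
  qed
qed

section \<open>Measurable selection of a minimiser\<close>

text \<open>
  Among all vectors \<open>w\<close> whose inner products satisfy \<open>ip d w u \<le> Qf x u + s * nrm d u\<close> in every
  direction, one with the least possible slack \<open>s\<close> can be chosen measurably in \<open>x\<close>. It is the limit of
  rational vectors: the \<open>k\<close>-th one has slack within \<open>1 / (k + 1)\<close> of the infimum and, among these, nearly
  minimal norm. The admissible sets are convex, so the parallelogram law makes this sequence Cauchy
  coordinatewise. The quantity \<open>g x w\<close> in the proof is the slack of \<open>w\<close>, and \<open>gs x\<close> its infimum.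
\<close>

lemma measurable_min_slack_selection:
  fixes Qf :: "'a \<Rightarrow> (nat \<Rightarrow> real) \<Rightarrow> real" and B :: "'a \<Rightarrow> real"
  assumes d: "1 \<le> d"
    and Qm: "\<And>u. u \<in> rat_dirs d \<Longrightarrow> (\<lambda>x. Qf x u) \<in> borel_measurable M"
    and Qb: "\<And>x u. x \<in> space M \<Longrightarrow> u \<in> rat_dirs d \<Longrightarrow> \<bar>Qf x u\<bar> \<le> B x * nrm d u"
  obtains est where "est \<in> M \<rightarrow>\<^sub>M Rd d"
    "\<And>x w s. x \<in> space M \<Longrightarrow> (\<And>u. u \<in> rat_dirs d \<Longrightarrow> ip d w u \<le> Qf x u + s * nrm d u) \<Longrightarrow>
       (\<forall>u\<in>rat_dirs d. ip d (est x) u \<le> Qf x u + s * nrm d u)"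
proof -
  let ?U = "rat_dirs d" and ?K = "rat_vecs d"
  have U0: "?U \<noteq> {}" using rat_dirs_nonempty[OF d] .
  have nU: "0 < nrm d u" if "u \<in> ?U" for u using that by (simp add: rat_dirs_def)
  define r where "r = (\<lambda>x w u. (ip d w u - Qf x u) / nrm d u)"
  define g where "g = (\<lambda>x w. SUP u\<in>?U. r x w u)"
  define gs where "gs = (\<lambda>x. INF w\<in>?K. g x w)"
  have r_le: "r x w u \<le> s \<longleftrightarrow> ip d w u \<le> Qf x u + s * nrm d u" if "u \<in> ?U" for x w u s
    using nU[OF that] by (simp add: r_def pos_divide_le_eq algebra_simps)
  have rb: "r x w u \<le> nrm d w + B x" if "x \<in> space M" "u \<in> ?U" for x w u
  proof -
    have "ip d w u \<le> nrm d w * nrm d u" by (rule ip_le)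
    moreover have "- Qf x u \<le> B x * nrm d u" using Qb[OF that] by linarith
    ultimately show ?thesis using r_le[OF that(2)] by (simp add: algebra_simps)
  qed
  have bdd: "bdd_above (r x w ` ?U)" if "x \<in> space M" for x w
    by (rule bdd_aboveI[of _ "nrm d w + B x"]) (use rb[OF that] in auto)
  have g_le: "g x w \<le> s \<longleftrightarrow> (\<forall>u\<in>?U. ip d w u \<le> Qf x u + s * nrm d u)" if "x \<in> space M" for x w s
    unfolding g_def using cSUP_le_iff[OF U0 bdd[OF that]] r_le by auto
  have g_ge: "- B x \<le> g x w" if x: "x \<in> space M" for x w
  proof -
    obtain u where u: "u \<in> ?U" using U0 by auto
    let ?u' = "\<lambda>i\<in>{..<d}. - u i"
    have 1: "ip d w u \<le> Qf x u + g x w * nrm d u" using g_le[OF x, of w "g x w"] u by auto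
    have 2: "- ip d w u \<le> Qf x ?u' + g x w * nrm d u"
      using g_le[OF x, of w "g x w"] rat_dirs_minus[OF u] by (auto simp: ip_restrict_minus nrm_restrict_minus)
    have 3: "Qf x u \<le> B x * nrm d u" using Qb[OF x u] by linarith
    have 4: "Qf x ?u' \<le> B x * nrm d u"
      using Qb[OF x rat_dirs_minus[OF u]] by (simp add: nrm_restrict_minus)
    from 1 2 3 4 have "0 \<le> (B x + g x w) * nrm d u" by (simp add: algebra_simps)
    with nU[OF u] show ?thesis by (simp add: zero_le_mult_iff)
  qed
  have bddK: "bdd_below (g x ` ?K)" if "x \<in> space M" for x
    by (rule bdd_belowI[of _ "- B x"]) (use g_ge[OF that] in auto)
  have K0: "?K \<noteq> {}" using rat_vecs_dense[of 1 d "\<lambda>_. 0"] by fastforce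
  define ws where "ws = from_nat_into ?K"
  have wsK: "range ws = ?K" unfolding ws_def by (rule range_from_nat_into[OF K0 countable_rat_vecs])
  have ws_in: "ws i \<in> ?K" for i using wsK by auto
  define N where "N = (\<lambda>i. (nrm d (ws i))\<^sup>2)"
  define P where "P = (\<lambda>k x i. g x (ws i) \<le> gs x + 1 / real (k + 1) \<and>
    (\<forall>j. g x (ws j) \<le> gs x + 1 / real (k + 1) \<longrightarrow> N i \<le> N j + 1 / real (k + 1)))"
  define idx where "idx = (\<lambda>k x. LEAST i. P k x i)"
  define est where "est = (\<lambda>x. \<lambda>i\<in>{..<d}. lim (\<lambda>k. ws (idx k x) i))"
  have gm: "(\<lambda>x. g x w) \<in> borel_measurable M" for w
    unfolding g_def
  proof (rule borel_measurable_cSUP[OF countable_rat_dirs])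
    fix u assume u: "u \<in> ?U"
    note [measurable] = Qm[OF u]
    show "(\<lambda>x. r x w u) \<in> borel_measurable M" unfolding r_def by measurable
  qed (rule bdd)
  have gsm: "gs \<in> borel_measurable M"
    unfolding gs_def by (rule borel_measurable_cINF[OF countable_rat_vecs gm bddK])
  note [measurable] = gm gsm
  have Pm[measurable]: "Measurable.pred M (\<lambda>x. P k x i)" for k i
    unfolding P_def by measurable
  have idxm: "idx k \<in> measurable M (count_space UNIV)" for k
    unfolding idx_def by measurable
  have wm: "(\<lambda>x. ws (idx k x) i) \<in> borel_measurable M" for k i
    by (rule measurable_compose[OF idxm, of "\<lambda>n. ws n i"]) simp
  have estm: "est \<in> M \<rightarrow>\<^sub>M Rd d"
    unfolding est_def Rd_def by (rule measurable_restrict, rule borel_measurable_lim_metric, rule wm)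
  have ex: "\<exists>i. P k x i" if x: "x \<in> space M" for k x
  proof -
    let ?e = "1 / real (k + 1)"
    let ?S = "{j. g x (ws j) \<le> gs x + ?e}"
    have "gs x < gs x + ?e" by simp
    then obtain w where "w \<in> ?K" "g x w < gs x + ?e"
      unfolding gs_def using cINF_less_iff[OF K0 bddK[OF x]] by blast
    moreover from this obtain j where "w = ws j" using wsK by blast
    ultimately have "j \<in> ?S" by simp
    then have S0: "?S \<noteq> {}" by blast
    have bN: "bdd_below (N ` ?S)" by (rule bdd_belowI[of _ 0]) (auto simp: N_def)
    have "(INF j\<in>?S. N j) < (INF j\<in>?S. N j) + ?e" by simp
    then obtain i where i: "i \<in> ?S" "N i < (INF j\<in>?S. N j) + ?e"
      using cINF_less_iff[OF S0 bN] by blast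
    have "N i \<le> N j + ?e" if "j \<in> ?S" for j
      using cINF_lower[OF bN that] i(2) by linarith
    then show ?thesis using i(1) by (auto simp: P_def)
  qed
  have Pidx: "P k x (idx k x)" if "x \<in> space M" for k x
    unfolding idx_def using ex[OF that] by (rule LeastI_ex)
  have conv: "\<exists>v. (\<forall>i<d. (\<lambda>k. ws (idx k x) i) \<longlonglongrightarrow> v i)" if x: "x \<in> space M" for x
  proof -
    define a where "a = (\<lambda>k. idx k x)"
    have a1: "g x (ws (a k)) \<le> gs x + 1 / real (k + 1)" for k
      using Pidx[OF x, of k] by (simp add: P_def a_def)
    have a2: "N (a k) \<le> N j + 1 / real (k + 1)" if "g x (ws j) \<le> gs x + 1 / real (k + 1)" for k j
      using Pidx[OF x, of k] that by (simp add: P_def a_def)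
    have mono: "1 / real (l + 1) \<le> 1 / real (k + 1)" if "k \<le> l" for k l :: nat
      using that by (intro divide_left_mono) auto
    define S where "S = (\<lambda>k. {j. g x (ws j) \<le> gs x + 1 / real (k + 1)})"
    have aS: "a l \<in> S k" if "k \<le> l" for k l
      using a1[of l] mono[OF that] by (simp add: S_def)
    define m where "m = (\<lambda>k. INF j\<in>S k. N j)"
    have bN: "bdd_below (N ` T)" for T by (rule bdd_belowI[of _ 0]) (auto simp: N_def)
    have m1: "m k \<le> N (a k)" for k unfolding m_def by (rule cINF_lower[OF bN aS]) simp
    have m2: "N (a k) - 1 / real (k + 1) \<le> m k" for k
      unfolding m_def using aS[of k k] a2[of _ k] by (intro cINF_greatest) (auto simp: S_def algebra_simps)
    have minc: "incseq m"
    proof (rule incseq_SucI)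
      fix k
      have "S (Suc k) \<subseteq> S k" using mono[of k "Suc k"] by (auto simp: S_def)
      moreover have "S (Suc k) \<noteq> {}" using aS[of "Suc k" "Suc k"] by auto
      ultimately show "m k \<le> m (Suc k)" unfolding m_def by (intro cINF_superset_mono bN) auto
    qed
    \<comment> \<open>the constraints in the coordinate directions bound the candidates uniformly\<close>
    define R where "R = (\<Sum>i<d. (B x + gs x + 1)\<^sup>2)"
    have NR: "N (a k) \<le> R" for k
    proof -
      have gk: "g x (ws (a k)) \<le> gs x + 1"
      proof -
        have "1 / real (k + 1) \<le> 1" by simp
        with a1[of k] show ?thesis by linarith
      qed
      have "(ws (a k) i)\<^sup>2 \<le> (B x + gs x + 1)\<^sup>2" if i: "i < d" for i
      proof -
        let ?e = "coord_dir d i"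
        note e = coord_dir_rat_dirs[OF i]
        have 1: "ip d (ws (a k)) ?e \<le> Qf x ?e + (gs x + 1) * nrm d ?e"
          using gk g_le[OF x] e by blast
        have 2: "- ip d (ws (a k)) ?e \<le> Qf x (\<lambda>i\<in>{..<d}. - ?e i) + (gs x + 1) * nrm d ?e"
          using gk g_le[OF x] rat_dirs_minus[OF e] by (metis ip_restrict_minus nrm_restrict_minus)
        have 3: "Qf x ?e \<le> B x * nrm d ?e" using Qb[OF x e] by linarith
        have 4: "Qf x (\<lambda>i\<in>{..<d}. - ?e i) \<le> B x * nrm d ?e"
          using Qb[OF x rat_dirs_minus[OF e]] by (simp add: nrm_restrict_minus)
        have "\<bar>ws (a k) i\<bar> \<le> B x + gs x + 1"
          using 1 2 3 4 by (simp add: ip_coord_dir[OF i] nrm_coord_dir[OF i] abs_le_iff)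
        then show ?thesis by (rule power2_le_iff_abs_le[THEN iffD2, rotated]) (use \<open>\<bar>ws (a k) i\<bar> \<le> B x + gs x + 1\<close> in linarith)
      qed
      then show ?thesis unfolding N_def nrm_sq ip_def R_def
        by (intro sum_mono) (simp add: power2_eq_square)
    qed
    have "m k \<le> R" for k using m1[of k] NR[of k] by linarith
    then obtain L where L: "m \<longlonglongrightarrow> L" using incseq_convergent[OF minc] by blast
    have "(\<lambda>k. N (a k)) \<longlonglongrightarrow> L"
    proof (rule tendsto_sandwich[OF _ _ L])
      show "(\<lambda>k. m k + 1 / real (k + 1)) \<longlonglongrightarrow> L" using tendsto_add[OF L lim_inverse_Suc] by simp
      show "\<forall>\<^sub>F k in sequentially. m k \<le> N (a k)" using m1 by simp
      show "\<forall>\<^sub>F k in sequentially. N (a k) \<le> m k + 1 / real (k + 1)"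
        using m2 by (simp add: diff_le_eq)
    qed
    then have CN: "Cauchy (\<lambda>k. N (a k))" by (rule LIMSEQ_imp_Cauchy)
    \<comment> \<open>the midpoint of two rational candidates is again a candidate for the smaller index\<close>
    have dist2: "(nrm d (\<lambda>i. ws (a k) i - ws (a l) i))\<^sup>2 \<le> 2 * (N (a l) - N (a k)) + 4 / real (k + 1)"
      if kl: "k \<le> l" for k l
    proof -
      define w where "w = (\<lambda>i\<in>{..<d}. (ws (a k) i + ws (a l) i) / 2)"
      have "w \<in> ?K" using ws_in[of "a k"] ws_in[of "a l"]
        by (auto simp: w_def rat_vecs_def PiE_iff intro!: Rats_divide Rats_add)
      then obtain j where j: "ws j = w" using wsK by (metis imageE)
      have ipw: "ip d w u = (ip d (ws (a k)) u + ip d (ws (a l)) u) / 2" for u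
        unfolding ip_def sum.distrib[symmetric] sum_divide_distrib
        by (intro sum.cong refl) (simp add: w_def field_simps)
      have gk: "g x (ws (a k)) \<le> gs x + 1 / real (k + 1)" "g x (ws (a l)) \<le> gs x + 1 / real (k + 1)"
        using a1[of k] aS[OF kl] by (auto simp: S_def)
      have mean: "(b + c) / 2 \<le> e" if "b \<le> e" "c \<le> e" for b c e :: real using that by simp
      have "g x w \<le> gs x + 1 / real (k + 1)"
        unfolding g_le[OF x]
      proof
        fix u assume u: "u \<in> ?U"
        have "ip d (ws (a k)) u \<le> Qf x u + (gs x + 1 / real (k + 1)) * nrm d u"
          "ip d (ws (a l)) u \<le> Qf x u + (gs x + 1 / real (k + 1)) * nrm d u"
          using gk u unfolding g_le[OF x] by auto
        then show "ip d w u \<le> Qf x u + (gs x + 1 / real (k + 1)) * nrm d u"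
          unfolding ipw using mean by blast
      qed
      then have "N (a k) \<le> N j + 1 / real (k + 1)" using a2[of j k] j by simp
      moreover have "N j = (nrm d (\<lambda>i. (ws (a k) i + ws (a l) i) / 2))\<^sup>2"
        unfolding N_def j using nrm_cong[of d w] by (simp add: w_def)
      ultimately show ?thesis unfolding nrm_parallelogram by (simp add: N_def)
    qed
    have "Cauchy (\<lambda>k. ws (a k) i)" if i: "i < d" for i
    proof (rule CauchyI')
      fix e :: real assume e: "0 < e"
      have e2: "0 < e\<^sup>2 / 4" using e by simp
      obtain k1 where k1: "\<And>k l. k1 \<le> k \<Longrightarrow> k1 \<le> l \<Longrightarrow> \<bar>N (a k) - N (a l)\<bar> < e\<^sup>2 / 4"
        using CN e2 unfolding Cauchy_def dist_real_def by meson
      obtain k2 where k2: "\<And>k. k2 \<le> k \<Longrightarrow> 4 / real (k + 1) < e\<^sup>2 / 4"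
      proof -
        have "(\<lambda>k. 4 * (1 / real (k + 1))) \<longlonglongrightarrow> 4 * 0" by (intro tendsto_mult lim_inverse_Suc tendsto_const)
        then have "(\<lambda>k. 4 / real (k + 1)) \<longlonglongrightarrow> 0" by simp
        from order_tendstoD(2)[OF this e2] show ?thesis using that unfolding eventually_sequentially by blast
      qed
      show "\<exists>M. \<forall>m\<ge>M. \<forall>n>m. dist (ws (a m) i) (ws (a n) i) < e"
      proof (intro exI[of _ "max k1 k2"] allI impI)
        fix k l assume kl: "max k1 k2 \<le> k" "k < l"
        have "\<bar>ws (a k) i - ws (a l) i\<bar>\<^sup>2 \<le> (nrm d (\<lambda>i. ws (a k) i - ws (a l) i))\<^sup>2"
          by (rule power_mono[OF abs_coord_le_nrm[OF i]]) simp
        also have "\<dots> \<le> 2 * (N (a l) - N (a k)) + 4 / real (k + 1)" using dist2 kl by simp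
        also have "\<dots> < e\<^sup>2"
        proof -
          have "N (a l) - N (a k) < e\<^sup>2 / 4" using k1[of k l] kl by linarith
          moreover have "4 / real (k + 1) < e\<^sup>2 / 4" using k2[of k] kl by simp
          moreover have "2 * b + c < 4 * t" if "b < t" "c < t" "0 < t" for b c t :: real
            using that by linarith
          ultimately have "2 * (N (a l) - N (a k)) + 4 / real (k + 1) < 4 * (e\<^sup>2 / 4)" using e2 by blast
          then show ?thesis by simp
        qed
        finally have "\<bar>ws (a k) i - ws (a l) i\<bar> < e" using e by (simp add: power2_less_imp_less)
        then show "dist (ws (a k) i) (ws (a l) i) < e" by (simp add: dist_real_def)
      qed
    qed
    then have "\<forall>i. \<exists>t. i < d \<longrightarrow> (\<lambda>k. ws (a k) i) \<longlonglongrightarrow> t"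
      by (meson Cauchy_convergent convergent_def)
    then show ?thesis unfolding a_def by metis
  qed
  show ?thesis
  proof (rule that[OF estm])
    fix x w s assume x: "x \<in> space M" and w: "\<And>u. u \<in> ?U \<Longrightarrow> ip d w u \<le> Qf x u + s * nrm d u"
    obtain v where v: "\<And>i. i < d \<Longrightarrow> (\<lambda>k. ws (idx k x) i) \<longlonglongrightarrow> v i" using conv[OF x] by blast
    have ev: "ip d (est x) u = ip d v u" for u
      by (rule ip_cong) (auto simp: est_def limI[OF v])
    have lim: "(\<lambda>k. ip d (ws (idx k x)) u) \<longlonglongrightarrow> ip d (est x) u" for u
      unfolding ev unfolding ip_def by (intro tendsto_intros v) auto
    have gss: "gs x \<le> s"
    proof (rule field_le_epsilon)
      fix e :: real assume "0 < e"
      then obtain w' where w': "w' \<in> ?K" "nrm d (\<lambda>i. w i - w' i) < e" using rat_vecs_dense by metis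
      have "g x w' \<le> s + e"
        unfolding g_le[OF x]
      proof
        fix u assume u: "u \<in> ?U"
        have "ip d w' u = ip d w u + - ip d (\<lambda>i. w i - w' i) u" by (simp add: ip_diff_left)
        also have "- ip d (\<lambda>i. w i - w' i) u \<le> nrm d (\<lambda>i. w i - w' i) * nrm d u"
          using abs_ip_le[of d "\<lambda>i. w i - w' i" u] by linarith
        also have "\<dots> \<le> e * nrm d u" using w'(2) by (intro mult_right_mono) auto
        finally show "ip d w' u \<le> Qf x u + (s + e) * nrm d u" using w[OF u] by (simp add: algebra_simps)
      qed
      then show "gs x \<le> s + e" unfolding gs_def using cINF_lower[OF bddK[OF x] w'(1)] by linarith
    qed
    show "\<forall>u\<in>?U. ip d (est x) u \<le> Qf x u + s * nrm d u"
    proof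
      fix u assume u: "u \<in> ?U"
      have "(\<lambda>k. Qf x u + (gs x + 1 / real (k + 1)) * nrm d u) \<longlonglongrightarrow> Qf x u + (gs x + 0) * nrm d u"
        by (intro tendsto_intros lim_inverse_Suc)
      moreover have "ip d (ws (idx k x)) u \<le> Qf x u + (gs x + 1 / real (k + 1)) * nrm d u" for k
        using Pidx[OF x, of k] u unfolding P_def g_le[OF x] by blast
      ultimately have "ip d (est x) u \<le> Qf x u + (gs x + 0) * nrm d u"
        by (intro LIMSEQ_le[OF lim]) auto
      also have "\<dots> \<le> Qf x u + s * nrm d u" using gss nU[OF u] by simp
      finally show "ip d (est x) u \<le> Qf x u + s * nrm d u" .
    qed
  qed
qed

section \<open>A Tukey median with slack\<close>

text \<open>
  The \<open>a\<close>-th largest of the numbers \<open>v 0, \<dots>, v (n - 1)\<close>, for \<open>1 \<le> a \<le> n\<close>.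
\<close>

definition order_stat :: "nat \<Rightarrow> nat \<Rightarrow> (nat \<Rightarrow> real) \<Rightarrow> real" where
  "order_stat n a v = Max ((\<lambda>J. Min (v ` J)) ` {J. J \<subseteq> {..<n} \<and> card J = a})"

lemma order_stat_ge_iff:
  assumes a: "1 \<le> a" "a \<le> n"
  shows "t \<le> order_stat n a v \<longleftrightarrow> a \<le> card {j. j < n \<and> t \<le> v j}"
proof -
  let ?F = "{J. J \<subseteq> {..<n} \<and> card J = a}"
  have fin: "finite ?F" by (rule finite_subset[of _ "Pow {..<n}"]) auto
  have ne: "?F \<noteq> {}" using obtain_subset_with_card_n[of a "{..<n}"] a by auto
  have J: "finite J" "J \<noteq> {}" if "J \<in> ?F" for J using that a finite_subset[of J "{..<n}"] by auto
  have "t \<le> order_stat n a v \<longleftrightarrow> (\<exists>J\<in>?F. t \<le> Min (v ` J))"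
    unfolding order_stat_def using fin ne by (subst Max_ge_iff) auto
  also have "\<dots> \<longleftrightarrow> (\<exists>J\<in>?F. \<forall>j\<in>J. t \<le> v j)"
  proof (intro bex_cong refl)
    fix J assume "J \<in> ?F"
    from J[OF this] show "t \<le> Min (v ` J) \<longleftrightarrow> (\<forall>j\<in>J. t \<le> v j)" by simp
  qed
  also have "\<dots> \<longleftrightarrow> a \<le> card {j. j < n \<and> t \<le> v j}" (is "?l \<longleftrightarrow> a \<le> card ?S")
  proof
    assume ?l
    then obtain J where "J \<subseteq> {..<n}" "card J = a" "\<forall>j\<in>J. t \<le> v j" by blast
    moreover from this have "card J \<le> card ?S" by (intro card_mono) auto
    ultimately show "a \<le> card ?S" by simp
  next
    assume "a \<le> card ?S"
    then obtain J where "J \<subseteq> ?S" "card J = a" using obtain_subset_with_card_n by metis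
    then show ?l by (intro bexI[of _ J]) auto
  qed
  finally show ?thesis .
qed

lemma order_stat_abs_le:
  assumes a: "1 \<le> a" "a \<le> n" and b: "\<And>j. j < n \<Longrightarrow> \<bar>v j\<bar> \<le> b"
  shows "\<bar>order_stat n a v\<bar> \<le> b"
proof -
  have "{j. j < n \<and> - b \<le> v j} = {..<n}" using b by (force simp: abs_le_iff)
  then have 1: "- b \<le> order_stat n a v" using order_stat_ge_iff[OF a, of "- b" v] a by simp
  have "a \<le> card {j. j < n \<and> order_stat n a v \<le> v j}" using order_stat_ge_iff[OF a] by blast
  then have "{j. j < n \<and> order_stat n a v \<le> v j} \<noteq> {}" using a by (metis card.empty not_one_le_zero order_trans)
  then obtain j where "j < n" "order_stat n a v \<le> v j" by blast
  with b[of j] 1 show ?thesis by (simp add: abs_le_iff)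
qed

lemma ip_measurable [measurable (raw)]:
  assumes "\<And>i. i < d \<Longrightarrow> (\<lambda>x. f x i) \<in> borel_measurable M"
  shows "(\<lambda>x. ip d (f x) u) \<in> borel_measurable M"
  unfolding ip_def by (intro borel_measurable_sum borel_measurable_times borel_measurable_const assms) simp

lemma sample_space_coord:
  assumes "j < n" "i < d"
  shows "(\<lambda>z. z j i) \<in> borel_measurable (sample_space d n)"
proof -
  have "(\<lambda>z. z j) \<in> sample_space d n \<rightarrow>\<^sub>M Rd d"
    unfolding sample_space_def using assms by (intro measurable_component_singleton) auto
  moreover have "(\<lambda>x. x i) \<in> Rd d \<rightarrow>\<^sub>M borel"
    unfolding Rd_def using assms by (intro measurable_component_singleton) auto
  ultimately show ?thesis by (rule measurable_compose)
qed

text \<open>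
  A Tukey median with slack. A point has depth at least \<open>a\<close> up to slack \<open>s\<close> if every closed half-space
  with this point on its boundary holds at least \<open>a\<close> sample points after the boundary has been moved
  outwards by \<open>s\<close>.
  The estimator attains the least slack for which such a point exists.
\<close>

lemma slack_depth_estimator:
  assumes d: "1 \<le> d" and a: "1 \<le> a" "a \<le> n"
  obtains est where "est \<in> sample_space d n \<rightarrow>\<^sub>M Rd d"
    "\<And>z w s. z \<in> space (sample_space d n) \<Longrightarrow>
       (\<And>u. u \<in> rat_dirs d \<Longrightarrow> a \<le> card {j. j < n \<and> ip d w u - s * nrm d u \<le> ip d (z j) u}) \<Longrightarrow>
       (\<forall>u\<in>rat_dirs d. a \<le> card {j. j < n \<and> ip d (est z) u - s * nrm d u \<le> ip d (z j) u})"
proof -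
  define Qf where "Qf = (\<lambda>z u. order_stat n a (\<lambda>j. ip d (z j) u))"
  have iff: "ip d w u \<le> Qf z u + s * nrm d u
      \<longleftrightarrow> a \<le> card {j. j < n \<and> ip d w u - s * nrm d u \<le> ip d (z j) u}" for w z s u
    using order_stat_ge_iff[OF a, of "ip d w u - s * nrm d u" "\<lambda>j. ip d (z j) u"]
    by (simp add: Qf_def diff_le_eq)
  have Qm: "(\<lambda>z. Qf z u) \<in> borel_measurable (sample_space d n)" for u
    unfolding Qf_def order_stat_def
  proof (intro borel_measurable_Max borel_measurable_Min)
    show "finite {J. J \<subseteq> {..<n} \<and> card J = a}" by (rule finite_subset[of _ "Pow {..<n}"]) auto
  next
    fix J assume "J \<in> {J. J \<subseteq> {..<n} \<and> card J = a}"
    then show "finite J" using finite_subset[of J "{..<n}"] by auto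
  next
    fix J j assume "J \<in> {J. J \<subseteq> {..<n} \<and> card J = a}" "j \<in> J"
    then show "(\<lambda>z. ip d (z j) u) \<in> borel_measurable (sample_space d n)"
      by (intro ip_measurable sample_space_coord) auto
  qed
  have Qb: "\<bar>Qf z u\<bar> \<le> (\<Sum>j<n. nrm d (z j)) * nrm d u" for z u
    unfolding Qf_def
  proof (rule order_stat_abs_le[OF a])
    fix j assume "j < n"
    then have "nrm d (z j) \<le> (\<Sum>j<n. nrm d (z j))" by (intro member_le_sum) auto
    then have "nrm d (z j) * nrm d u \<le> (\<Sum>j<n. nrm d (z j)) * nrm d u" by (rule mult_right_mono) simp
    with abs_ip_le[of d "z j" u] show "\<bar>ip d (z j) u\<bar> \<le> (\<Sum>j<n. nrm d (z j)) * nrm d u" by linarith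
  qed
  obtain est where "est \<in> sample_space d n \<rightarrow>\<^sub>M Rd d"
    "\<And>x w s. x \<in> space (sample_space d n) \<Longrightarrow> (\<And>u. u \<in> rat_dirs d \<Longrightarrow> ip d w u \<le> Qf x u + s * nrm d u) \<Longrightarrow>
       (\<forall>u\<in>rat_dirs d. ip d (est x) u \<le> Qf x u + s * nrm d u)"
    using measurable_min_slack_selection[OF d Qm Qb] by blast
  with that show ?thesis unfolding iff by blast
qed

text \<open>
  The deterministic part of the argument. The two counting hypotheses imply that \<open>\<mu>\<close> has large depth
  up to slack \<open>sqrt 2 * C * r\<close>: in directions with large \<open>\<sigma>\<close> this is \<open>many\<close>, in the others it is \<open>few\<close>
  for the opposite direction. Hence the minimiser \<open>m\<close> has the same depth, and in each direction
  some sample point lies above \<open>m\<close> up to the slack but not far above \<open>\<mu>\<close>.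
\<close>

lemma slack_depth_deterministic:
  fixes d n :: nat and p C r :: real and \<sigma> :: "(nat \<Rightarrow> real) \<Rightarrow> real"
  defines "\<rho> \<equiv> \<lambda>u. sqrt ((\<sigma> u)\<^sup>2 + r\<^sup>2 * (nrm d u)\<^sup>2)"
  assumes p: "0 < p" "p \<le> 1" and C: "0 \<le> C" and r: "0 \<le> r"
    and s0: "\<And>u. 0 \<le> \<sigma> u" and ssym: "\<And>u. \<sigma> (\<lambda>i\<in>{..<d}. - u i) = \<sigma> u"
    and few: "\<And>u. u \<in> rat_dirs d \<Longrightarrow>
        real (card {j. j < n \<and> C * \<rho> u < ip d (z j) u - ip d \<mu> u}) < p * real n / 4"
    and many: "\<And>u. u \<in> rat_dirs d \<Longrightarrow> r * nrm d u \<le> \<sigma> u \<Longrightarrow>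
        p * real n / 2 \<le> real (card {j. j < n \<and> 0 < ip d (z j) u - ip d \<mu> u})"
    and opt: "\<And>w s. (\<And>u. u \<in> rat_dirs d \<Longrightarrow>
          nat \<lceil>p * real n / 2\<rceil> \<le> card {j. j < n \<and> ip d w u - s * nrm d u \<le> ip d (z j) u}) \<Longrightarrow>
       (\<forall>u\<in>rat_dirs d. nat \<lceil>p * real n / 2\<rceil> \<le> card {j. j < n \<and> ip d m u - s * nrm d u \<le> ip d (z j) u})"
    and u: "u \<in> rat_dirs d"
  shows "ip d m u - ip d \<mu> u \<le> C * \<sigma> u + 3 * C * r * nrm d u"
proof -
  let ?a = "nat \<lceil>p * real n / 2\<rceil>"
  define s where "s = sqrt 2 * C * r"
  have s_nn: "0 \<le> s" using C r by (simp add: s_def)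
  have depth: "?a \<le> card {j. j < n \<and> ip d \<mu> u - s * nrm d u \<le> ip d (z j) u}" (is "_ \<le> card ?D")
    if u: "u \<in> rat_dirs d" for u
  proof (cases "r * nrm d u \<le> \<sigma> u")
    case True
    have "card {j. j < n \<and> 0 < ip d (z j) u - ip d \<mu> u} \<le> card ?D"
      using mult_nonneg_nonneg[OF s_nn nrm_nonneg[of d u]] by (intro card_mono) auto
    with many[OF u True] have "p * real n / 2 \<le> real (card ?D)" by linarith
    then show ?thesis by (simp add: nat_le_iff ceiling_le_iff)
  next
    case False
    let ?u' = "\<lambda>i\<in>{..<d}. - u i"
    let ?B = "{j. j < n \<and> C * \<rho> ?u' < ip d (z j) ?u' - ip d \<mu> ?u'}"
    have "\<rho> u \<le> sqrt (2 * (r * nrm d u)\<^sup>2)"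
      unfolding \<rho>_def using False s0[of u] power_mono[of "\<sigma> u" "r * nrm d u" 2]
      by (intro real_sqrt_le_mono) (simp add: power_mult_distrib)
    also have "\<dots> = sqrt 2 * (r * nrm d u)" using r by (simp add: real_sqrt_mult)
    finally have "C * \<rho> u \<le> C * (sqrt 2 * (r * nrm d u))" using C by (rule mult_left_mono)
    then have rho: "C * \<rho> u \<le> s * nrm d u" by (simp add: s_def mult_ac)
    have rho': "\<rho> ?u' = \<rho> u" by (simp add: \<rho>_def ssym nrm_restrict_minus)
    have "{..<n} \<subseteq> ?D \<union> ?B"
      using rho by (auto simp: rho' ip_restrict_minus)
    then have "card {..<n} \<le> card (?D \<union> ?B)" by (intro card_mono) auto
    also have "\<dots> \<le> card ?D + card ?B" by (rule card_Un_le)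
    finally have "real n \<le> real (card ?D) + real (card ?B)" by simp
    moreover have "real (card ?B) < p * real n / 4" by (rule few[OF rat_dirs_minus[OF u]])
    moreover have "p * real n \<le> real n" using p by (simp add: mult_left_le_one_le)
    ultimately have "p * real n / 2 \<le> real (card ?D)" using p by (simp add: field_simps)
    then show ?thesis by (simp add: nat_le_iff ceiling_le_iff)
  qed
  from opt[OF depth] u
  have "?a \<le> card {j. j < n \<and> ip d m u - s * nrm d u \<le> ip d (z j) u}" (is "_ \<le> card ?E") by blast
  then have E: "p * real n / 2 \<le> real (card ?E)" by (simp add: nat_le_iff ceiling_le_iff)
  let ?B = "{j. j < n \<and> C * \<rho> u < ip d (z j) u - ip d \<mu> u}"
  have "real (card ?B) < real (card ?E)"
  proof -
    have "0 \<le> p * real n" using p by simp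
    with E few[OF u] show ?thesis by simp
  qed
  then have "\<not> ?E \<subseteq> ?B" using card_mono[of ?B ?E] by auto
  then obtain j where j: "ip d m u - s * nrm d u \<le> ip d (z j) u" "ip d (z j) u - ip d \<mu> u \<le> C * \<rho> u"
    by force
  have "\<rho> u \<le> \<sigma> u + r * nrm d u"
    unfolding \<rho>_def by (rule real_le_lsqrt) (use s0[of u] r in \<open>auto simp: power2_sum power_mult_distrib\<close>)
  then have "C * \<rho> u \<le> C * (\<sigma> u + r * nrm d u)" using C by (rule mult_left_mono)
  with j have "ip d m u - ip d \<mu> u \<le> C * \<sigma> u + C * r * nrm d u + s * nrm d u"
    by (simp add: algebra_simps)
  also have "s * nrm d u \<le> 2 * C * r * nrm d u"
  proof -
    have "sqrt 2 \<le> 2" by (rule real_le_lsqrt) auto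
    then have "sqrt 2 * (C * r * nrm d u) \<le> 2 * (C * r * nrm d u)" using C r by (intro mult_right_mono) auto
    then show ?thesis by (simp add: s_def mult_ac)
  qed
  finally show ?thesis by (simp add: algebra_simps)
qed

section \<open>Moments and small-ball estimates\<close>

lemma (in prob_space) PiM_pair_moment:
  fixes f g :: "'a \<Rightarrow> real" and a b m :: nat
  assumes ab: "a < m" "b < m" and f: "integrable M f" and g: "integrable M g"
    and fg: "integrable M (\<lambda>x. f x * g x)"
  shows "integrable (\<Pi>\<^sub>M i\<in>{..<m}. M) (\<lambda>x. f (x a) * g (x b))"
    and "(\<integral>x. f (x a) * g (x b) \<partial>(\<Pi>\<^sub>M i\<in>{..<m}. M))
       = (if a = b then expectation (\<lambda>x. f x * g x) else expectation f * expectation g)"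
proof -
  interpret S: product_sigma_finite "\<lambda>_::nat. M" ..
  define F where "F = (\<lambda>(i::nat) z. (if i = a then f z else 1) * (if i = b then g z else 1))"
  have Fi: "integrable M (F i)" for i
    unfolding F_def using f g fg by (cases "i = a"; cases "i = b") auto
  have prod: "(\<Prod>i<m. F i (x i)) = f (x a) * g (x b)" for x :: "nat \<Rightarrow> 'a"
    using ab by (simp add: F_def prod.distrib)
  show "integrable (\<Pi>\<^sub>M i\<in>{..<m}. M) (\<lambda>x. f (x a) * g (x b))"
    using S.product_integrable_prod[of "{..<m}" F] Fi by (simp add: prod)
  have "(\<integral>x. f (x a) * g (x b) \<partial>(\<Pi>\<^sub>M i\<in>{..<m}. M)) = (\<Prod>i<m. expectation (F i))"
    using S.product_integral_prod[of "{..<m}" F] Fi by (simp add: prod)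
  also have "\<dots> = (if a = b then expectation (\<lambda>x. f x * g x) else expectation f * expectation g)"
  proof (cases "a = b")
    case True
    have "expectation (F i) = (if i = a then expectation (\<lambda>x. f x * g x) else 1)" for i
      using True by (simp add: F_def prob_space)
    then show ?thesis using ab True by simp
  next
    case False
    have "expectation (F i) = (if i = a then expectation f else 1) * (if i = b then expectation g else 1)" for i
      using False by (simp add: F_def prob_space)
    then show ?thesis using ab False by (simp add: prod.distrib)
  qed
  finally show "(\<integral>x. f (x a) * g (x b) \<partial>(\<Pi>\<^sub>M i\<in>{..<m}. M))
       = (if a = b then expectation (\<lambda>x. f x * g x) else expectation f * expectation g)" .
qed

lemma (in prob_space) PiM_sum_product_moment:
  fixes f g :: "'a \<Rightarrow> real" and m :: nat
  assumes f: "integrable M f" and g: "integrable M g" and fg: "integrable M (\<lambda>x. f x * g x)"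
    and f0: "expectation f = 0"
  shows "integrable (\<Pi>\<^sub>M i\<in>{..<m}. M) (\<lambda>x. (\<Sum>a<m. f (x a)) * (\<Sum>b<m. g (x b)))"
    and "(\<integral>x. (\<Sum>a<m. f (x a)) * (\<Sum>b<m. g (x b)) \<partial>(\<Pi>\<^sub>M i\<in>{..<m}. M))
       = real m * expectation (\<lambda>x. f x * g x)"
proof -
  note P = PiM_pair_moment[OF _ _ f g fg]
  have eq: "(\<Sum>a<m. f (x a)) * (\<Sum>b<m. g (x b)) = (\<Sum>a<m. \<Sum>b<m. f (x a) * g (x b))" for x :: "nat \<Rightarrow> 'a"
    by (simp add: sum_product)
  show "integrable (\<Pi>\<^sub>M i\<in>{..<m}. M) (\<lambda>x. (\<Sum>a<m. f (x a)) * (\<Sum>b<m. g (x b)))"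
    unfolding eq by (intro Bochner_Integration.integrable_sum P) auto
  have "(\<integral>x. (\<Sum>a<m. f (x a)) * (\<Sum>b<m. g (x b)) \<partial>(\<Pi>\<^sub>M i\<in>{..<m}. M))
      = (\<Sum>a<m. \<Sum>b<m. \<integral>x. f (x a) * g (x b) \<partial>(\<Pi>\<^sub>M i\<in>{..<m}. M))"
    unfolding eq using P(1)
    by (subst Bochner_Integration.integral_sum)
       (auto intro!: Bochner_Integration.integrable_sum sum.cong Bochner_Integration.integral_sum)
  also have "\<dots> = (\<Sum>a<m. \<Sum>b<m. if a = b then expectation (\<lambda>x. f x * g x) else 0)"
    using P(2) f0 by (intro sum.cong refl) auto
  also have "\<dots> = real m * expectation (\<lambda>x. f x * g x)" by simp
  finally show "(\<integral>x. (\<Sum>a<m. f (x a)) * (\<Sum>b<m. g (x b)) \<partial>(\<Pi>\<^sub>M i\<in>{..<m}. M))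
       = real m * expectation (\<lambda>x. f x * g x)" .
qed

text \<open>
  The first absolute moment of a sum of \<open>m\<close> independent centred variables is at least of order
  \<open>sqrt m\<close>. The sum is tested against the Riesz product of the factors \<open>1 + \<i> t s\<close>, where \<open>s\<close> is the
  centred sign of \<open>f\<close> and \<open>t = 1 / sqrt m\<close>: its modulus is bounded by \<open>exp 2\<close>, and by independence
  each summand contributes \<open>\<i> t\<close> times the first absolute moment of \<open>f\<close>.
\<close>

lemma (in prob_space) PiM_abs_sum_ge:
  fixes f :: "'a \<Rightarrow> real" and m :: nat
  assumes f: "integrable M f" and f0: "expectation f = 0" and m: "1 \<le> m"
  shows "integrable (\<Pi>\<^sub>M i\<in>{..<m}. M) (\<lambda>x. \<Sum>a<m. f (x a))"
    and "exp (- 2) * sqrt (real m) * expectation (\<lambda>x. \<bar>f x\<bar>)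
       \<le> (\<integral>x. \<bar>\<Sum>a<m. f (x a)\<bar> \<partial>(\<Pi>\<^sub>M i\<in>{..<m}. M))"
proof -
  interpret S: product_sigma_finite "\<lambda>_::nat. M" ..
  let ?P = "\<Pi>\<^sub>M i\<in>{..<m}. M"
  interpret P: prob_space ?P by (intro prob_space_PiM prob_space_axioms)
  have fm[measurable]: "f \<in> borel_measurable M" using f by auto
  define b where "b = expectation (\<lambda>x. sgn (f x))"
  define s where "s = (\<lambda>x. sgn (f x) - b)"
  have si: "integrable M (\<lambda>x. sgn (f x))"
    by (rule integrable_const_bound[of _ 1]) (auto simp: sgn_if)
  have b1: "\<bar>b\<bar> \<le> 1"
  proof -
    have "\<bar>b\<bar> \<le> expectation (\<lambda>x. \<bar>sgn (f x)\<bar>)" unfolding b_def by (rule integral_abs_bound)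
    also have "\<dots> \<le> expectation (\<lambda>x. 1)"
      using si by (intro integral_mono) (auto simp: sgn_if)
    finally show ?thesis by (simp add: prob_space)
  qed
  have sm[measurable]: "s \<in> borel_measurable M" unfolding s_def by measurable
  have s2: "\<bar>s x\<bar> \<le> 2" for x using b1 by (auto simp: s_def sgn_if abs_le_iff)
  have s_int: "integrable M s" unfolding s_def using si by simp
  have s0: "expectation s = 0" unfolding s_def using si by (simp add: b_def prob_space)
  have fs_int: "integrable M (\<lambda>x. f x * s x)"
  proof (rule Bochner_Integration.integrable_bound)
    show "integrable M (\<lambda>x. 2 * f x)" using f by simp
    have "norm (f x * s x) \<le> norm (2 * f x)" for x
      using mult_left_mono[OF s2[of x], of "\<bar>f x\<bar>"] by (simp add: abs_mult mult.commute)
    then show "AE x in M. norm (f x * s x) \<le> norm (2 * f x)" by simp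
  qed simp
  have fs: "expectation (\<lambda>x. f x * s x) = expectation (\<lambda>x. \<bar>f x\<bar>)"
  proof -
    have "f x * s x = \<bar>f x\<bar> - b * f x" for x by (auto simp: s_def sgn_if algebra_simps)
    then show ?thesis using f f0 by simp
  qed
  define t where "t = 1 / sqrt (real m)"
  define c where "c = (\<lambda>z. 1 + \<i> * complex_of_real (t * s z))"
  define R where "R = (\<lambda>x. \<Prod>a<m. c (x a))"
  have c_int: "integrable M c" unfolding c_def using s_int by (intro Bochner_Integration.integrable_add) auto
  have c1: "integral\<^sup>L M c = 1" unfolding c_def using s_int s0 by (simp add: prob_space)
  have cn: "norm (c z) \<le> exp (2 / real m)" for z
  proof -
    have "(s z)\<^sup>2 \<le> 4" using s2[of z] abs_le_square_iff[of "s z" 2] by simp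
    have "(norm (c z))\<^sup>2 = 1 + (t * s z)\<^sup>2" unfolding c_def cmod_power2 by simp
    also have "\<dots> = 1 + (s z)\<^sup>2 / real m" using m by (simp add: t_def power_mult_distrib power_divide)
    also have "\<dots> \<le> 1 + 4 / real m" using \<open>(s z)\<^sup>2 \<le> 4\<close> m by (simp add: divide_right_mono)
    also have "\<dots> \<le> exp (4 / real m)" by (rule exp_ge_add_one_self)
    also have "\<dots> = (exp (2 / real m))\<^sup>2" by (simp add: power2_eq_square mult_exp_exp)
    finally show ?thesis by (rule power2_le_imp_le) simp
  qed
  have Rn: "norm (R x) \<le> exp 2" for x
  proof -
    have "norm (R x) \<le> (\<Prod>a<m. exp (2 / real m))"
      unfolding R_def prod_norm[symmetric] by (intro prod_mono) (simp add: cn)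
    also have "\<dots> = exp 2" using m by (simp add: exp_of_nat_mult[symmetric])
    finally show ?thesis .
  qed
  define F where "F = (\<lambda>(k::nat) (i::nat) z. (if i = k then complex_of_real (f z) else 1) * c z)"
  have fc: "integrable M (\<lambda>z. complex_of_real (f z) * c z)"
    "integral\<^sup>L M (\<lambda>z. complex_of_real (f z) * c z) = \<i> * complex_of_real (t * expectation (\<lambda>x. \<bar>f x\<bar>))"
  proof -
    have fi: "integrable M (\<lambda>z. \<i> * complex_of_real (t * (f z * s z)))"
      using fs_int by (intro integrable_mult_right integrable_of_real)
    have e: "complex_of_real (f z) * c z = complex_of_real (f z) + \<i> * complex_of_real (t * (f z * s z))" for z
      by (simp add: c_def algebra_simps)
    show "integrable M (\<lambda>z. complex_of_real (f z) * c z)"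
      unfolding e using f fi by (intro Bochner_Integration.integrable_add) auto
    have "integral\<^sup>L M (\<lambda>z. complex_of_real (f z) * c z)
       = integral\<^sup>L M (\<lambda>z. complex_of_real (f z)) + integral\<^sup>L M (\<lambda>z. \<i> * complex_of_real (t * (f z * s z)))"
      unfolding e using f fi by (intro Bochner_Integration.integral_add) auto
    also have "\<dots> = \<i> * complex_of_real (t * expectation (\<lambda>x. \<bar>f x\<bar>))"
      using f fs_int f0 by (simp only: integral_complex_of_real integral_mult_right_zero fs) simp
    finally show "integral\<^sup>L M (\<lambda>z. complex_of_real (f z) * c z) = \<i> * complex_of_real (t * expectation (\<lambda>x. \<bar>f x\<bar>))" .
  qed
  have Fint: "integrable M (F k i)" for k i
    unfolding F_def using c_int fc(1) by (cases "i = k") auto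
  have Fprod: "(\<Prod>i<m. F k i (x i)) = complex_of_real (f (x k)) * R x" if "k < m" for k and x :: "nat \<Rightarrow> 'a"
    using that by (simp add: F_def R_def prod.distrib)
  have Ti: "integrable ?P (\<lambda>x. complex_of_real (f (x k)) * R x)" if "k < m" for k
    using S.product_integrable_prod[of "{..<m}" "F k"] Fint by (simp add: Fprod[OF that])
  have Te: "(\<integral>x. complex_of_real (f (x k)) * R x \<partial>?P) = \<i> * complex_of_real (t * expectation (\<lambda>x. \<bar>f x\<bar>))" if "k < m" for k
  proof -
    have "(\<integral>x. complex_of_real (f (x k)) * R x \<partial>?P) = (\<Prod>i<m. integral\<^sup>L M (F k i))"
      using S.product_integral_prod[of "{..<m}" "F k"] Fint by (simp add: Fprod[OF that])
    also have "\<dots> = (\<Prod>i<m. if i = k then \<i> * complex_of_real (t * expectation (\<lambda>x. \<bar>f x\<bar>)) else 1)"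
      by (intro prod.cong refl) (auto simp: F_def fc c1)
    finally show ?thesis using that by simp
  qed
  have comp: "integrable ?P (\<lambda>x. f (x a))" if "a < m" for a
    using PiM_pair_moment(1)[OF that that f, of "\<lambda>_. 1"] f by simp
  show Sint: "integrable ?P (\<lambda>x. \<Sum>a<m. f (x a))"
    by (intro Bochner_Integration.integrable_sum comp) auto
  have "(\<integral>x. complex_of_real (\<Sum>a<m. f (x a)) * R x \<partial>?P) = (\<integral>x. (\<Sum>a<m. complex_of_real (f (x a)) * R x) \<partial>?P)"
    by (simp add: sum_distrib_right)
  also have "\<dots> = (\<Sum>a<m. \<integral>x. complex_of_real (f (x a)) * R x \<partial>?P)"
    using Ti by (intro Bochner_Integration.integral_sum) auto
  also have "\<dots> = (\<Sum>a<m. \<i> * complex_of_real (t * expectation (\<lambda>x. \<bar>f x\<bar>)))"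
    using Te by (intro sum.cong refl) auto
  also have "\<dots> = \<i> * complex_of_real (real m * t * expectation (\<lambda>x. \<bar>f x\<bar>))" by simp
  also have "real m * t = sqrt (real m)" using m by (simp add: t_def real_div_sqrt)
  finally have "sqrt (real m) * expectation (\<lambda>x. \<bar>f x\<bar>)
     = norm (\<integral>x. complex_of_real (\<Sum>a<m. f (x a)) * R x \<partial>?P)"
    by (simp add: norm_mult)
  also have "\<dots> \<le> (\<integral>x. norm (complex_of_real (\<Sum>a<m. f (x a)) * R x) \<partial>?P)"
    by (rule integral_norm_bound)
  also have "\<dots> \<le> (\<integral>x. exp 2 * \<bar>\<Sum>a<m. f (x a)\<bar> \<partial>?P)"
  proof (rule integral_mono')
    show "integrable ?P (\<lambda>x. exp 2 * \<bar>\<Sum>a<m. f (x a)\<bar>)" using Sint by simp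
    fix x
    show "norm (complex_of_real (\<Sum>a<m. f (x a)) * R x) \<le> exp 2 * \<bar>\<Sum>a<m. f (x a)\<bar>"
      using mult_left_mono[OF Rn[of x], of "\<bar>\<Sum>a<m. f (x a)\<bar>"]
      by (simp only: norm_mult norm_of_real mult.commute abs_ge_zero)
  qed simp
  also have "\<dots> = exp 2 * (\<integral>x. \<bar>\<Sum>a<m. f (x a)\<bar> \<partial>?P)" by simp
  finally have "exp (- 2) * (sqrt (real m) * expectation (\<lambda>x. \<bar>f x\<bar>))
      \<le> exp (- 2) * (exp 2 * (\<integral>x. \<bar>\<Sum>a<m. f (x a)\<bar> \<partial>?P))"
    by (rule mult_left_mono) simp
  also have "\<dots> = (\<integral>x. \<bar>\<Sum>a<m. f (x a)\<bar> \<partial>?P)" by (simp add: mult.assoc[symmetric] mult_exp_exp)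
  finally show "exp (- 2) * sqrt (real m) * expectation (\<lambda>x. \<bar>f x\<bar>) \<le> (\<integral>x. \<bar>\<Sum>a<m. f (x a)\<bar> \<partial>?P)"
    by (simp add: mult.assoc)
qed

text \<open>
  A moment of order \<open>q > 2\<close> controlled by the second moment bounds the first absolute moment from
  below. The truncation level is chosen so that large values account for at most half of the second
  moment.
\<close>

lemma (in prob_space) first_moment_ge:
  fixes y :: "'a \<Rightarrow> real"
  assumes q: "2 < q" and k: "0 < \<kappa>" and y1: "integrable M y" and y2: "integrable M (\<lambda>x. (y x)\<^sup>2)"
    and yq: "integrable M (\<lambda>x. \<bar>y x\<bar> powr q)"
    and le: "expectation (\<lambda>x. \<bar>y x\<bar> powr q) powr (1 / q) \<le> \<kappa> * sqrt (expectation (\<lambda>x. (y x)\<^sup>2))"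
  shows "sqrt (expectation (\<lambda>x. (y x)\<^sup>2)) / (2 * (2 * \<kappa> powr q) powr (1 / (q - 2))) \<le> expectation (\<lambda>x. \<bar>y x\<bar>)"
proof -
  define s where "s = sqrt (expectation (\<lambda>x. (y x)\<^sup>2))"
  define T where "T = (2 * \<kappa> powr q) powr (1 / (q - 2))"
  have T: "0 < T" using k by (simp add: T_def)
  have v0: "0 \<le> expectation (\<lambda>x. (y x)\<^sup>2)" by simp
  have s0: "0 \<le> s" and s2: "s\<^sup>2 = expectation (\<lambda>x. (y x)\<^sup>2)" by (auto simp: s_def)
  have "s / (2 * T) \<le> expectation (\<lambda>x. \<bar>y x\<bar>)"
  proof (cases "s = 0")
    case True
    then show ?thesis by simp
  next
    case False
    with s0 have s: "0 < s" by simp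
    define \<tau> where "\<tau> = T * s"
    have tau: "0 < \<tau>" using T s by (simp add: \<tau>_def)
    have TT: "T powr (2 - q) * \<kappa> powr q = 1 / 2"
    proof -
      have "T powr (2 - q) = (2 * \<kappa> powr q) powr (- 1)"
        unfolding T_def powr_powr using q by (intro arg_cong2[of _ _ _ _ "(powr)"] refl) (simp add: field_simps)
      also have "\<dots> = 1 / (2 * \<kappa> powr q)" using k by (simp add: powr_minus_divide)
      finally show ?thesis using k by simp
    qed
    have pw: "(y x)\<^sup>2 \<le> \<tau> * \<bar>y x\<bar> + \<tau> powr (2 - q) * \<bar>y x\<bar> powr q" for x
    proof (cases "\<bar>y x\<bar> \<le> \<tau>")
      case True
      then have "(y x)\<^sup>2 \<le> \<tau> * \<bar>y x\<bar>"
        using mult_right_mono[OF True, of "\<bar>y x\<bar>"] by (simp add: power2_eq_square)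
      moreover have "0 \<le> \<tau> powr (2 - q) * \<bar>y x\<bar> powr q" by simp
      ultimately show ?thesis by linarith
    next
      case False
      then have y0: "\<tau> < \<bar>y x\<bar>" "0 < \<bar>y x\<bar>" using tau by auto
      have "(y x)\<^sup>2 = \<bar>y x\<bar> powr 2" using y0 by (simp add: powr_numeral)
      also have "\<dots> = \<bar>y x\<bar> powr (2 - q) * \<bar>y x\<bar> powr q" by (simp add: powr_add[symmetric])
      also have "\<dots> \<le> \<tau> powr (2 - q) * \<bar>y x\<bar> powr q"
        using y0 tau q by (intro mult_right_mono powr_mono2') auto
      finally show ?thesis using tau by (smt (verit) mult_nonneg_nonneg abs_ge_zero)
    qed
    have "s\<^sup>2 \<le> expectation (\<lambda>x. \<tau> * \<bar>y x\<bar> + \<tau> powr (2 - q) * \<bar>y x\<bar> powr q)"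
      unfolding s2 using y1 y2 yq pw by (intro integral_mono) auto
    also have "\<dots> = \<tau> * expectation (\<lambda>x. \<bar>y x\<bar>) + \<tau> powr (2 - q) * expectation (\<lambda>x. \<bar>y x\<bar> powr q)"
      using y1 yq by simp
    also have "expectation (\<lambda>x. \<bar>y x\<bar> powr q) \<le> (\<kappa> * s) powr q"
    proof -
      have nn: "0 \<le> expectation (\<lambda>x. \<bar>y x\<bar> powr q)" by simp
      have "expectation (\<lambda>x. \<bar>y x\<bar> powr q) = (expectation (\<lambda>x. \<bar>y x\<bar> powr q) powr (1 / q)) powr q"
        using q nn by (simp add: powr_powr)
      also have "\<dots> \<le> (\<kappa> * s) powr q"
        using le q by (intro powr_mono2) (auto simp: s_def)
      finally show ?thesis .
    qed
    also have "\<tau> powr (2 - q) * (\<kappa> * s) powr q = (T powr (2 - q) * \<kappa> powr q) * (s powr (2 - q) * s powr q)"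
      using T s k by (simp add: \<tau>_def powr_mult)
    also have "s powr (2 - q) * s powr q = s\<^sup>2" using s by (simp add: powr_add[symmetric] powr_numeral)
    finally have "s\<^sup>2 \<le> \<tau> * expectation (\<lambda>x. \<bar>y x\<bar>) + s\<^sup>2 / 2"
      using TT by (simp add: mult_left_mono)
    then have "s * s \<le> s * (2 * T * expectation (\<lambda>x. \<bar>y x\<bar>))"
      by (simp add: \<tau>_def power2_eq_square algebra_simps)
    then have "s \<le> 2 * T * expectation (\<lambda>x. \<bar>y x\<bar>)" using s by simp
    then show ?thesis using T by (simp add: pos_divide_le_eq mult.commute)
  qed
  then show ?thesis by (simp add: s_def T_def)
qed

text \<open>
  A one-sided Paley-Zygmund inequality. A centred variable has positive part of mean at least
  \<open>c * s / 2\<close>; values below \<open>c * s / 4\<close> account for at most half of it, and the inequality of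
  arithmetic and geometric means turns the remainder into a probability.
\<close>

lemma (in prob_space) small_ball_one_sided:
  fixes Y :: "'a \<Rightarrow> real"
  assumes Y1: "integrable M Y" and Y2: "integrable M (\<lambda>x. (Y x)\<^sup>2)" and Y0: "expectation Y = 0"
    and s: "0 < s" and s2: "expectation (\<lambda>x. (Y x)\<^sup>2) = s\<^sup>2" and c: "0 < c"
    and ge: "c * s \<le> expectation (\<lambda>x. \<bar>Y x\<bar>)"
  shows "c\<^sup>2 / 16 \<le> \<P>(x in M. c / 4 * s \<le> Y x)"
proof -
  let ?A = "{x\<in>space M. c / 4 * s \<le> Y x}"
  have [measurable]: "Y \<in> borel_measurable M" using Y1 by auto
  define \<alpha> where "\<alpha> = s * 4 / c"
  have al: "0 < \<alpha>" using s c by (simp add: \<alpha>_def)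
  have pw: "(\<bar>Y x\<bar> + Y x) / 2 \<le> c / 4 * s + ((Y x)\<^sup>2 / \<alpha> + \<alpha> * indicator ?A x) / 2" if "x \<in> space M" for x
  proof (cases "c / 4 * s \<le> Y x")
    case True
    have "0 \<le> c / 4 * s" using c s by simp
    have "0 \<le> (Y x / sqrt \<alpha> - sqrt \<alpha>)\<^sup>2" by simp
    also have "\<dots> = (Y x)\<^sup>2 / \<alpha> - 2 * Y x + \<alpha>"
      using al by (simp add: power2_diff power_divide)
    finally have "2 * Y x \<le> (Y x)\<^sup>2 / \<alpha> + \<alpha>" by simp
    moreover have "indicator ?A x = (1 :: real)" "\<bar>Y x\<bar> = Y x"
      using True that \<open>0 \<le> c / 4 * s\<close> by auto
    moreover have "(b + b) / 2 \<le> e + t / 2" if "2 * b \<le> t" "0 \<le> e" for b e t :: real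
      using that by simp
    ultimately show ?thesis using \<open>0 \<le> c / 4 * s\<close> by (simp only: mult_1_right)
  next
    case False
    moreover have "0 \<le> c / 4 * s" using c s by simp
    moreover have "0 \<le> (Y x)\<^sup>2 / \<alpha>" using al by simp
    ultimately show ?thesis by (auto simp: abs_if)
  qed
  have "c * s / 2 \<le> expectation (\<lambda>x. (\<bar>Y x\<bar> + Y x) / 2)" using Y1 Y0 ge by simp
  also have "\<dots> \<le> expectation (\<lambda>x. c / 4 * s + ((Y x)\<^sup>2 / \<alpha> + \<alpha> * indicator ?A x) / 2)"
  proof (rule integral_mono[OF _ _ pw])
    show "integrable M (\<lambda>x. c / 4 * s + ((Y x)\<^sup>2 / \<alpha> + \<alpha> * indicator ?A x) / 2)"
      using Y2 by (intro Bochner_Integration.integrable_add integrable_divide_zero integrable_mult_right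
          integrable_real_indicator) (auto simp: emeasure_eq_measure)
  qed (use Y1 in auto)
  also have "\<dots> = c / 4 * s + (s\<^sup>2 / \<alpha> + \<alpha> * prob ?A) / 2"
  proof -
    have i: "integrable M (\<lambda>x. (Y x)\<^sup>2 / \<alpha>)" "integrable M (\<lambda>x. \<alpha> * indicator ?A x :: real)"
      using Y2 by (auto simp: emeasure_eq_measure intro!: integrable_mult_right integrable_real_indicator)
    have "expectation (\<lambda>x. \<alpha> * indicator ?A x) = \<alpha> * prob ?A"
      by (subst integral_mult_right_zero, subst Bochner_Integration.integral_indicator) simp
    moreover have "expectation (\<lambda>x. (Y x)\<^sup>2 / \<alpha>) = s\<^sup>2 / \<alpha>" by (simp add: s2)
    moreover have "expectation (\<lambda>x. c / 4 * s + ((Y x)\<^sup>2 / \<alpha> + \<alpha> * indicator ?A x) / 2)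
      = expectation (\<lambda>x. c / 4 * s) + expectation (\<lambda>x. ((Y x)\<^sup>2 / \<alpha> + \<alpha> * indicator ?A x) / 2)"
      by (rule Bochner_Integration.integral_add)
        (use Bochner_Integration.integrable_add[OF i] in \<open>simp_all add: integrable_divide_zero\<close>)
    moreover have "expectation (\<lambda>x. ((Y x)\<^sup>2 / \<alpha> + \<alpha> * indicator ?A x) / 2)
      = (expectation (\<lambda>x. (Y x)\<^sup>2 / \<alpha>) + expectation (\<lambda>x. \<alpha> * indicator ?A x)) / 2"
      by (subst integral_divide_zero, subst Bochner_Integration.integral_add[OF i]) simp
    ultimately show ?thesis by (simp only: lebesgue_integral_const prob_space) simp
  qed
  also have "\<dots> = s * (c / 4 + c / 8 + 2 * prob ?A / c)"
    using s c by (simp add: \<alpha>_def field_simps power2_eq_square)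
  finally have "s * (c / 2) \<le> s * (c / 4 + c / 8 + 2 * prob ?A / c)" by (simp add: mult.commute)
  then have "c / 2 \<le> c / 4 + c / 8 + 2 * prob ?A / c" using s by simp
  then have "c * c / 16 \<le> prob ?A" using c by (simp add: field_simps)
  then show ?thesis by (simp add: power2_eq_square)
qed

section \<open>Uniform counting\<close>

lemma integral_double_sum:
  fixes f :: "nat \<Rightarrow> nat \<Rightarrow> 'a \<Rightarrow> real" and d :: nat
  assumes "\<And>i j. i < d \<Longrightarrow> j < d \<Longrightarrow> integrable M (f i j)"
  shows "integrable M (\<lambda>x. \<Sum>i<d. \<Sum>j<d. f i j x)"
    and "(\<integral>x. (\<Sum>i<d. \<Sum>j<d. f i j x) \<partial>M) = (\<Sum>i<d. \<Sum>j<d. \<integral>x. f i j x \<partial>M)"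
proof -
  have i: "integrable M (\<lambda>x. \<Sum>j<d. f i j x)" if "i < d" for i
    using assms that by (intro Bochner_Integration.integrable_sum) auto
  then show "integrable M (\<lambda>x. \<Sum>i<d. \<Sum>j<d. f i j x)"
    by (rule Bochner_Integration.integrable_sum) simp
  have "(\<integral>x. (\<Sum>i<d. \<Sum>j<d. f i j x) \<partial>M) = (\<Sum>i<d. \<integral>x. (\<Sum>j<d. f i j x) \<partial>M)"
    using i by (intro Bochner_Integration.integral_sum) auto
  also have "\<dots> = (\<Sum>i<d. \<Sum>j<d. \<integral>x. f i j x \<partial>M)"
    using assms by (intro sum.cong refl Bochner_Integration.integral_sum) auto
  finally show "(\<integral>x. (\<Sum>i<d. \<Sum>j<d. f i j x) \<partial>M) = (\<Sum>i<d. \<Sum>j<d. \<integral>x. f i j x \<partial>M)" .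
qed

text \<open>
  Truncation to the unit interval; it serves as a Lipschitz substitute for an indicator function.
\<close>

definition clip :: "real \<Rightarrow> real" where
  "clip t = max 0 (min 1 t)"

lemma clip_bounds: "0 \<le> clip t" "clip t \<le> 1"
  by (auto simp: clip_def)

lemma clip_eq_0: "t \<le> 0 \<Longrightarrow> clip t = 0"
  and clip_eq_1: "1 \<le> t \<Longrightarrow> clip t = 1"
  by (auto simp: clip_def)

lemma clip_lipschitz: "\<bar>clip a - clip b\<bar> \<le> \<bar>a - b\<bar>"
  by (auto simp: clip_def)

lemma clip_measurable [measurable]: "clip \<in> borel_measurable borel"
  unfolding clip_def by measurable

text \<open>
  The two uniform counting statements. The covariance matrix of \<open>Q\<close> is \<open>S / m\<close> (for block means, \<open>m\<close>
  will be the length of a block) and \<open>V\<close> is the variance of the marginals. Outside an exponentially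
  small event, simultaneously for all directions: only a small fraction of the sample deviates upwards
  from the mean by more than a multiple of \<open>sqrt (V u + r\<^sup>2 (nrm d u)\<^sup>2)\<close>, and, provided that the
  standard deviation dominates \<open>r * nrm d u\<close>, twice this fraction of the sample lies strictly above
  the mean. The fraction \<open>c\<^sup>2 / 16\<close> comes from the one-sided small-ball estimate.
\<close>

lemma uniform_counts:
  fixes Q :: "(nat \<Rightarrow> real) measure" and S :: "real mat" and c r m :: real and d n :: nat
  defines "V \<equiv> \<lambda>u. (\<Sum>i<d. \<Sum>j<d. S $$ (i, j) * u i * u j) / m"
  assumes Q: "prob_space Q" and Qs: "sets Q = sets (Rd d)"
    and m1: "\<And>i. i < d \<Longrightarrow> integrable Q (\<lambda>x. x i)" "\<And>i. i < d \<Longrightarrow> (\<integral>x. x i \<partial>Q) = \<mu> i"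
    and m2: "\<And>i j. i < d \<Longrightarrow> j < d \<Longrightarrow> integrable Q (\<lambda>x. (x i - \<mu> i) * (x j - \<mu> j))"
      "\<And>i j. i < d \<Longrightarrow> j < d \<Longrightarrow> (\<integral>x. (x i - \<mu> i) * (x j - \<mu> j) \<partial>Q) = S $$ (i, j) / m"
    and abs1: "\<And>u. u \<in> rat_dirs d \<Longrightarrow> c * sqrt (V u) \<le> (\<integral>x. \<bar>ip d (vdiff d x \<mu>) u\<bar> \<partial>Q)"
    and S: "S \<in> carrier_mat d d" and ev: "ordered_eigenvalues d S lam"
    and c: "0 < c" "c \<le> 1" and r: "0 < r" and m: "0 < m" and n: "1 \<le> n" and d: "1 \<le> d"
    and tr: "(\<Sum>i\<in>{1..d}. lam i / (lam i + m * r\<^sup>2)) \<le> 2 * (c ^ 3 / 4096)\<^sup>2 * real n"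
  obtains A where "A \<in> sets (\<Pi>\<^sub>M j\<in>{..<n}. Q)"
    "measure (\<Pi>\<^sub>M j\<in>{..<n}. Q) A \<ge> 1 - 2 * exp (- real n * (c\<^sup>2 / 256)\<^sup>2 / 2)"
    "\<And>x u. x \<in> A \<Longrightarrow> u \<in> rat_dirs d \<Longrightarrow>
        real (card {j. j < n \<and> 32 / c * sqrt ((sqrt (V u))\<^sup>2 + r\<^sup>2 * (nrm d u)\<^sup>2) < ip d (x j) u - ip d \<mu> u})
          < c\<^sup>2 / 16 * real n / 4"
    "\<And>x u. x \<in> A \<Longrightarrow> u \<in> rat_dirs d \<Longrightarrow> r * nrm d u \<le> sqrt (V u) \<Longrightarrow>
        c\<^sup>2 / 16 * real n / 2 \<le> real (card {j. j < n \<and> 0 < ip d (x j) u - ip d \<mu> u})"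
proof -
  interpret Q: prob_space Q by fact
  let ?P = "\<Pi>\<^sub>M j\<in>{..<n}. Q" and ?U = "rat_dirs d"
  interpret P: prob_space ?P by (intro prob_space_PiM Q)
  have cm: "(\<lambda>x. x i) \<in> borel_measurable Q" if "i < d" for i using m1(1)[OF that] by auto
  define Y where "Y = (\<lambda>u x. ip d (vdiff d x \<mu>) u)"
  have Y_sum: "Y u x = (\<Sum>i<d. (x i - \<mu> i) * u i)" for u x by (simp add: Y_def ip_def vdiff_def)
  have Y_ip: "Y u x = ip d x u - ip d \<mu> u" for u x by (simp add: Y_def ip_vdiff)
  have Y_sq: "(Y u x)\<^sup>2 = (\<Sum>i<d. \<Sum>j<d. (x i - \<mu> i) * (x j - \<mu> j) * (u i * u j))" for u x
    unfolding Y_sum power2_eq_square sum_product by (intro sum.cong refl) (simp add: mult_ac)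
  have Yi: "integrable Q (Y u)" for u
    unfolding Y_sum using m1(1) by (intro Bochner_Integration.integrable_sum integrable_mult_left) auto
  have Y0: "(\<integral>x. Y u x \<partial>Q) = 0" for u
    unfolding Y_sum using m1 by (subst Bochner_Integration.integral_sum) (auto simp: Q.prob_space)
  have Y2i: "integrable Q (\<lambda>x. (Y u x)\<^sup>2)" for u
    unfolding Y_sq using m2(1) by (intro integral_double_sum integrable_mult_left) auto
  have Y2: "(\<integral>x. (Y u x)\<^sup>2 \<partial>Q) = V u" for u
    unfolding Y_sq V_def sum_divide_distrib using m2 by (subst integral_double_sum) (auto intro!: sum.cong)
  have V0: "0 \<le> V u" for u unfolding Y2[symmetric] by simp
  have sym: "S $$ (i, j) = S $$ (j, i)" if "i < d" "j < d" for i j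
    using m2(2)[OF that] m2(2)[OF that(2,1)] m by (simp add: mult.commute)
  have r2: "0 < m * r\<^sup>2" using r m by simp
  have psd: "0 \<le> (\<Sum>i<d. \<Sum>j<d. S $$ (i, j) * v i * v j)" for v
    using V0[of v] m by (simp add: V_def zero_le_divide_iff)
  obtain G where G0: "\<And>w. 0 \<le> (\<Sum>i<d. \<Sum>j<d. G i j * w i * w j)"
    and Gle: "\<And>w u. (ip d w u)\<^sup>2 \<le> (\<Sum>i<d. \<Sum>j<d. G i j * w i * w j)
        * ((\<Sum>i<d. \<Sum>j<d. S $$ (i, j) * u i * u j) + m * r\<^sup>2 * ip d u u)"
    and Gtr: "(\<Sum>i<d. \<Sum>j<d. G i j * S $$ (i, j)) = (\<Sum>i\<in>{1..d}. lam i / (lam i + m * r\<^sup>2))"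
    by (rule resolvent_form[OF S ev r2 sym psd]) auto
  define q where "q = (\<lambda>w. m * (\<Sum>i<d. \<Sum>j<d. G i j * w i * w j))"
  define \<rho> where "\<rho> = (\<lambda>u. sqrt ((sqrt (V u))\<^sup>2 + r\<^sup>2 * (nrm d u)\<^sup>2))"
  have rho2: "(\<rho> u)\<^sup>2 = V u + r\<^sup>2 * (nrm d u)\<^sup>2" for u using V0[of u] by (simp add: \<rho>_def)
  have rho0: "0 < \<rho> u" if "u \<in> ?U" for u
    using that r V0[of u] by (auto simp: \<rho>_def rat_dirs_def intro!: add_nonneg_pos)
  define e where "e = (\<lambda>u w. ip d w u / \<rho> u)"
  define cc where "cc = (\<lambda>x. vdiff d x \<mu>)"
  have eY: "e u (cc x) = Y u x / \<rho> u" for u x by (simp add: e_def cc_def Y_def)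
  have cci: "cc x i = x i - \<mu> i" if "i < d" for x i using that by (simp add: cc_def vdiff_def)
  have U: "countable ?U" "?U \<noteq> {}" using countable_rat_dirs rat_dirs_nonempty[OF d] by auto
  have add: "e u (v + w) = e u v + e u w" if "u \<in> ?U" for u v w
    by (simp add: e_def ip_def algebra_simps sum.distrib add_divide_distrib)
  have q0: "0 \<le> q w" for w unfolding q_def using m G0 by simp
  have par: "q (v + w) + q (v - w) = 2 * q v + 2 * q w" for v w
    unfolding q_def mult.left_commute[of 2 m] distrib_left[symmetric] sum_distrib_left sum.distrib[symmetric]
    by (intro sum.cong refl arg_cong[of _ _ "(*) m"]) (simp add: algebra_simps)
  have eq: "e u w \<le> sqrt (q w)" if u: "u \<in> ?U" for u w
  proof -
    have "(ip d w u)\<^sup>2 \<le> q w * (\<rho> u)\<^sup>2" 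
    proof -
      have "(\<Sum>i<d. \<Sum>j<d. S $$ (i, j) * u i * u j) + m * r\<^sup>2 * ip d u u = m * (\<rho> u)\<^sup>2"
        unfolding rho2 V_def nrm_sq using m by (simp add: algebra_simps)
      with Gle[of w u] show ?thesis by (simp add: q_def mult_ac)
    qed
    then have "(e u w)\<^sup>2 \<le> q w" using rho0[OF u] by (simp add: e_def power_divide pos_divide_le_eq)
    then show ?thesis by (rule real_le_rsqrt)
  qed
  have em: "(\<lambda>z. e u (cc z)) \<in> borel_measurable Q" if "u \<in> ?U" for u
    unfolding eY using Yi[of u] by auto
  have q_cc: "q (cc z) = (\<Sum>i<d. \<Sum>j<d. m * G i j * ((z i - \<mu> i) * (z j - \<mu> j)))" for z
    unfolding q_def sum_distrib_left by (intro sum.cong refl) (simp add: cci mult.assoc)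
  have qm: "(\<lambda>z. q (w + cc z)) \<in> borel_measurable Q" for w
  proof -
    have "q (w + cc z) = m * (\<Sum>i<d. \<Sum>j<d. G i j * (w i + (z i - \<mu> i)) * (w j + (z j - \<mu> j)))" for z
      unfolding q_def by (intro sum.cong refl arg_cong[of _ _ "(*) m"]) (simp add: cci)
    note q_eq = this
    show ?thesis
      unfolding q_eq by (intro borel_measurable_sum borel_measurable_times borel_measurable_add
        borel_measurable_diff borel_measurable_const cm) auto
  qed
  have qi: "integrable Q (\<lambda>z. q (cc z))"
    unfolding q_cc using m2(1) by (intro Bochner_Integration.integrable_sum integrable_mult_right) auto
  have tau: "(\<integral>z. q (cc z) \<partial>Q) = (\<Sum>i\<in>{1..d}. lam i / (lam i + m * r\<^sup>2))"
    unfolding q_cc Gtr[symmetric] using m2 m by (subst integral_double_sum) (auto intro!: sum.cong)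
  have sq: "sqrt (real n * (\<integral>z. q (cc z) \<partial>Q)) \<le> sqrt 2 * (c ^ 3 / 4096) * real n"
  proof -
    have "real n * (\<integral>z. q (cc z) \<partial>Q) \<le> real n * (2 * (c ^ 3 / 4096)\<^sup>2 * real n)"
      using tr unfolding tau by (intro mult_left_mono) auto
    also have "\<dots> = 2 * ((c ^ 3 / 4096) * real n)\<^sup>2" by (simp add: power2_eq_square)
    finally have "sqrt (real n * (\<integral>z. q (cc z) \<partial>Q)) \<le> sqrt (2 * ((c ^ 3 / 4096) * real n)\<^sup>2)"
      by (rule real_sqrt_le_mono)
    also have "\<dots> = sqrt 2 * ((c ^ 3 / 4096) * real n)" using c by (simp add: real_sqrt_mult)
    finally show ?thesis by (simp add: mult.assoc)
  qed
  define t where "t = c\<^sup>2 / 256"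
  have t: "0 < t" using c by (simp add: t_def)
  \<comment> \<open>\<open>\<psi>A\<close> dominates the indicator of \<open>{32 / c<..}\<close> and is dominated by a small multiple of the square;
    \<open>1 - \<psi>B\<close> vanishes on the nonpositive half-line and is \<open>1\<close> from \<open>c / (4 * sqrt 2)\<close> on\<close>
  define \<psi>A where "\<psi>A = (\<lambda>s. clip (c / 16 * s - 1))"
  define \<psi>B where "\<psi>B = (\<lambda>s. 1 - clip (4 * sqrt 2 / c * s))"
  have mA: "\<psi>A \<in> borel_measurable borel" and mB: "\<psi>B \<in> borel_measurable borel"
    unfolding \<psi>A_def \<psi>B_def by measurable
  have bA: "0 \<le> \<psi>A s" "\<psi>A s \<le> 1" and bB: "0 \<le> \<psi>B s" "\<psi>B s \<le> 1" for s
    using clip_bounds by (auto simp: \<psi>A_def \<psi>B_def)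
  have lA: "\<bar>\<psi>A a - \<psi>A b\<bar> \<le> c / 16 * \<bar>a - b\<bar>" for a b
  proof -
    have eq: "c / 16 * a - 1 - (c / 16 * b - 1) = c / 16 * (a - b)" by (simp add: algebra_simps)
    have "\<bar>\<psi>A a - \<psi>A b\<bar> \<le> \<bar>c / 16 * (a - b)\<bar>"
      using clip_lipschitz[of "c / 16 * a - 1" "c / 16 * b - 1"] unfolding eq \<psi>A_def .
    then show ?thesis using c by (simp add: abs_mult)
  qed
  have lB: "\<bar>\<psi>B a - \<psi>B b\<bar> \<le> 4 * sqrt 2 / c * \<bar>a - b\<bar>" for a b
  proof -
    have eq: "4 * sqrt 2 / c * b - 4 * sqrt 2 / c * a = 4 * sqrt 2 / c * (b - a)"
      by (rule right_diff_distrib[symmetric])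
    have eq2: "\<psi>B a - \<psi>B b = clip (4 * sqrt 2 / c * b) - clip (4 * sqrt 2 / c * a)" by (simp add: \<psi>B_def)
    have "\<bar>\<psi>B a - \<psi>B b\<bar> \<le> \<bar>4 * sqrt 2 / c * (b - a)\<bar>"
      using clip_lipschitz[of "4 * sqrt 2 / c * b" "4 * sqrt 2 / c * a"] unfolding eq eq2 .
    then have "\<bar>\<psi>B a - \<psi>B b\<bar> \<le> \<bar>4 * sqrt 2 / c * (a - b)\<bar>"
      by (simp add: abs_mult abs_minus_commute)
    then show ?thesis using c by (simp add: abs_mult)
  qed
  have LA: "0 \<le> c / 16" and LB: "0 \<le> 4 * sqrt 2 / c" using c by auto
  define BadA where "BadA = {x \<in> space ?P. \<exists>u\<in>?U. real n * (\<integral>z. \<psi>A (e u (cc z)) \<partial>Q)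
     + 2 * (c / 16) * sqrt (real n * (\<integral>z. q (cc z) \<partial>Q)) + real n * t < (\<Sum>j<n. \<psi>A (e u (cc (x j))))}"
  define BadB where "BadB = {x \<in> space ?P. \<exists>u\<in>?U. real n * (\<integral>z. \<psi>B (e u (cc z)) \<partial>Q)
     + 2 * (4 * sqrt 2 / c) * sqrt (real n * (\<integral>z. q (cc z) \<partial>Q)) + real n * t < (\<Sum>j<n. \<psi>B (e u (cc (x j))))}"
  note UA = uniform_deviation[where n = n and e = e and q = q and c = cc and \<psi> = \<psi>A and U = ?U and L = "c / 16", OF Q U add q0 par eq em qm qi mA bA lA LA t, folded BadA_def]
  note UB = uniform_deviation[where n = n and e = e and q = q and c = cc and \<psi> = \<psi>B and U = ?U and L = "4 * sqrt 2 / c", OF Q U add q0 par eq em qm qi mB bB lB LB t, folded BadB_def]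
  define A where "A = space ?P - (BadA \<union> BadB)"
  have As: "A \<in> sets ?P" unfolding A_def using UA(1) UB(1) by auto
  have Am: "1 - 2 * exp (- real n * (c\<^sup>2 / 256)\<^sup>2 / 2) \<le> measure ?P A"
  proof -
    have "measure ?P (BadA \<union> BadB) \<le> measure ?P BadA + measure ?P BadB"
      using UA(1) UB(1) by (rule measure_Un_le)
    also have "\<dots> \<le> 2 * exp (- real n * t\<^sup>2 / 2)" using UA(2) UB(2) by simp
    finally show ?thesis
      unfolding A_def using UA(1) UB(1) by (subst P.prob_compl) (auto simp: t_def)
  qed
  have few: "real (card {j. j < n \<and> 32 / c * \<rho> u < ip d (x j) u - ip d \<mu> u}) < c\<^sup>2 / 16 * real n / 4"
    if x: "x \<in> A" and u: "u \<in> ?U" for x u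
  proof -
    let ?J = "{j. j < n \<and> 32 / c * \<rho> u < ip d (x j) u - ip d \<mu> u}"
    have "real (card ?J) = (\<Sum>j<n. if j \<in> ?J then 1 else 0)"
      by (simp add: sum.If_cases Int_def)
    also have "\<dots> \<le> (\<Sum>j<n. \<psi>A (e u (cc (x j))))"
    proof (rule sum_mono)
      fix j
      show "(if j \<in> ?J then 1 else 0) \<le> \<psi>A (e u (cc (x j)))"
      proof (cases "j \<in> ?J")
        case True
        then have "32 / c < Y u (x j) / \<rho> u" using rho0[OF u] by (simp add: Y_ip pos_less_divide_eq)
        then have "c / 16 * (32 / c) \<le> c / 16 * (Y u (x j) / \<rho> u)"
          using c by (intro mult_left_mono) auto
        then have "1 \<le> c / 16 * (Y u (x j) / \<rho> u) - 1" using c by simp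
        then show ?thesis using True by (simp add: eY \<psi>A_def clip_def)
      qed (use bA in auto)
    qed
    also have "\<dots> \<le> real n * (\<integral>z. \<psi>A (e u (cc z)) \<partial>Q)
        + 2 * (c / 16) * sqrt (real n * (\<integral>z. q (cc z) \<partial>Q)) + real n * t"
      using x u by (force simp: A_def BadA_def)
    finally have F1: "real (card ?J) \<le> real n * (\<integral>z. \<psi>A (e u (cc z)) \<partial>Q)
        + 2 * (c / 16) * sqrt (real n * (\<integral>z. q (cc z) \<partial>Q)) + real n * t" .
    have F2: "(\<integral>z. \<psi>A (e u (cc z)) \<partial>Q) \<le> c\<^sup>2 / 256"
    proof -
      have pw: "\<psi>A s \<le> (c\<^sup>2 / 256) * s\<^sup>2" for s
      proof (cases "c / 16 * s \<le> 1")
        case True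
        then have "\<psi>A s = 0" by (simp add: \<psi>A_def clip_def)
        then show ?thesis by simp
      next
        case False
        then have "1 \<le> (c / 16 * s)\<^sup>2" by (simp add: one_le_power)
        also have "\<dots> = (c\<^sup>2 / 256) * s\<^sup>2" by (simp add: power_mult_distrib power_divide)
        finally show ?thesis using bA(2)[of s] by linarith
      qed
      have e2: "(e u (cc z))\<^sup>2 = (Y u z)\<^sup>2 / (\<rho> u)\<^sup>2" for z by (simp add: eY power_divide)
      have "(\<integral>z. \<psi>A (e u (cc z)) \<partial>Q) \<le> (\<integral>z. (c\<^sup>2 / 256) * (e u (cc z))\<^sup>2 \<partial>Q)"
      proof (rule integral_mono)
        show "integrable Q (\<lambda>z. \<psi>A (e u (cc z)))"
          using bA by (intro Q.integrable_const_bound[of _ 1] AE_I2 measurable_compose[OF em[OF u] mA]) auto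
        show "integrable Q (\<lambda>z. (c\<^sup>2 / 256) * (e u (cc z))\<^sup>2)" unfolding e2 using Y2i[of u] by simp
      qed (rule pw)
      also have "\<dots> = (c\<^sup>2 / 256) * (V u / (\<rho> u)\<^sup>2)" unfolding e2 by (simp add: Y2)
      also have "\<dots> \<le> (c\<^sup>2 / 256) * 1"
        using rho0[OF u] r V0[of u] by (intro mult_left_mono) (auto simp: pos_divide_le_eq rho2 divide_le_eq)
      finally show ?thesis by simp
    qed
    have F3: "2 * (c / 16) * sqrt (real n * (\<integral>z. q (cc z) \<partial>Q)) \<le> c\<^sup>2 / 256 * real n"
    proof -
      have "2 * (c / 16) * sqrt (real n * (\<integral>z. q (cc z) \<partial>Q))
          \<le> 2 * (c / 16) * (sqrt 2 * (c ^ 3 / 4096) * real n)"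
        using c sq by (intro mult_left_mono) auto
      also have "\<dots> = sqrt 2 * (c\<^sup>2 / 128) * (c\<^sup>2 / 256 * real n)"
        by (simp add: power2_eq_square power3_eq_cube)
      also have "\<dots> \<le> 1 * (c\<^sup>2 / 256 * real n)"
      proof (rule mult_right_mono)
        have "sqrt 2 \<le> 2" by (rule real_le_lsqrt) auto
        moreover have "c\<^sup>2 \<le> 1" using c by (simp add: power_le_one)
        ultimately have "sqrt 2 * (c\<^sup>2 / 128) \<le> 2 * (1 / 128)" by (intro mult_mono) auto
        then show "sqrt 2 * (c\<^sup>2 / 128) \<le> 1" by simp
      qed simp
      finally show ?thesis by simp
    qed
    have "real (card ?J) \<le> real n * (c\<^sup>2 / 256) + c\<^sup>2 / 256 * real n + real n * t"
      by (rule order_trans[OF F1]) (intro add_mono mult_left_mono F2 F3, auto)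
    also have "\<dots> = 3 * (c\<^sup>2 / 256 * real n)" by (simp add: t_def mult.commute)
    also have "\<dots> < c\<^sup>2 / 16 * real n / 4" using c n by simp
    finally show ?thesis .
  qed
  have many: "c\<^sup>2 / 16 * real n / 2 \<le> real (card {j. j < n \<and> 0 < ip d (x j) u - ip d \<mu> u})"
    if x: "x \<in> A" and u: "u \<in> ?U" and big: "r * nrm d u \<le> sqrt (V u)" for x u
  proof -
    let ?J = "{j. j < n \<and> 0 < ip d (x j) u - ip d \<mu> u}"
    define s where "s = sqrt (V u)"
    have s: "0 < s" using big r u unfolding s_def by (smt (verit) mult_pos_pos mem_Collect_eq rat_dirs_def)
    have s2: "V u = s\<^sup>2" using V0[of u] by (simp add: s_def)
    have rho_s: "\<rho> u \<le> sqrt 2 * s"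
    proof (rule power2_le_imp_le)
      have "(r * nrm d u)\<^sup>2 \<le> s\<^sup>2" using big r unfolding s_def by (intro power_mono) auto
      then show "(\<rho> u)\<^sup>2 \<le> (sqrt 2 * s)\<^sup>2" by (simp add: rho2 s2 power_mult_distrib)
    qed (use s in simp)
    have sb: "c\<^sup>2 / 16 \<le> \<P>(x in Q. c / 4 * s \<le> Y u x)"
    proof (rule Q.small_ball_one_sided[OF Yi Y2i Y0 s _ c(1)])
      show "(\<integral>x. (Y u x)\<^sup>2 \<partial>Q) = s\<^sup>2" by (simp only: Y2 s2)
      show "c * s \<le> (\<integral>x. \<bar>Y u x\<bar> \<partial>Q)" using abs1[OF u] unfolding s_def Y_def .
    qed
    have EB: "(\<integral>z. \<psi>B (e u (cc z)) \<partial>Q) \<le> 1 - c\<^sup>2 / 16"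
    proof -
      have Ym: "Y u \<in> borel_measurable Q" using Yi by auto
      have "(\<integral>z. \<psi>B (e u (cc z)) \<partial>Q) \<le> (\<integral>z. 1 - indicator {x\<in>space Q. c / 4 * s \<le> Y u x} z \<partial>Q)"
      proof (rule integral_mono)
        show "integrable Q (\<lambda>z. \<psi>B (e u (cc z)))"
          using bB by (intro Q.integrable_const_bound[of _ 1] AE_I2 measurable_compose[OF em[OF u] mB]) auto
        show "integrable Q (\<lambda>z. 1 - indicator {x\<in>space Q. c / 4 * s \<le> Y u x} z :: real)"
          using Ym by (intro Bochner_Integration.integrable_diff integrable_real_indicator) (auto simp: Q.emeasure_eq_measure)
        fix z assume z: "z \<in> space Q"
        show "\<psi>B (e u (cc z)) \<le> 1 - indicator {x\<in>space Q. c / 4 * s \<le> Y u x} z"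
        proof (cases "c / 4 * s \<le> Y u z")
          case True
          have "\<rho> u \<le> sqrt 2 * s" by (rule rho_s)
          also have "\<dots> = 4 * sqrt 2 / c * (c / 4 * s)" using c by simp
          also have "\<dots> \<le> 4 * sqrt 2 / c * Y u z" using True c by (intro mult_left_mono) auto
          finally have "1 \<le> 4 * sqrt 2 / c * Y u z / \<rho> u" using rho0[OF u] by (simp only: le_divide_eq_1_pos)
          then have "1 \<le> 4 * sqrt 2 / c * (Y u z / \<rho> u)" by simp
          from clip_eq_1[OF this] have "\<psi>B (e u (cc z)) = 0" by (simp only: \<psi>B_def eY diff_self)
          then show ?thesis using True z by simp
        qed (use bB in auto)
      qed
      also have "\<dots> = 1 - \<P>(x in Q. c / 4 * s \<le> Y u x)"
        using Ym by (subst Bochner_Integration.integral_diff)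
          (auto simp: Q.prob_space Q.emeasure_eq_measure intro!: integrable_real_indicator)
      finally show ?thesis using sb by simp
    qed
    have F1: "(\<Sum>j<n. \<psi>B (e u (cc (x j)))) \<le> real n * (\<integral>z. \<psi>B (e u (cc z)) \<partial>Q)
        + 2 * (4 * sqrt 2 / c) * sqrt (real n * (\<integral>z. q (cc z) \<partial>Q)) + real n * t"
      using x u by (force simp: A_def BadB_def)
    have F2: "real n * (\<integral>z. \<psi>B (e u (cc z)) \<partial>Q) \<le> real n * (1 - c\<^sup>2 / 16)"
      using EB by (intro mult_left_mono) auto
    have F3: "2 * (4 * sqrt 2 / c) * sqrt (real n * (\<integral>z. q (cc z) \<partial>Q)) \<le> c\<^sup>2 / 256 * real n"
    proof -
      have "2 * (4 * sqrt 2 / c) * sqrt (real n * (\<integral>z. q (cc z) \<partial>Q))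
          \<le> 2 * (4 * sqrt 2 / c) * (sqrt 2 * (c ^ 3 / 4096) * real n)"
        using c sq by (intro mult_left_mono) auto
      also have "\<dots> = (sqrt 2 * sqrt 2) * (8 * c\<^sup>2 / 4096) * real n"
        using c by (simp add: power2_eq_square power3_eq_cube)
      also have "\<dots> = c\<^sup>2 / 256 * real n" by simp
      finally show ?thesis .
    qed
    have "(\<Sum>j<n. \<psi>B (e u (cc (x j)))) \<le> real n * (1 - c\<^sup>2 / 16) + c\<^sup>2 / 256 * real n + real n * t"
      by (rule order_trans[OF F1]) (intro add_mono F2 F3 order_refl)
    also have "\<dots> = real n - c\<^sup>2 / 16 * real n + 2 * (c\<^sup>2 / 256 * real n)"
      by (simp add: t_def algebra_simps)
    finally have B1: "(\<Sum>j<n. \<psi>B (e u (cc (x j)))) \<le> real n - c\<^sup>2 / 16 * real n + 2 * (c\<^sup>2 / 256 * real n)" .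
    have "real n - (\<Sum>j<n. \<psi>B (e u (cc (x j)))) = (\<Sum>j<n. 1 - \<psi>B (e u (cc (x j))))"
      by (simp add: sum_subtractf)
    also have "\<dots> \<le> (\<Sum>j<n. if j \<in> ?J then 1 else 0)"
    proof (rule sum_mono)
      fix j assume j: "j \<in> {..<n}"
      show "1 - \<psi>B (e u (cc (x j))) \<le> (if j \<in> ?J then 1 else 0)"
      proof (cases "j \<in> ?J")
        case False
        then have "Y u (x j) \<le> 0" using j by (simp add: Y_ip)
        then have "4 * sqrt 2 / c * (Y u (x j) / \<rho> u) \<le> 0"
          using c rho0[OF u] by (intro mult_nonneg_nonpos divide_nonpos_pos) auto
        from clip_eq_0[OF this] have "\<psi>B (e u (cc (x j))) = 1" by (simp only: \<psi>B_def eY diff_zero)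
        then show ?thesis using False by simp
      qed (use bB in auto)
    qed
    also have "\<dots> = real (card ?J)" by (simp add: sum.If_cases Int_def)
    finally have "c\<^sup>2 / 16 * real n - 2 * (c\<^sup>2 / 256 * real n) \<le> real (card ?J)" using B1 by simp
    moreover have "0 \<le> c\<^sup>2 * real n" by simp
    ultimately show ?thesis by (simp add: field_simps)
  qed
  show ?thesis
    by (rule that[OF As Am few[unfolded \<rho>_def] many])
qed

section \<open>Block means\<close>

text \<open>
  The average of the \<open>m\<close> vectors \<open>x 0, \<dots>, x (m - 1)\<close>.
\<close>

definition block_mean :: "nat \<Rightarrow> nat \<Rightarrow> (nat \<Rightarrow> nat \<Rightarrow> real) \<Rightarrow> (nat \<Rightarrow> real)" where
  "block_mean d m x = (\<lambda>i\<in>{..<d}. (\<Sum>a<m. x a i) / real m)"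

text \<open>
  The means of \<open>n\<close> consecutive blocks of length \<open>m\<close>; observations with index \<open>\<ge> n * m\<close> are ignored.
\<close>

definition block_means :: "nat \<Rightarrow> nat \<Rightarrow> nat \<Rightarrow> (nat \<Rightarrow> nat \<Rightarrow> real) \<Rightarrow> (nat \<Rightarrow> nat \<Rightarrow> real)" where
  "block_means d n m x = (\<lambda>j\<in>{..<n}. block_mean d m (\<lambda>a\<in>{..<m}. x (j * m + a)))"

text \<open>
  The distribution of the mean of \<open>m\<close> independent vectors with distribution \<open>P\<close>.
\<close>

definition block_law :: "nat \<Rightarrow> nat \<Rightarrow> (nat \<Rightarrow> real) measure \<Rightarrow> (nat \<Rightarrow> real) measure" where
  "block_law d m P = distr (\<Pi>\<^sub>M a\<in>{..<m}. P) (Rd d) (block_mean d m)"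

lemma block_mean_measurable: "block_mean d m \<in> sample_space d m \<rightarrow>\<^sub>M Rd d"
  unfolding block_mean_def Rd_def
  by (rule measurable_restrict)
     (intro borel_measurable_divide borel_measurable_sum borel_measurable_const sample_space_coord, auto)

lemma sets_iid_law:
  assumes "sets P = sets (Rd d)"
  shows "sets (\<Pi>\<^sub>M k\<in>{..<n}. P) = sets (sample_space d n)"
  unfolding sample_space_def using assms by (intro sets_PiM_cong) auto

lemma block_index:
  assumes "j < n" "a < m" "n * m \<le> N" shows "j * m + a < (N :: nat)"
proof -
  have "Suc j * m \<le> n * m" using assms(1) by (intro mult_right_mono) auto
  then show ?thesis using assms(2,3) by simp
qed

lemma block_means_measurable:
  assumes "n * m \<le> N"
  shows "block_means d n m \<in> sample_space d N \<rightarrow>\<^sub>M sample_space d n"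
proof -
  have "(\<lambda>x. \<lambda>a\<in>{..<m}. x (j * m + a)) \<in> sample_space d N \<rightarrow>\<^sub>M sample_space d m" if "j < n" for j
    unfolding sample_space_def
    by (rule measurable_restrict, rule measurable_component_singleton)
       (use block_index[OF that _ assms] in auto)
  from measurable_compose[OF this block_mean_measurable] show ?thesis
    unfolding block_means_def sample_space_def[of d n]
    by (intro measurable_restrict) auto
qed

lemma (in prob_space) indep_vars_PiM_coords:
  assumes I: "I \<noteq> {}" "finite I"
  shows "prob_space.indep_vars (\<Pi>\<^sub>M i\<in>I. M) (\<lambda>_. M) (\<lambda>i x. x i) I"
proof -
  interpret P: prob_space "\<Pi>\<^sub>M i\<in>I. M" by (intro prob_space_PiM prob_space_axioms)
  have rv: "(\<lambda>x. x i) \<in> (\<Pi>\<^sub>M i\<in>I. M) \<rightarrow>\<^sub>M M" if "i \<in> I" for i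
    using that by (rule measurable_component_singleton)
  have "distr (\<Pi>\<^sub>M i\<in>I. M) (\<Pi>\<^sub>M i\<in>I. M) (\<lambda>x. \<lambda>i\<in>I. x i)
      = distr (\<Pi>\<^sub>M i\<in>I. M) (\<Pi>\<^sub>M i\<in>I. M) (\<lambda>x. x)"
    by (rule distr_cong) (auto simp: space_PiM)
  also have "\<dots> = (\<Pi>\<^sub>M i\<in>I. M)" by (rule distr_id)
  also have "\<dots> = (\<Pi>\<^sub>M i\<in>I. distr (\<Pi>\<^sub>M i\<in>I. M) M (\<lambda>x. x i))"
    by (rule PiM_cong) (auto intro!: distr_PiM_component[symmetric] prob_space_axioms)
  finally show ?thesis using P.indep_vars_iff_distr_eq_PiM'[OF I(1) rv] by simp
qed

lemma distr_block_means:
  assumes P: "prob_space P" and Ps: "sets P = sets (Rd d)" and nm: "n * m \<le> N" "1 \<le> n" "1 \<le> m"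
  shows "distr (iid_law N P) (sample_space d n) (block_means d n m) = (\<Pi>\<^sub>M j\<in>{..<n}. block_law d m P)"
proof -
  interpret P: prob_space P by fact
  interpret N: prob_space "iid_law N P" unfolding iid_law_def by (intro prob_space_PiM P)
  have "1 * 1 \<le> N" by (rule order_trans[OF mult_le_mono[OF nm(2,3)] nm(1)])
  then have N0: "{..<N} \<noteq> {}" by (auto simp: lessThan_empty_iff)
  have ind: "N.indep_vars (\<lambda>_. P) (\<lambda>i x. x i) {..<N}"
    using P.indep_vars_PiM_coords[OF N0] by (simp add: iid_law_def)
  define K where "K = (\<lambda>j. {j * m ..< j * m + m})"
  have KN: "K j \<subseteq> {..<N}" if "j \<in> {..<n}" for j
  proof
    fix k assume "k \<in> K j"
    then have k: "j * m \<le> k" "k - j * m < m" by (auto simp: K_def)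
    from block_index[of j n, OF _ k(2) nm(1)] that k(1) show "k \<in> {..<N}" by simp
  qed
  have Kd: "disjoint_family_on K {..<n}"
    unfolding disjoint_family_on_def
  proof safe
    fix i j k assume "k \<in> K i" "k \<in> K j" "i \<noteq> j"
    then have "k div m = i" "k div m = j"
      by (auto simp: K_def intro!: div_nat_eqI simp: mult.commute)
    with \<open>i \<noteq> j\<close> show "k \<in> {}" by simp
  qed
  have ind2: "N.indep_vars (\<lambda>j. \<Pi>\<^sub>M i\<in>K j. P) (\<lambda>j x. \<lambda>i\<in>K j. x i) {..<n}"
    by (rule N.indep_vars_restrict[OF ind KN Kd])
  define Yj where "Yj = (\<lambda>j (y :: nat \<Rightarrow> nat \<Rightarrow> real). block_mean d m (\<lambda>a\<in>{..<m}. y (j * m + a)))"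
  have Rm: "(\<lambda>x. \<lambda>a\<in>{..<m}. x (j * m + a)) \<in> (\<Pi>\<^sub>M i\<in>K j. P) \<rightarrow>\<^sub>M (\<Pi>\<^sub>M a\<in>{..<m}. P)" for j
    by (rule measurable_restrict, rule measurable_component_singleton) (auto simp: K_def)
  have bmm: "block_mean d m \<in> (\<Pi>\<^sub>M a\<in>{..<m}. P) \<rightarrow>\<^sub>M Rd d"
    using block_mean_measurable[of d m] measurable_cong_sets[OF sets_iid_law[OF Ps, of m] refl] by blast
  have Ym: "Yj j \<in> (\<Pi>\<^sub>M i\<in>K j. P) \<rightarrow>\<^sub>M Rd d" for j
    unfolding Yj_def using measurable_compose[OF Rm bmm] by simp
  have ind3: "N.indep_vars (\<lambda>_. Rd d) (\<lambda>j x. Yj j (\<lambda>i\<in>K j. x i)) {..<n}"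
    by (rule N.indep_vars_compose2[OF ind2 Ym])
  have Yeq: "Yj j (\<lambda>i\<in>K j. x i) = block_mean d m (\<lambda>a\<in>{..<m}. x (j * m + a))" for j x
    unfolding Yj_def by (rule arg_cong[of _ _ "block_mean d m"]) (auto simp: K_def fun_eq_iff)
  have law: "distr (iid_law N P) (Rd d) (\<lambda>x. Yj j (\<lambda>i\<in>K j. x i)) = block_law d m P" if j: "j < n" for j
  proof -
    have re: "distr (iid_law N P) (\<Pi>\<^sub>M a\<in>{..<m}. P) (\<lambda>x. \<lambda>a\<in>{..<m}. x (j * m + a)) = (\<Pi>\<^sub>M a\<in>{..<m}. P)"
      unfolding iid_law_def
      by (rule distr_PiM_reindex) (use block_index[OF j _ nm(1)] P in \<open>auto simp: inj_on_def\<close>)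
    have meas: "(\<lambda>x. \<lambda>a\<in>{..<m}. x (j * m + a)) \<in> iid_law N P \<rightarrow>\<^sub>M (\<Pi>\<^sub>M a\<in>{..<m}. P)"
      unfolding iid_law_def
      by (rule measurable_restrict, rule measurable_component_singleton) (use block_index[OF j _ nm(1)] in auto)
    show ?thesis
      unfolding Yeq block_law_def
      by (subst re[symmetric], subst distr_distr[OF bmm meas]) (simp add: comp_def)
  qed
  have rv: "(\<lambda>x. Yj j (\<lambda>i\<in>K j. x i)) \<in> iid_law N P \<rightarrow>\<^sub>M Rd d" if "j \<in> {..<n}" for j
    using ind3 that unfolding N.indep_vars_def by blast
  have ne: "{..<n} \<noteq> {}" using nm by (auto simp: lessThan_empty_iff)
  have "distr (iid_law N P) (sample_space d n) (block_means d n m)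
      = distr (iid_law N P) (\<Pi>\<^sub>M j\<in>{..<n}. Rd d) (\<lambda>x. \<lambda>j\<in>{..<n}. Yj j (\<lambda>i\<in>K j. x i))"
    unfolding Yeq sample_space_def block_means_def by simp
  also have "\<dots> = (\<Pi>\<^sub>M j\<in>{..<n}. distr (iid_law N P) (Rd d) (\<lambda>x. Yj j (\<lambda>i\<in>K j. x i)))"
    using N.indep_vars_iff_distr_eq_PiM'[OF ne rv] ind3 by simp
  also have "\<dots> = (\<Pi>\<^sub>M j\<in>{..<n}. block_law d m P)"
    by (rule PiM_cong) (auto simp: law)
  finally show ?thesis .
qed

lemma square_integrable_coords:
  assumes P: "prob_space P" and Ps: "sets P = sets (Rd d)"
    and sq: "\<forall>i<d. integrable P (\<lambda>x. (x i)\<^sup>2)"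
  shows "\<And>i. i < d \<Longrightarrow> integrable P (\<lambda>x. x i)"
    and "\<And>i j. i < d \<Longrightarrow> j < d \<Longrightarrow> integrable P (\<lambda>x. (x i - \<mu> i) * (x j - \<mu> j))"
proof -
  interpret P: prob_space P by fact
  have cm: "(\<lambda>x. x i) \<in> borel_measurable P" if "i < d" for i
  proof -
    have "(\<lambda>x. x i) \<in> borel_measurable (Rd d)"
      unfolding Rd_def using that by (intro measurable_component_singleton) auto
    then show ?thesis using measurable_cong_sets[OF Ps refl, of borel] by blast
  qed
  show c1: "integrable P (\<lambda>x. x i)" if "i < d" for i
    using P.square_integrable_imp_integrable[OF cm[OF that] sq[rule_format, OF that]] .
  have f2: "integrable P (\<lambda>x. (x i - \<mu> i)\<^sup>2)" if "i < d" for i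
    using c1[OF that] sq[rule_format, OF that] by (simp add: power2_diff mult.commute)
  show "integrable P (\<lambda>x. (x i - \<mu> i) * (x j - \<mu> j))" if "i < d" "j < d" for i j
  proof (rule Bochner_Integration.integrable_bound)
    show "integrable P (\<lambda>x. (x i - \<mu> i)\<^sup>2 + (x j - \<mu> j)\<^sup>2)" using f2 that by simp
    show "(\<lambda>x. (x i - \<mu> i) * (x j - \<mu> j)) \<in> borel_measurable P"
      using cm that by (intro borel_measurable_times borel_measurable_diff) auto
    have "\<bar>a * b\<bar> \<le> a\<^sup>2 + b\<^sup>2" for a b :: real
    proof -
      have "2 * (\<bar>a\<bar> * \<bar>b\<bar>) \<le> a\<^sup>2 + b\<^sup>2" using sum_squares_bound[of "\<bar>a\<bar>" "\<bar>b\<bar>"] by simp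
      moreover have "0 \<le> \<bar>a\<bar> * \<bar>b\<bar>" by simp
      ultimately show ?thesis unfolding abs_mult by linarith
    qed
    then show "AE x in P. norm ((x i - \<mu> i) * (x j - \<mu> j)) \<le> norm ((x i - \<mu> i)\<^sup>2 + (x j - \<mu> j)\<^sup>2)" by simp
  qed
qed

lemma block_law_moments:
  assumes P: "prob_space P" and Ps: "sets P = sets (Rd d)"
    and sq: "\<forall>i<d. integrable P (\<lambda>x. (x i)\<^sup>2)" and m: "1 \<le> m"
  defines "\<mu> \<equiv> mean_vec d P" and "Q \<equiv> block_law d m P"
  shows "prob_space Q" "sets Q = sets (Rd d)"
    and "\<And>i. i < d \<Longrightarrow> integrable Q (\<lambda>x. x i)" "\<And>i. i < d \<Longrightarrow> (\<integral>x. x i \<partial>Q) = \<mu> i"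
    and "\<And>i j. i < d \<Longrightarrow> j < d \<Longrightarrow> integrable Q (\<lambda>x. (x i - \<mu> i) * (x j - \<mu> j))"
    and "\<And>i j. i < d \<Longrightarrow> j < d \<Longrightarrow> (\<integral>x. (x i - \<mu> i) * (x j - \<mu> j) \<partial>Q) = cov_mat d P $$ (i, j) / real m"
    and "\<And>u. exp (- 2) / sqrt (real m) * (\<integral>x. \<bar>ip d (vdiff d x \<mu>) u\<bar> \<partial>P)
          \<le> (\<integral>x. \<bar>ip d (vdiff d x \<mu>) u\<bar> \<partial>Q)"
proof -
  interpret P: prob_space P by fact
  let ?P = "\<Pi>\<^sub>M a\<in>{..<m}. P"
  interpret PP: prob_space ?P by (intro prob_space_PiM P)
  have bmm: "block_mean d m \<in> ?P \<rightarrow>\<^sub>M Rd d"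
    using block_mean_measurable[of d m] measurable_cong_sets[OF sets_iid_law[OF Ps, of m] refl] by blast
  show "prob_space Q" unfolding Q_def block_law_def by (rule PP.prob_space_distr[OF bmm])
  show Qs: "sets Q = sets (Rd d)" by (simp add: Q_def block_law_def)
  have cR: "(\<lambda>x. x i) \<in> borel_measurable (Rd d)" if "i < d" for i
    unfolding Rd_def using that by (intro measurable_component_singleton) auto
  note c1 = square_integrable_coords(1)[OF P Ps sq]
  have mu: "\<mu> i = (\<integral>x. x i \<partial>P)" if "i < d" for i using that by (simp add: \<mu>_def mean_vec_def)
  define f where "f = (\<lambda>i (x :: nat \<Rightarrow> real). x i - \<mu> i)"
  have fi: "integrable P (f i)" if "i < d" for i using c1[OF that] by (simp add: f_def)
  have f0: "P.expectation (f i) = 0" if "i < d" for i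
    using c1[OF that] mu[OF that] by (simp add: f_def P.prob_space)
  have ff: "integrable P (\<lambda>x. f i x * f j x)" if "i < d" "j < d" for i j
    unfolding f_def by (rule square_integrable_coords(2)[OF P Ps sq that])
  have bmi: "block_mean d m x i - \<mu> i = (\<Sum>a<m. f i (x a)) / real m" if "i < d" for x i
    using that m by (simp add: block_mean_def f_def sum_subtractf diff_divide_distrib)
  have comp: "integrable ?P (\<lambda>x. x a i)" "(\<integral>x. x a i \<partial>?P) = \<mu> i" if "a < m" "i < d" for a i
    using P.PiM_pair_moment[OF that(1) that(1) c1[OF that(2)], of "\<lambda>_. 1"] c1[OF that(2)]
    by (auto simp: mu[OF that(2)])
  have integ: "integrable Q g \<longleftrightarrow> integrable ?P (\<lambda>x. g (block_mean d m x))"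
    and integr: "(\<integral>x. g x \<partial>Q) = (\<integral>x. g (block_mean d m x) \<partial>?P)"
    if "g \<in> borel_measurable (Rd d)" for g :: "(nat \<Rightarrow> real) \<Rightarrow> real"
    unfolding Q_def block_law_def
    using integrable_distr_eq[OF bmm that] integral_distr[OF bmm that] by auto
  show "integrable Q (\<lambda>x. x i)" if i: "i < d" for i
    unfolding integ[OF cR[OF i]] using i comp(1)[OF _ i]
    by (simp add: block_mean_def) (intro integrable_divide_zero Bochner_Integration.integrable_sum, simp)
  show "(\<integral>x. x i \<partial>Q) = \<mu> i" if i: "i < d" for i
    unfolding integr[OF cR[OF i]] using comp i m
    by (simp add: block_mean_def Bochner_Integration.integral_sum)
  note M2 = P.PiM_sum_product_moment[OF fi fi ff f0]
  have gm: "(\<lambda>x. (x i - \<mu> i) * (x j - \<mu> j)) \<in> borel_measurable (Rd d)" if "i < d" "j < d" for i j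
    using cR that by (intro borel_measurable_times borel_measurable_diff) auto
  show "integrable Q (\<lambda>x. (x i - \<mu> i) * (x j - \<mu> j))" if ij: "i < d" "j < d" for i j
    unfolding integ[OF gm[OF ij]] using M2(1)[OF ij(1) ij(2) ij ij(1), of m] by (simp add: bmi ij)
  show "(\<integral>x. (x i - \<mu> i) * (x j - \<mu> j) \<partial>Q) = cov_mat d P $$ (i, j) / real m" if ij: "i < d" "j < d" for i j
  proof -
    have "(\<integral>x. (x i - \<mu> i) * (x j - \<mu> j) \<partial>Q) = real m * P.expectation (\<lambda>x. f i x * f j x) / (real m * real m)"
      unfolding integr[OF gm[OF ij]] using M2(2)[OF ij(1) ij(2) ij ij(1), of m] by (simp add: bmi ij)
    also have "\<dots> = P.expectation (\<lambda>x. f i x * f j x) / real m" using m by simp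
    finally show ?thesis using ij by (simp add: cov_mat_def f_def \<mu>_def)
  qed
  show "exp (- 2) / sqrt (real m) * (\<integral>x. \<bar>ip d (vdiff d x \<mu>) u\<bar> \<partial>P) \<le> (\<integral>x. \<bar>ip d (vdiff d x \<mu>) u\<bar> \<partial>Q)" for u
  proof -
    define F where "F = (\<lambda>x. \<Sum>i<d. f i x * u i)"
    have F: "ip d (vdiff d x \<mu>) u = F x" for x by (simp add: ip_def vdiff_def F_def f_def)
    have Fi: "integrable P F" unfolding F_def using fi by (intro Bochner_Integration.integrable_sum integrable_mult_left) auto
    have F0: "P.expectation F = 0" unfolding F_def
      using fi f0 by (subst Bochner_Integration.integral_sum) auto
    have Fm: "(\<lambda>x. \<bar>F x\<bar>) \<in> borel_measurable (Rd d)"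
      unfolding F_def f_def using cR by (intro borel_measurable_abs borel_measurable_sum borel_measurable_times borel_measurable_diff) auto
    have "F (block_mean d m x) = (\<Sum>a<m. F (x a)) / real m" for x
    proof -
      have "F (block_mean d m x) = (\<Sum>i<d. (\<Sum>a<m. f i (x a)) / real m * u i)"
        unfolding F_def using bmi by (intro sum.cong refl) (simp add: f_def)
      also have "\<dots> = (\<Sum>i<d. \<Sum>a<m. f i (x a) * u i) / real m"
        by (simp add: sum_divide_distrib sum_distrib_right)
      also have "\<dots> = (\<Sum>a<m. F (x a)) / real m" unfolding F_def by (subst sum.swap) simp
      finally show ?thesis .
    qed
    then have "(\<integral>x. \<bar>F x\<bar> \<partial>Q) = (\<integral>x. \<bar>\<Sum>a<m. F (x a)\<bar> \<partial>?P) / real m"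
      unfolding integr[OF Fm] by simp
    also have "\<dots> \<ge> exp (- 2) * sqrt (real m) * (\<integral>x. \<bar>F x\<bar> \<partial>P) / real m"
      using P.PiM_abs_sum_ge(2)[OF Fi F0 m] by (intro divide_right_mono) auto
    also have "exp (- 2) * sqrt (real m) * (\<integral>x. \<bar>F x\<bar> \<partial>P) / real m = exp (- 2) / sqrt (real m) * (\<integral>x. \<bar>F x\<bar> \<partial>P)"
      using m by (simp add: field_simps)
    finally show ?thesis by (simp add: F)
  qed
qed

section \<open>Error bounds for the two estimators\<close>

text \<open>
  The quadratic form of the covariance matrix, that is, the variance of the marginal in direction \<open>u\<close>.
\<close>

definition cov_form :: "nat \<Rightarrow> (nat \<Rightarrow> real) measure \<Rightarrow> (nat \<Rightarrow> real) \<Rightarrow> real" where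
  "cov_form d P u = (\<Sum>i<d. \<Sum>j<d. cov_mat d P $$ (i, j) * u i * u j)"

text \<open>
  With probability at least \<open>p\<close>, the error of \<open>est\<close> in each direction is at most \<open>a\<close> times the standard
  deviation of the marginal plus \<open>b\<close>, up to an arbitrarily small additional error \<open>\<epsilon>\<close>. The latter makes
  the scale \<open>r\<close> in \<open>block_estimator\<close> positive even if the sum of the small eigenvalues is empty.
\<close>

definition estimates_mean ::
    "nat \<Rightarrow> nat \<Rightarrow> (nat \<Rightarrow> real) measure \<Rightarrow> ((nat \<Rightarrow> nat \<Rightarrow> real) \<Rightarrow> nat \<Rightarrow> real) \<Rightarrow> real \<Rightarrow> real \<Rightarrow> real \<Rightarrow> bool" where
  "estimates_mean d N P est p a b \<longleftrightarrow> (\<forall>\<epsilon>>0. \<exists>A\<in>sets (iid_law N P). p \<le> measure (iid_law N P) A \<and>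
    (\<forall>x\<in>A. \<forall>u\<in>rat_dirs d.
      ip d (est x) u - ip d (mean_vec d P) u \<le> a * sqrt (cov_form d P u) + (b + \<epsilon>) * nrm d u))"

lemma estimates_meanI:
  assumes "\<And>\<epsilon>. 0 < \<epsilon> \<Longrightarrow> \<exists>A\<in>sets (iid_law N P). p \<le> measure (iid_law N P) A \<and>
    (\<forall>x\<in>A. \<forall>u\<in>rat_dirs d.
      ip d (est x) u - ip d (mean_vec d P) u \<le> a * sqrt (cov_form d P u) + (b + \<epsilon>) * nrm d u)"
  shows "estimates_mean d N P est p a b"
  using assms by (simp add: estimates_mean_def)

lemma estimates_mean_mono:
  assumes est: "estimates_mean d N P est p a b" and le: "p' \<le> p" "a \<le> a'" "b \<le> b'"
    and cf0: "\<And>u. 0 \<le> cov_form d P u"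
  shows "estimates_mean d N P est p' a' b'"
proof (rule estimates_meanI)
  fix \<epsilon> :: real assume e: "0 < \<epsilon>"
  obtain A where A: "A \<in> sets (iid_law N P)" "p \<le> measure (iid_law N P) A"
    and Ab: "\<And>x u. x \<in> A \<Longrightarrow> u \<in> rat_dirs d \<Longrightarrow> ip d (est x) u - ip d (mean_vec d P) u
      \<le> a * sqrt (cov_form d P u) + (b + \<epsilon>) * nrm d u"
    using est[unfolded estimates_mean_def, rule_format, OF e] by blast
  have "ip d (est x) u - ip d (mean_vec d P) u \<le> a' * sqrt (cov_form d P u) + (b' + \<epsilon>) * nrm d u"
    if "x \<in> A" "u \<in> rat_dirs d" for x u
    by (rule order_trans[OF Ab[OF that]])
      (intro add_mono mult_right_mono le order_refl nrm_nonneg real_sqrt_ge_zero cf0)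
  with A le(1) show "\<exists>A\<in>sets (iid_law N P). p' \<le> measure (iid_law N P) A \<and>
    (\<forall>x\<in>A. \<forall>u\<in>rat_dirs d.
      ip d (est x) u - ip d (mean_vec d P) u \<le> a' * sqrt (cov_form d P u) + (b' + \<epsilon>) * nrm d u)"
    by (intro bexI[of _ A]) auto
qed

text \<open>
  The additional error disappears since the corresponding events decrease to the desired one. The
  event for all unit vectors is measurable because it agrees with the one for rational directions.
\<close>

lemma estimates_mean_limit:
  assumes P: "prob_space P" and Ps: "sets P = sets (Rd d)"
    and est: "est \<in> sample_space d N \<rightarrow>\<^sub>M Rd d" and ev: "estimates_mean d N P est p a b"
  shows "p \<le> \<P>(x in iid_law N P. \<forall>u\<in>usphere d.
    ip d (vdiff d (est x) (mean_vec d P)) u \<le> a * sqrt (cov_form d P u) + b)"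
proof -
  interpret N: prob_space "iid_law N P" unfolding iid_law_def by (intro prob_space_PiM P)
  let ?M = "iid_law N P" and ?U = "rat_dirs d" and ?\<mu> = "mean_vec d P"
  have Ms: "sets ?M = sets (sample_space d N)" unfolding iid_law_def by (rule sets_iid_law[OF Ps])
  have estm: "est \<in> ?M \<rightarrow>\<^sub>M Rd d" using est measurable_cong_sets[OF Ms refl] by blast
  have cm: "(\<lambda>x. est x i) \<in> borel_measurable ?M" if "i < d" for i
    by (rule measurable_compose[OF estm]) (use that in \<open>auto simp: Rd_def intro!: measurable_component_singleton\<close>)
  define W where "W = (\<lambda>\<epsilon>. {x\<in>space ?M. \<forall>u\<in>?U. ip d (est x) u - ip d ?\<mu> u \<le> a * sqrt (cov_form d P u) + (b + \<epsilon>) * nrm d u})"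
  have Wm: "W \<epsilon> \<in> sets ?M" for \<epsilon>
  proof -
    have [measurable]: "(\<lambda>x. ip d (est x) u) \<in> borel_measurable ?M" for u by (rule ip_measurable[OF cm])
    have "countable ?U" by (rule countable_rat_dirs)
    then show ?thesis unfolding W_def by measurable
  qed
  have Wp: "p \<le> measure ?M (W \<epsilon>)" if e: "0 < \<epsilon>" for \<epsilon>
  proof -
    obtain A where A: "A \<in> sets ?M" "p \<le> measure ?M A"
      "\<forall>x\<in>A. \<forall>u\<in>?U. ip d (est x) u - ip d ?\<mu> u \<le> a * sqrt (cov_form d P u) + (b + \<epsilon>) * nrm d u"
      using ev[unfolded estimates_mean_def, rule_format, OF e] by blast
    have "A \<subseteq> W \<epsilon>" using A sets.sets_into_space[OF A(1)] by (auto simp: W_def)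
    then have "measure ?M A \<le> measure ?M (W \<epsilon>)" using Wm by (intro N.finite_measure_mono)
    with A show ?thesis by linarith
  qed
  let ?e = "\<lambda>k. 1 / real (k + 1)"
  have mono: "W x \<subseteq> W y" if "x \<le> y" for x y
  proof
    fix z assume z: "z \<in> W x"
    have "(b + x) * nrm d u \<le> (b + y) * nrm d u" for u using that by (intro mult_right_mono) auto
    with z show "z \<in> W y" unfolding W_def by (force intro: order_trans)
  qed
  have dec: "decseq (\<lambda>k. W (?e k))"
    unfolding decseq_def by (intro allI impI mono divide_left_mono) auto
  have Int: "(\<Inter>k. W (?e k)) = W 0"
  proof
    show "W 0 \<subseteq> (\<Inter>k. W (?e k))" by (intro INT_greatest mono) simp
    show "(\<Inter>k. W (?e k)) \<subseteq> W 0"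
    proof
      fix x assume x: "x \<in> (\<Inter>k. W (?e k))"
      have "ip d (est x) u - ip d ?\<mu> u \<le> a * sqrt (cov_form d P u) + (b + 0) * nrm d u" if u: "u \<in> ?U" for u
      proof (rule LIMSEQ_le_const)
        show "(\<lambda>k. a * sqrt (cov_form d P u) + (b + ?e k) * nrm d u)
            \<longlonglongrightarrow> a * sqrt (cov_form d P u) + (b + 0) * nrm d u"
          by (intro tendsto_intros lim_inverse_Suc)
        show "\<exists>N. \<forall>k\<ge>N. ip d (est x) u - ip d ?\<mu> u \<le> a * sqrt (cov_form d P u) + (b + ?e k) * nrm d u"
          using x u by (auto simp: W_def)
      qed
      moreover have "x \<in> space ?M" using x by (auto simp: W_def)
      ultimately show "x \<in> W 0" by (simp add: W_def)
    qed
  qed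
  have "(\<lambda>k. measure ?M (W (?e k))) \<longlonglongrightarrow> measure ?M (\<Inter>k. W (?e k))"
    by (rule N.finite_Lim_measure_decseq) (use Wm dec in auto)
  then have "p \<le> measure ?M (W 0)"
    unfolding Int by (rule LIMSEQ_le_const) (use Wp in auto)
  also have "W 0 = {x\<in>space ?M. \<forall>u\<in>usphere d. ip d (vdiff d (est x) ?\<mu>) u \<le> a * sqrt (cov_form d P u) + b}"
    unfolding cov_form_def usphere_iff_rat_dirs by (simp add: W_def cov_form_def ip_vdiff)
  finally show ?thesis .
qed

lemma projection_moments:
  assumes P: "prob_space P" and Ps: "sets P = sets (Rd d)"
    and sq: "\<forall>i<d. integrable P (\<lambda>x. (x i)\<^sup>2)"
  shows "integrable P (\<lambda>x. ip d (vdiff d x (mean_vec d P)) u)"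
    and "integrable P (\<lambda>x. (ip d (vdiff d x (mean_vec d P)) u)\<^sup>2)"
    and "(\<integral>x. (ip d (vdiff d x (mean_vec d P)) u)\<^sup>2 \<partial>P) = cov_form d P u"
    and "dir_var d P u = cov_form d P u"
proof -
  interpret P: prob_space P by fact
  let ?\<mu> = "mean_vec d P"
  note C = square_integrable_coords[OF P Ps sq]
  have sum: "ip d (vdiff d x ?\<mu>) u = (\<Sum>i<d. (x i - ?\<mu> i) * u i)" for x by (simp add: ip_def vdiff_def)
  have sq: "(ip d (vdiff d x ?\<mu>) u)\<^sup>2 = (\<Sum>i<d. \<Sum>j<d. (x i - ?\<mu> i) * (x j - ?\<mu> j) * (u i * u j))" for x
    unfolding sum power2_eq_square sum_product by (intro sum.cong refl) (simp add: mult_ac)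
  show "integrable P (\<lambda>x. ip d (vdiff d x ?\<mu>) u)"
    unfolding sum using C(1) by (intro Bochner_Integration.integrable_sum integrable_mult_left) auto
  show "integrable P (\<lambda>x. (ip d (vdiff d x ?\<mu>) u)\<^sup>2)"
    unfolding sq using C(2) by (intro integral_double_sum integrable_mult_left) auto
  show var: "(\<integral>x. (ip d (vdiff d x ?\<mu>) u)\<^sup>2 \<partial>P) = cov_form d P u"
    unfolding sq cov_form_def using C(2)
    by (subst integral_double_sum) (auto intro!: sum.cong simp: cov_mat_def)
  have "(\<integral>x. ip d x u \<partial>P) = ip d ?\<mu> u"
    unfolding ip_def using C(1) by (subst Bochner_Integration.integral_sum) (auto simp: mean_vec_def)
  then show "dir_var d P u = cov_form d P u"
    unfolding dir_var_def var[symmetric] ip_vdiff by simp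
qed

lemma cov_form_nonneg:
  assumes "prob_space P" "sets P = sets (Rd d)" "\<forall>i<d. integrable P (\<lambda>x. (x i)\<^sup>2)"
  shows "0 \<le> cov_form d P u"
  unfolding projection_moments(3)[OF assms, symmetric] by simp

lemma first_moment_all_directions:
  assumes q: "2 < q" and k: "0 < \<kappa>" and ac: "ac_square_integrable_law d P"
    and me: "moment_equivalence d q \<kappa> P" and u: "u \<in> rat_dirs d"
  shows "sqrt (cov_form d P u) / (2 * (2 * \<kappa> powr q) powr (1 / (q - 2)))
      \<le> (\<integral>x. \<bar>ip d (vdiff d x (mean_vec d P)) u\<bar> \<partial>P)"
proof -
  have P: "prob_space P" and Ps: "sets P = sets (Rd d)" and sq: "\<forall>i<d. integrable P (\<lambda>x. (x i)\<^sup>2)"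
    using ac by (auto simp: ac_square_integrable_law_def)
  interpret P: prob_space P by fact
  note M = projection_moments[OF P Ps sq]
  let ?Y = "\<lambda>u x. ip d (vdiff d x (mean_vec d P)) u"
  have n: "0 < nrm d u" using u by (simp add: rat_dirs_def)
  obtain w where w: "w \<in> usphere d" and wi: "\<And>i. i < d \<Longrightarrow> w i = u i / nrm d u"
    using rat_dirs_normalized[OF u] by blast
  have Yw: "?Y w x = ?Y u x / nrm d u" for x by (simp add: ip_def wi sum_divide_distrib)
  have "(\<integral>x. (?Y w x)\<^sup>2 \<partial>P) = cov_form d P u / (nrm d u)\<^sup>2"
    unfolding Yw power_divide by (simp add: M)
  then have s: "sqrt (\<integral>x. (?Y w x)\<^sup>2 \<partial>P) = sqrt (cov_form d P u) / nrm d u"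
    using n by (simp add: real_sqrt_divide)
  have "sqrt (\<integral>x. (?Y w x)\<^sup>2 \<partial>P) / (2 * (2 * \<kappa> powr q) powr (1 / (q - 2))) \<le> (\<integral>x. \<bar>?Y w x\<bar> \<partial>P)"
    by (rule P.first_moment_ge[OF q k M(1) M(2)]) (use me w in \<open>auto simp: moment_equivalence_def\<close>)
  also have "(\<integral>x. \<bar>?Y w x\<bar> \<partial>P) = (\<integral>x. \<bar>?Y u x\<bar> \<partial>P) / nrm d u"
    unfolding Yw using n by simp
  finally have "sqrt (cov_form d P u) / (2 * (2 * \<kappa> powr q) powr (1 / (q - 2))) / nrm d u
      \<le> (\<integral>x. \<bar>?Y u x\<bar> \<partial>P) / nrm d u"
    unfolding s by (simp add: mult.commute)
  then show ?thesis using n unfolding divide_le_cancel by blast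
qed

text \<open>
  With probability at least one half, the empirical mean satisfies the bound given by the full trace.
\<close>

lemma empirical_mean_event:
  assumes P: "prob_space P" and Ps: "sets P = sets (Rd d)"
    and sq: "\<forall>i<d. integrable P (\<lambda>x. (x i)\<^sup>2)" and N: "1 \<le> N"
    and ev: "ordered_eigenvalues d (cov_mat d P) lam"
  shows "estimates_mean d N P (block_mean d N) (1 / 2) 0 (sqrt (2 * (\<Sum>i\<in>{1..d}. lam i) / real N))"
proof (rule estimates_meanI)
  fix \<epsilon> :: real assume e: "0 < \<epsilon>"
  let ?\<mu> = "mean_vec d P" and ?Q = "block_law d N P" and ?S = "\<Sum>i\<in>{1..d}. lam i"
  note B = block_law_moments[OF P Ps sq N]
  interpret Q: prob_space ?Q by (rule B(1))
  have Bi: "integrable ?Q (\<lambda>x. (x i - ?\<mu> i) * (x j - ?\<mu> j))"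
    "(\<integral>x. (x i - ?\<mu> i) * (x j - ?\<mu> j) \<partial>?Q) = cov_mat d P $$ (i, j) / real N" if "i < d" "j < d" for i j
    using B(5,6) that by auto
  define D where "D = (\<lambda>x. (nrm d (vdiff d x ?\<mu>))\<^sup>2)"
  have D_sum: "D x = (\<Sum>i<d. (x i - ?\<mu> i) * (x i - ?\<mu> i))" for x
    unfolding D_def nrm_sq by (simp add: ip_def vdiff_def)
  have Di: "integrable ?Q D" unfolding D_sum using Bi by (intro Bochner_Integration.integrable_sum) auto
  have "(\<integral>x. D x \<partial>?Q) = (\<Sum>i<d. cov_mat d P $$ (i, i) / real N)"
    unfolding D_sum using Bi by (subst Bochner_Integration.integral_sum) auto
  also have "\<dots> = mat_tr d (cov_mat d P) / real N" by (simp add: mat_tr_def sum_divide_distrib)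
  also have "mat_tr d (cov_mat d P) = ?S" by (rule mat_tr_eigenvalues[OF _ ev]) (simp add: cov_mat_def)
  finally have ED: "(\<integral>x. D x \<partial>?Q) = ?S / real N" .
  have S0: "0 \<le> ?S" using ev by (intro sum_nonneg) (auto simp: ordered_eigenvalues_def)
  define b where "b = sqrt (2 * ?S / real N) + \<epsilon>"
  have b: "0 < b" using e S0 by (simp add: b_def add_nonneg_pos)
  have b2: "2 * (?S / real N) \<le> b\<^sup>2"
  proof -
    have "(sqrt (2 * ?S / real N))\<^sup>2 \<le> b\<^sup>2" using e S0 by (intro power_mono) (auto simp: b_def)
    then show ?thesis using S0 by simp
  qed
  define A where "A = {x\<in>space ?Q. D x < b\<^sup>2}"
  have Dm: "D \<in> borel_measurable ?Q" using Di by auto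
  have Am: "A \<in> sets ?Q" unfolding A_def using Dm by measurable
  have "\<P>(x in ?Q. b\<^sup>2 \<le> D x) \<le> (\<integral>x. D x \<partial>?Q) / b\<^sup>2"
    using b Di by (intro integral_Markov_inequality_measure[where A = "{}"]) (auto simp: D_def)
  also have "\<dots> \<le> 1 / 2"
  proof -
    have "(\<integral>x. D x \<partial>?Q) \<le> 1 / 2 * b\<^sup>2" using b2 unfolding ED by (simp add: mult.commute)
    moreover have "0 < b\<^sup>2" using b by simp
    ultimately show ?thesis by (simp only: pos_divide_le_eq)
  qed
  finally have "\<P>(x in ?Q. b\<^sup>2 \<le> D x) \<le> 1 / 2" .
  moreover have "measure ?Q A = 1 - \<P>(x in ?Q. b\<^sup>2 \<le> D x)"
  proof -
    have "A = space ?Q - {x\<in>space ?Q. b\<^sup>2 \<le> D x}" by (auto simp: A_def)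
    then show ?thesis using Dm by (simp only:) (rule Q.prob_compl, measurable)
  qed
  ultimately have Ap: "1 / 2 \<le> measure ?Q A" by simp
  have bmm: "block_mean d N \<in> iid_law N P \<rightarrow>\<^sub>M Rd d"
    using block_mean_measurable[of d N] measurable_cong_sets[OF sets_iid_law[OF Ps, of N] refl]
    unfolding iid_law_def by blast
  have As: "A \<in> sets (Rd d)" using Am by (simp add: block_law_def)
  show "\<exists>A\<in>sets (iid_law N P). 1 / 2 \<le> measure (iid_law N P) A \<and>
      (\<forall>x\<in>A. \<forall>u\<in>rat_dirs d. ip d (block_mean d N x) u - ip d ?\<mu> u
         \<le> 0 * sqrt (cov_form d P u) + (sqrt (2 * ?S / real N) + \<epsilon>) * nrm d u)"
  proof (intro bexI[of _ "block_mean d N -` A \<inter> space (iid_law N P)"] conjI ballI)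
    show "block_mean d N -` A \<inter> space (iid_law N P) \<in> sets (iid_law N P)"
      by (rule measurable_sets[OF bmm As])
    show "1 / 2 \<le> measure (iid_law N P) (block_mean d N -` A \<inter> space (iid_law N P))"
      using Ap measure_distr[OF bmm As] by (simp add: block_law_def iid_law_def)
    fix x u assume "x \<in> block_mean d N -` A \<inter> space (iid_law N P)" and u: "u \<in> rat_dirs d"
    then have "D (block_mean d N x) < b\<^sup>2" by (simp add: A_def)
    then have "nrm d (vdiff d (block_mean d N x) ?\<mu>) \<le> b"
      unfolding D_def using b by (auto intro: power2_le_imp_le[OF less_imp_le])
    then have "nrm d (vdiff d (block_mean d N x) ?\<mu>) * nrm d u \<le> b * nrm d u" by (rule mult_right_mono) simp
    then show "ip d (block_mean d N x) u - ip d ?\<mu> u \<le> 0 * sqrt (cov_form d P u) + (sqrt (2 * ?S / real N) + \<epsilon>) * nrm d u"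
      using ip_le[of d "vdiff d (block_mean d N x) ?\<mu>" u] by (simp add: ip_vdiff b_def)
  qed
qed

text \<open>
  The index set \<open>I\<close> consists of the small eigenvalues. Its complement may be as large as a small
  multiple of the number \<open>n\<close> of blocks; each of its elements contributes at most one to the trace in
  the hypothesis of \<open>uniform_counts\<close>, and \<open>r\<close> is chosen such that the elements of \<open>I\<close> contribute as
  much in total.
\<close>

lemma block_estimator:
  fixes c :: real and d n m N :: nat
  assumes c: "0 < c" "c \<le> 1" and d: "1 \<le> d" and n: "1 \<le> n" and m: "1 \<le> m" and nm: "n * m \<le> N"
  obtains est where "est \<in> sample_space d N \<rightarrow>\<^sub>M Rd d"
    "\<And>P lam I. prob_space P \<Longrightarrow> sets P = sets (Rd d) \<Longrightarrow> \<forall>i<d. integrable P (\<lambda>x. (x i)\<^sup>2) \<Longrightarrow>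
       ordered_eigenvalues d (cov_mat d P) lam \<Longrightarrow>
       (\<And>u. u \<in> rat_dirs d \<Longrightarrow> exp 2 * c * sqrt (cov_form d P u)
          \<le> (\<integral>x. \<bar>ip d (vdiff d x (mean_vec d P)) u\<bar> \<partial>P)) \<Longrightarrow>
       I \<subseteq> {1..d} \<Longrightarrow> real (card ({1..d} - I)) \<le> (c ^ 3 / 4096)\<^sup>2 * real n \<Longrightarrow>
       estimates_mean d N P est (1 - 2 * exp (- real n * (c\<^sup>2 / 256)\<^sup>2 / 2)) (32 / c * sqrt (1 / real m))
         (96 / c * sqrt ((\<Sum>i\<in>I. lam i) / (real m * real n * (c ^ 3 / 4096)\<^sup>2)))"
proof -
  define p where "p = c\<^sup>2 / 16"
  define \<theta> where "\<theta> = (c ^ 3 / 4096)\<^sup>2"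
  have p: "0 < p" "p \<le> 1" using c power_le_one[of c 2] by (auto simp: p_def)
  have th: "0 < \<theta>" using c by (simp add: \<theta>_def)
  define a where "a = nat \<lceil>p * real n / 2\<rceil>"
  have a: "1 \<le> a" "a \<le> n"
  proof -
    have "0 < p * real n / 2" using p n by simp
    then have "0 < \<lceil>p * real n / 2\<rceil>" by (simp only: zero_less_ceiling)
    then show "1 \<le> a" unfolding a_def by linarith
    have "p * real n \<le> 1 * real n" using p by (intro mult_right_mono) auto
    then show "a \<le> n" unfolding a_def by (simp add: nat_le_iff ceiling_le_iff)
  qed
  obtain est0 where est0: "est0 \<in> sample_space d n \<rightarrow>\<^sub>M Rd d"
    and opt: "\<And>z w s. z \<in> space (sample_space d n) \<Longrightarrow>
       (\<And>u. u \<in> rat_dirs d \<Longrightarrow> a \<le> card {j. j < n \<and> ip d w u - s * nrm d u \<le> ip d (z j) u}) \<Longrightarrow>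
       (\<forall>u\<in>rat_dirs d. a \<le> card {j. j < n \<and> ip d (est0 z) u - s * nrm d u \<le> ip d (z j) u})"
    using slack_depth_estimator[OF d a] by blast
  show ?thesis
  proof (rule that[of "\<lambda>x. est0 (block_means d n m x)"])
    show "(\<lambda>x. est0 (block_means d n m x)) \<in> sample_space d N \<rightarrow>\<^sub>M Rd d"
      by (rule measurable_compose[OF block_means_measurable[OF nm] est0])
  next
    fix P lam I
    assume P: "prob_space P" and Ps: "sets P = sets (Rd d)"
      and sq: "\<forall>i<d. integrable P (\<lambda>x. (x i)\<^sup>2)"
      and ev: "ordered_eigenvalues d (cov_mat d P) lam"
      and abs1: "\<And>u. u \<in> rat_dirs d \<Longrightarrow> exp 2 * c * sqrt (cov_form d P u)
          \<le> (\<integral>x. \<bar>ip d (vdiff d x (mean_vec d P)) u\<bar> \<partial>P)"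
      and I: "I \<subseteq> {1..d}" and top: "real (card ({1..d} - I)) \<le> (c ^ 3 / 4096)\<^sup>2 * real n"
    show "estimates_mean d N P (\<lambda>x. est0 (block_means d n m x)) (1 - 2 * exp (- real n * (c\<^sup>2 / 256)\<^sup>2 / 2))
      (32 / c * sqrt (1 / real m)) (96 / c * sqrt ((\<Sum>i\<in>I. lam i) / (real m * real n * (c ^ 3 / 4096)\<^sup>2)))"
    proof (rule estimates_meanI)
      fix \<epsilon> :: real assume e: "0 < \<epsilon>"
      let ?\<mu> = "mean_vec d P" and ?Q = "block_law d m P"
      note B = block_law_moments[OF P Ps sq m]
      have lam0: "0 \<le> lam i" if "i \<in> {1..d}" for i using ev that by (auto simp: ordered_eigenvalues_def)
      define L where "L = (\<Sum>i\<in>I. lam i)"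
      have L0: "0 \<le> L" unfolding L_def using I lam0 by (intro sum_nonneg) auto
      define r0 where "r0 = sqrt (L / (real m * real n * \<theta>))"
      define r where "r = r0 + \<epsilon> * c / 96"
      have r0: "0 \<le> r0" using L0 th by (simp add: r0_def)
      have r: "0 < r" using r0 e c by (simp add: r_def add_nonneg_pos)
      have r2: "L / (real m * real n * \<theta>) \<le> r\<^sup>2"
      proof -
        have "r0\<^sup>2 \<le> r\<^sup>2" using r0 e c by (intro power_mono) (auto simp: r_def)
        then show ?thesis using L0 th by (simp add: r0_def)
      qed
      have m0: "0 < real m" and n0: "0 < real n" using m n by auto
      have tr: "(\<Sum>i\<in>{1..d}. lam i / (lam i + real m * r\<^sup>2)) \<le> 2 * (c ^ 3 / 4096)\<^sup>2 * real n"
      proof -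
        have mr: "0 < real m * r\<^sup>2" using m0 r by simp
        have "(\<Sum>i\<in>{1..d}. lam i / (lam i + real m * r\<^sup>2))
          = (\<Sum>i\<in>{1..d} - I. lam i / (lam i + real m * r\<^sup>2)) + (\<Sum>i\<in>I. lam i / (lam i + real m * r\<^sup>2))"
          using I by (intro sum.subset_diff) auto
        also have "(\<Sum>i\<in>{1..d} - I. lam i / (lam i + real m * r\<^sup>2)) \<le> (\<Sum>i\<in>{1..d} - I. 1)"
          using lam0 mr by (intro sum_mono) (simp add: divide_le_eq_1 add_nonneg_pos)
        also have "(\<Sum>i\<in>{1..d} - I. 1) = real (card ({1..d} - I))" by simp
        also have "\<dots> \<le> \<theta> * real n" using top by (simp add: \<theta>_def)
        also have "(\<Sum>i\<in>I. lam i / (lam i + real m * r\<^sup>2)) \<le> (\<Sum>i\<in>I. lam i / (real m * r\<^sup>2))"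
        proof (rule sum_mono)
          fix i assume "i \<in> I"
          then have "0 \<le> lam i" using I lam0 by auto
          with mr show "lam i / (lam i + real m * r\<^sup>2) \<le> lam i / (real m * r\<^sup>2)"
            by (intro divide_left_mono) auto
        qed
        also have "\<dots> = L / (real m * r\<^sup>2)" by (simp add: L_def sum_divide_distrib)
        also have "\<dots> \<le> \<theta> * real n"
        proof -
          have "L \<le> r\<^sup>2 * (real m * real n * \<theta>)" using r2 m0 n0 th by (simp add: pos_divide_le_eq)
          then show ?thesis using mr by (simp add: pos_divide_le_eq mult_ac)
        qed
        finally show ?thesis by (simp add: \<theta>_def mult_ac)
      qed
      have abs2: "c * sqrt ((\<Sum>i<d. \<Sum>j<d. cov_mat d P $$ (i, j) * u i * u j) / real m)
          \<le> (\<integral>x. \<bar>ip d (vdiff d x ?\<mu>) u\<bar> \<partial>?Q)" if u: "u \<in> rat_dirs d" for u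
      proof -
        have "c * sqrt (cov_form d P u / real m) = exp (- 2) / sqrt (real m) * (exp 2 * c * sqrt (cov_form d P u))"
          by (simp add: real_sqrt_divide exp_minus)
        also have "\<dots> \<le> exp (- 2) / sqrt (real m) * (\<integral>x. \<bar>ip d (vdiff d x ?\<mu>) u\<bar> \<partial>P)"
          using abs1[OF u] by (intro mult_left_mono) auto
        also have "\<dots> \<le> (\<integral>x. \<bar>ip d (vdiff d x ?\<mu>) u\<bar> \<partial>?Q)" using B(7) by auto
        finally show ?thesis by (simp add: cov_form_def)
      qed
      have cS: "cov_mat d P \<in> carrier_mat d d" by (simp add: cov_mat_def)
      define \<sigma> where "\<sigma> = (\<lambda>u. sqrt (cov_form d P u / real m))"
      have cf0: "0 \<le> cov_form d P u" for u by (rule cov_form_nonneg[OF P Ps sq])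
      have "\<exists>A. A \<in> sets (\<Pi>\<^sub>M j\<in>{..<n}. ?Q) \<and>
        measure (\<Pi>\<^sub>M j\<in>{..<n}. ?Q) A \<ge> 1 - 2 * exp (- real n * (c\<^sup>2 / 256)\<^sup>2 / 2) \<and>
        (\<forall>x\<in>A. \<forall>u\<in>rat_dirs d.
          real (card {j. j < n \<and> 32 / c * sqrt ((\<sigma> u)\<^sup>2 + r\<^sup>2 * (nrm d u)\<^sup>2) < ip d (x j) u - ip d ?\<mu> u})
            < p * real n / 4 \<and>
          (r * nrm d u \<le> \<sigma> u \<longrightarrow>
            p * real n / 2 \<le> real (card {j. j < n \<and> 0 < ip d (x j) u - ip d ?\<mu> u})))"
      proof (rule uniform_counts[where Q = ?Q and d = d and \<mu> = ?\<mu> and S = "cov_mat d P" and m = "real m"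
            and c = c and r = r and lam = lam and n = n])
        fix A
        assume "A \<in> sets (\<Pi>\<^sub>M j\<in>{..<n}. ?Q)"
          and "1 - 2 * exp (- real n * (c\<^sup>2 / 256)\<^sup>2 / 2) \<le> measure (\<Pi>\<^sub>M j\<in>{..<n}. ?Q) A"
          and "\<And>x u. x \<in> A \<Longrightarrow> u \<in> rat_dirs d \<Longrightarrow>
            real (card {j. j < n \<and> 32 / c * sqrt ((sqrt ((\<Sum>i<d. \<Sum>j<d. cov_mat d P $$ (i, j) * u i * u j) / real m))\<^sup>2
              + r\<^sup>2 * (nrm d u)\<^sup>2) < ip d (x j) u - ip d ?\<mu> u}) < c\<^sup>2 / 16 * real n / 4"
          and "\<And>x u. x \<in> A \<Longrightarrow> u \<in> rat_dirs d \<Longrightarrow>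
            r * nrm d u \<le> sqrt ((\<Sum>i<d. \<Sum>j<d. cov_mat d P $$ (i, j) * u i * u j) / real m) \<Longrightarrow>
            c\<^sup>2 / 16 * real n / 2 \<le> real (card {j. j < n \<and> 0 < ip d (x j) u - ip d ?\<mu> u})"
        then show ?thesis unfolding \<sigma>_def p_def cov_form_def by blast
      qed (rule B(1) | rule B(2) | erule B(3) | erule B(4) | erule (1) B(5) | erule (1) B(6) | erule abs2
          | rule cS ev c r m0 n d tr)+
      then obtain A where A: "A \<in> sets (\<Pi>\<^sub>M j\<in>{..<n}. ?Q)"
        and Ap: "measure (\<Pi>\<^sub>M j\<in>{..<n}. ?Q) A \<ge> 1 - 2 * exp (- real n * (c\<^sup>2 / 256)\<^sup>2 / 2)"
        and few: "\<And>x u. x \<in> A \<Longrightarrow> u \<in> rat_dirs d \<Longrightarrow>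
          real (card {j. j < n \<and> 32 / c * sqrt ((\<sigma> u)\<^sup>2 + r\<^sup>2 * (nrm d u)\<^sup>2) < ip d (x j) u - ip d ?\<mu> u})
            < p * real n / 4"
        and many: "\<And>x u. x \<in> A \<Longrightarrow> u \<in> rat_dirs d \<Longrightarrow> r * nrm d u \<le> \<sigma> u \<Longrightarrow>
          p * real n / 2 \<le> real (card {j. j < n \<and> 0 < ip d (x j) u - ip d ?\<mu> u})"
        by blast
      let ?M = "iid_law N P"
      have Qs: "sets (\<Pi>\<^sub>M j\<in>{..<n}. ?Q) = sets (sample_space d n)"
        by (rule sets_iid_law) (simp add: block_law_def)
      have As: "A \<in> sets (sample_space d n)" using A Qs by simp
      have bm: "block_means d n m \<in> ?M \<rightarrow>\<^sub>M sample_space d n"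
        using block_means_measurable[OF nm, of d] measurable_cong_sets[OF sets_iid_law[OF Ps, of N] refl]
        unfolding iid_law_def by blast
      show "\<exists>A\<in>sets ?M. 1 - 2 * exp (- real n * (c\<^sup>2 / 256)\<^sup>2 / 2) \<le> measure ?M A \<and>
           (\<forall>x\<in>A. \<forall>u\<in>rat_dirs d. ip d (est0 (block_means d n m x)) u - ip d ?\<mu> u
              \<le> 32 / c * sqrt (1 / real m) * sqrt (cov_form d P u)
                + (96 / c * sqrt ((\<Sum>i\<in>I. lam i) / (real m * real n * (c ^ 3 / 4096)\<^sup>2)) + \<epsilon>) * nrm d u)"
      proof (intro bexI[of _ "block_means d n m -` A \<inter> space ?M"] conjI ballI)
        show "block_means d n m -` A \<inter> space ?M \<in> sets ?M" by (rule measurable_sets[OF bm As])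
        show "1 - 2 * exp (- real n * (c\<^sup>2 / 256)\<^sup>2 / 2) \<le> measure ?M (block_means d n m -` A \<inter> space ?M)"
          using Ap measure_distr[OF bm As] by (simp add: distr_block_means[OF P Ps nm n m])
        fix x u assume "x \<in> block_means d n m -` A \<inter> space ?M" and u: "u \<in> rat_dirs d"
        then have z: "block_means d n m x \<in> A" by simp
        have zs: "block_means d n m x \<in> space (sample_space d n)" using z sets.sets_into_space[OF As] by auto
        have "ip d (est0 (block_means d n m x)) u - ip d ?\<mu> u \<le> 32 / c * \<sigma> u + 3 * (32 / c) * r * nrm d u"
        proof (rule slack_depth_deterministic[OF p _ _ _ _ few[OF z] many[OF z] _ u])
          show "\<sigma> (\<lambda>i\<in>{..<d}. - u i) = \<sigma> u" for u by (simp add: \<sigma>_def cov_form_def)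
          fix w s
          assume "\<And>u. u \<in> rat_dirs d \<Longrightarrow> nat \<lceil>p * real n / 2\<rceil>
            \<le> card {j. j < n \<and> ip d w u - s * nrm d u \<le> ip d (block_means d n m x j) u}"
          then show "\<forall>u\<in>rat_dirs d. nat \<lceil>p * real n / 2\<rceil>
            \<le> card {j. j < n \<and> ip d (est0 (block_means d n m x)) u - s * nrm d u \<le> ip d (block_means d n m x j) u}"
            using opt[OF zs, of w s] unfolding a_def by blast
        qed (use c r cf0 in \<open>auto simp: \<sigma>_def\<close>)
        also have "3 * (32 / c) * r = 96 / c * r0 + \<epsilon>" using c by (simp add: r_def field_simps)
        finally show "ip d (est0 (block_means d n m x)) u - ip d ?\<mu> u
              \<le> 32 / c * sqrt (1 / real m) * sqrt (cov_form d P u)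
                + (96 / c * sqrt ((\<Sum>i\<in>I. lam i) / (real m * real n * (c ^ 3 / 4096)\<^sup>2)) + \<epsilon>) * nrm d u"
          by (simp add: \<sigma>_def r0_def L_def \<theta>_def real_sqrt_divide)
      qed
    qed
  qed
qed

section \<open>Mean estimation with direction-dependent accuracy\<close>

theorem theorem1:
  fixes q \<kappa> :: real
  assumes "q > 2" and "\<kappa> > 0"
  shows "\<exists>c c' C :: real. 0 < c \<and> 0 < c' \<and> 0 < C \<and>
    (\<forall>(d :: nat) (N :: nat) (\<delta> :: real).
       1 \<le> d \<longrightarrow> 1 \<le> N \<longrightarrow> 0 < \<delta> \<longrightarrow> \<delta> < 1 \<longrightarrow> exp (- c' * real N) \<le> \<delta> \<longrightarrow>
       (\<exists>est :: (nat \<Rightarrow> nat \<Rightarrow> real) \<Rightarrow> (nat \<Rightarrow> real).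
          est \<in> sample_space d N \<rightarrow>\<^sub>M Rd d \<and>
          (\<forall>(P :: (nat \<Rightarrow> real) measure) (lam :: nat \<Rightarrow> real).
             ac_square_integrable_law d P \<longrightarrow>
             ordered_eigenvalues d (cov_mat d P) lam \<longrightarrow>
             moment_equivalence d q \<kappa> P \<longrightarrow>
             1 - \<delta> \<le> \<P>(x in iid_law N P.
               \<forall>u\<in>usphere d.
                 ip d (vdiff d (est x) (mean_vec d P)) u
                   \<le> C * (sqrt (dir_var d P u * ln (1 / \<delta>) / real N)
                        + sqrt ((\<Sum>i\<in>{i\<in>{1..d}. c * ln (1 / \<delta>) \<le> real i}. lam i) / real N))))))"
proof -
  \<comment> \<open>\<open>1 / (2 * T)\<close> is the constant of \<open>first_moment_ge\<close>; the factor \<open>exp (- 2)\<close> is lost in the passage to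
    block means, and \<open>t\<close> and \<open>\<theta>\<close> are the constants of \<open>uniform_counts\<close>\<close>
  define T where "T = (2 * \<kappa> powr q) powr (1 / (q - 2))"
  have T: "0 < T" using assms by (simp add: T_def)
  define c where "c = min 1 (exp (- 2) / (2 * T))"
  have c: "0 < c" "c \<le> 1" using T by (auto simp: c_def)
  have cT: "exp 2 * c \<le> 1 / (2 * T)"
  proof -
    have "exp 2 * c \<le> exp 2 * (exp (- 2) / (2 * T))" by (intro mult_left_mono) (auto simp: c_def)
    also have "\<dots> = 1 / (2 * T)" by (simp add: exp_minus)
    finally show ?thesis .
  qed
  define t where "t = c\<^sup>2 / 256"
  define \<theta> where "\<theta> = (c ^ 3 / 4096)\<^sup>2"
  have t: "0 < t" "t \<le> 1" using c power_le_one[of c 2] by (auto simp: t_def)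
  have th: "0 < \<theta>" using c by (simp add: \<theta>_def)
  have t2: "0 < t\<^sup>2" "t\<^sup>2 \<le> 1" using t power_le_one[of t 2] by auto
  define ct where "ct = min 1 (4 * \<theta> / t\<^sup>2)"
  define C where "C = max (sqrt 2) (max (128 / (c * t)) (96 / c * sqrt (2 / \<theta>)))"
  have ct: "0 < ct" "ct \<le> 1" using th t2 by (auto simp: ct_def)
  have C: "sqrt 2 \<le> C" "128 / (c * t) \<le> C" "96 / c * sqrt (2 / \<theta>) \<le> C" by (auto simp: C_def)
  have C0: "0 < C" using C(1) by (smt (verit) real_sqrt_gt_zero)
  show ?thesis
  proof (rule exI[of _ ct], rule exI[of _ "t\<^sup>2 / 8"], rule exI[of _ C], intro conjI allI impI)
    show "0 < ct" "0 < t\<^sup>2 / 8" "0 < C" using ct t2 C0 by auto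
    fix d N :: nat and \<delta> :: real
    assume d: "1 \<le> d" and N: "1 \<le> N" and \<delta>: "0 < \<delta>" "\<delta> < 1" and dN: "exp (- (t\<^sup>2 / 8) * real N) \<le> \<delta>"
    define k where "k = ln (1 / \<delta>)"
    have k0: "0 < k" using \<delta> by (simp add: k_def)
    have N0: "0 < real N" using N by simp
    define I where "I = {i\<in>{1..d}. ct * k \<le> real i}"
    let ?accurate = "\<lambda>est P lam. 1 - \<delta> \<le> \<P>(x in iid_law N P. \<forall>u\<in>usphere d.
      ip d (vdiff d (est x) (mean_vec d P)) u \<le> C * (sqrt (dir_var d P u * ln (1 / \<delta>) / real N)
        + sqrt ((\<Sum>i\<in>{i\<in>{1..d}. ct * ln (1 / \<delta>) \<le> real i}. lam i) / real N)))"
    \<comment> \<open>the required bound follows from an instance of \<open>estimates_mean\<close>\<close>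
    have fin: "?accurate est P lam"
      if est: "est \<in> sample_space d N \<rightarrow>\<^sub>M Rd d" and ac: "ac_square_integrable_law d P"
        and ev: "estimates_mean d N P est (1 - \<delta>) (C * sqrt (k / real N)) (C * sqrt (sum lam I / real N))"
      for est P lam
    proof -
      have P: "prob_space P" and Ps: "sets P = sets (Rd d)" and sq: "\<forall>i<d. integrable P (\<lambda>x. (x i)\<^sup>2)"
        using ac by (auto simp: ac_square_integrable_law_def)
      have eq: "C * (sqrt (dir_var d P u * ln (1 / \<delta>) / real N)
            + sqrt ((\<Sum>i\<in>{i\<in>{1..d}. ct * ln (1 / \<delta>) \<le> real i}. lam i) / real N))
          = C * sqrt (k / real N) * sqrt (cov_form d P u) + C * sqrt (sum lam I / real N)" for u
      proof -
        have "dir_var d P u * ln (1 / \<delta>) / real N = k / real N * cov_form d P u"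
          by (simp add: projection_moments(4)[OF P Ps sq] k_def)
        then have "sqrt (dir_var d P u * ln (1 / \<delta>) / real N) = sqrt (k / real N) * sqrt (cov_form d P u)"
          by (simp only: real_sqrt_mult)
        then show ?thesis unfolding I_def k_def[symmetric] by (simp only: distrib_left mult.assoc)
      qed
      show ?thesis unfolding eq by (rule estimates_mean_limit[OF P Ps est ev])
    qed
    show "\<exists>est. est \<in> sample_space d N \<rightarrow>\<^sub>M Rd d \<and>
          (\<forall>P lam. ac_square_integrable_law d P \<longrightarrow>
             ordered_eigenvalues d (cov_mat d P) lam \<longrightarrow>
             moment_equivalence d q \<kappa> P \<longrightarrow>
             ?accurate est P lam)"
    proof (cases "1 / 2 \<le> \<delta>")
      case True
      \<comment> \<open>as \<open>ct * k \<le> 1\<close>, the sum extends over all eigenvalues and the empirical mean is good enough\<close>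
      have "ln (1 / \<delta>) \<le> 1 / \<delta> - 1" using \<delta> by (intro ln_le_minus_one) auto
      also have "\<dots> \<le> 1" using True \<delta> by (simp add: field_simps)
      finally have "k \<le> 1" by (simp add: k_def)
      then have "ct * k \<le> 1 * 1" using ct k0 by (intro mult_mono) auto
      then have I: "I = {1..d}" by (auto simp: I_def intro: order_trans)
      show ?thesis
      proof (rule exI[of _ "block_mean d N"], intro conjI allI impI)
        show bm: "block_mean d N \<in> sample_space d N \<rightarrow>\<^sub>M Rd d" by (rule block_mean_measurable)
        fix P lam
        assume ac: "ac_square_integrable_law d P" and ev: "ordered_eigenvalues d (cov_mat d P) lam"
        have P: "prob_space P" and Ps: "sets P = sets (Rd d)" and sq: "\<forall>i<d. integrable P (\<lambda>x. (x i)\<^sup>2)"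
          using ac by (auto simp: ac_square_integrable_law_def)
        show "?accurate (block_mean d N) P lam"
        proof (rule fin[OF bm ac], rule estimates_mean_mono[OF empirical_mean_event[OF P Ps sq N ev]])
          show "1 - \<delta> \<le> 1 / 2" using True by simp
          show "0 \<le> C * sqrt (k / real N)" using C0 k0 by simp
          show "0 \<le> cov_form d P u" for u by (rule cov_form_nonneg[OF P Ps sq])
          have S0: "0 \<le> sum lam {1..d}" using ev by (intro sum_nonneg) (auto simp: ordered_eigenvalues_def)
          have "sqrt (2 * (\<Sum>i\<in>{1..d}. lam i) / real N) = sqrt 2 * sqrt (sum lam {1..d} / real N)"
            by (simp only: real_sqrt_mult[symmetric] times_divide_eq_right)
          also have "\<dots> \<le> C * sqrt (sum lam I / real N)"
            unfolding I using C S0 by (intro mult_right_mono) auto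
          finally show "sqrt (2 * (\<Sum>i\<in>{1..d}. lam i) / real N) \<le> C * sqrt (sum lam I / real N)" .
        qed
      qed
    next
      case False
      have lnd: "- ln \<delta> = k" using \<delta> by (simp add: k_def ln_div)
      have kl: "1 / 2 \<le> k"
      proof -
        have "ln \<delta> \<le> \<delta> - 1" using \<delta> by (intro ln_le_minus_one) auto
        then show ?thesis using False lnd by linarith
      qed
      have kN: "k \<le> t\<^sup>2 / 8 * real N"
      proof -
        have "- (t\<^sup>2 / 8) * real N \<le> ln \<delta>" using dN \<delta> by (simp add: ln_ge_iff)
        then show ?thesis using lnd by linarith
      qed
      \<comment> \<open>\<open>n\<close> is of the order of \<open>ln (1 / \<delta>)\<close>, chosen so that the failure probability is at most \<open>\<delta>\<close>\<close>
      define n where "n = nat \<lceil>4 * k / t\<^sup>2\<rceil>"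
      have q1: "1 \<le> 4 * k / t\<^sup>2" using kl t2 by (simp add: pos_le_divide_eq)
      have n1: "4 * k / t\<^sup>2 \<le> real n" unfolding n_def by (rule real_nat_ceiling_ge)
      have n2: "real n \<le> 8 * k / t\<^sup>2"
      proof -
        have "real n < 4 * k / t\<^sup>2 + 1" unfolding n_def using q1 by linarith
        also have "\<dots> \<le> 4 * k / t\<^sup>2 + 4 * k / t\<^sup>2" using q1 by simp
        finally show ?thesis by simp
      qed
      have n: "1 \<le> n" using n1 q1 by linarith
      have nN: "n \<le> N"
      proof -
        have "8 * k / t\<^sup>2 \<le> real N" using kN t2 by (simp add: pos_divide_le_eq mult.commute)
        with n2 show ?thesis by linarith
      qed
      define m where "m = N div n"
      have m: "1 \<le> m" using n nN by (simp add: m_def div_greater_zero_iff Suc_le_eq)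
      have nm: "n * m \<le> N" by (simp add: m_def)
      have Nnm: "real N \<le> 2 * (real m * real n)"
      proof -
        have "N < n + n * m" using dividend_less_times_div[of n N] n by (simp add: m_def)
        also have "\<dots> \<le> n * m + n * m" using m by simp
        finally have "real N \<le> real (2 * (m * n))" by (intro of_nat_mono) (simp add: mult.commute)
        then show ?thesis by simp
      qed
      have m0: "0 < real m" and n0: "0 < real n" using m n by auto
      obtain est where est: "est \<in> sample_space d N \<rightarrow>\<^sub>M Rd d"
        and estb: "\<And>P lam I. prob_space P \<Longrightarrow> sets P = sets (Rd d) \<Longrightarrow>
         \<forall>i<d. integrable P (\<lambda>x. (x i)\<^sup>2) \<Longrightarrow> ordered_eigenvalues d (cov_mat d P) lam \<Longrightarrow>
         (\<And>u. u \<in> rat_dirs d \<Longrightarrow> exp 2 * c * sqrt (cov_form d P u)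
            \<le> (\<integral>x. \<bar>ip d (vdiff d x (mean_vec d P)) u\<bar> \<partial>P)) \<Longrightarrow>
         I \<subseteq> {1..d} \<Longrightarrow> real (card ({1..d} - I)) \<le> \<theta> * real n \<Longrightarrow>
         estimates_mean d N P est (1 - 2 * exp (- real n * t\<^sup>2 / 2)) (32 / c * sqrt (1 / real m))
           (96 / c * sqrt ((\<Sum>i\<in>I. lam i) / (real m * real n * \<theta>)))"
        using block_estimator[OF c d n m nm] unfolding \<theta>_def t_def by blast
      have prob: "2 * exp (- real n * t\<^sup>2 / 2) \<le> \<delta>"
      proof -
        have "4 * k \<le> real n * t\<^sup>2" using n1 t2 by (simp add: pos_divide_le_eq)
        then have "exp (- real n * t\<^sup>2 / 2) \<le> exp (- (2 * k))" by simp
        also have "\<dots> = exp (- k) * exp (- k)" by (simp add: mult_exp_exp)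
        also have "exp (- k) = \<delta>" using \<delta> by (simp add: k_def ln_div)
        also have "\<delta> * \<delta> \<le> \<delta> * (1 / 2)" using False \<delta> by (intro mult_left_mono) auto
        finally show ?thesis by simp
      qed
      have top: "real (card ({1..d} - I)) \<le> \<theta> * real n"
      proof -
        have "{1..d} - I \<subseteq> {1..nat \<lfloor>ct * k\<rfloor>}"
        proof
          fix i assume "i \<in> {1..d} - I"
          then have "1 \<le> i" "real i \<le> ct * k" by (auto simp: I_def)
          then show "i \<in> {1..nat \<lfloor>ct * k\<rfloor>}" by (simp add: le_nat_floor)
        qed
        then have "card ({1..d} - I) \<le> nat \<lfloor>ct * k\<rfloor>"
          using card_mono[of "{1..nat \<lfloor>ct * k\<rfloor>}" "{1..d} - I"] by simp
        then have "real (card ({1..d} - I)) \<le> real (nat \<lfloor>ct * k\<rfloor>)" by (rule of_nat_mono)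
        also have "\<dots> \<le> ct * k" using ct k0 by (intro of_nat_floor) simp
        finally have "real (card ({1..d} - I)) \<le> ct * k" .
        also have "\<dots> \<le> 4 * \<theta> / t\<^sup>2 * k" using k0 by (intro mult_right_mono) (auto simp: ct_def)
        also have "\<dots> = \<theta> * (4 * k / t\<^sup>2)" by simp
        also have "\<dots> \<le> \<theta> * real n" using n1 th by (intro mult_left_mono) auto
        finally show ?thesis .
      qed
      show ?thesis
      proof (rule exI[of _ est], intro conjI allI impI)
        show "est \<in> sample_space d N \<rightarrow>\<^sub>M Rd d" by (rule est)
        fix P lam
        assume ac: "ac_square_integrable_law d P" and ev: "ordered_eigenvalues d (cov_mat d P) lam"
          and me: "moment_equivalence d q \<kappa> P"
        have P: "prob_space P" and Ps: "sets P = sets (Rd d)" and sq: "\<forall>i<d. integrable P (\<lambda>x. (x i)\<^sup>2)"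
          using ac by (auto simp: ac_square_integrable_law_def)
        have cf0: "0 \<le> cov_form d P u" for u by (rule cov_form_nonneg[OF P Ps sq])
        have S0: "0 \<le> sum lam I" using ev by (intro sum_nonneg) (auto simp: ordered_eigenvalues_def I_def)
        have abs1: "exp 2 * c * sqrt (cov_form d P u) \<le> (\<integral>x. \<bar>ip d (vdiff d x (mean_vec d P)) u\<bar> \<partial>P)"
          if u: "u \<in> rat_dirs d" for u
        proof -
          have "exp 2 * c * sqrt (cov_form d P u) \<le> 1 / (2 * T) * sqrt (cov_form d P u)"
            using cT cf0 by (intro mult_right_mono) auto
          also have "\<dots> \<le> (\<integral>x. \<bar>ip d (vdiff d x (mean_vec d P)) u\<bar> \<partial>P)"
            using first_moment_all_directions[OF assms ac me u] by (simp add: T_def)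
          finally show ?thesis .
        qed
        have s1: "32 / c * sqrt (1 / real m) \<le> C * sqrt (k / real N)"
        proof -
          have "1 / real m \<le> (4 / t)\<^sup>2 * (k / real N)"
          proof -
            have "real N \<le> real m * (2 * real n)" using Nnm by simp
            also have "\<dots> \<le> real m * (16 * k / t\<^sup>2)" using n2 by (intro mult_left_mono) auto
            finally show ?thesis using m0 N0 t2 by (simp add: field_simps power_divide)
          qed
          then have "sqrt (1 / real m) \<le> sqrt ((4 / t)\<^sup>2 * (k / real N))" by (rule real_sqrt_le_mono)
          also have "\<dots> = 4 / t * sqrt (k / real N)" using t by (simp only: real_sqrt_mult) simp
          finally have "32 / c * sqrt (1 / real m) \<le> 32 / c * (4 / t * sqrt (k / real N))"
            using c by (intro mult_left_mono) auto
          also have "\<dots> = 128 / (c * t) * sqrt (k / real N)" by simp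
          also have "\<dots> \<le> C * sqrt (k / real N)" using C k0 by (intro mult_right_mono) auto
          finally show ?thesis .
        qed
        have s2: "96 / c * sqrt (sum lam I / (real m * real n * \<theta>)) \<le> C * sqrt (sum lam I / real N)"
        proof -
          have "sum lam I / (real m * real n * \<theta>) \<le> 2 / \<theta> * (sum lam I / real N)"
          proof -
            have "sum lam I * real N \<le> sum lam I * (2 * (real m * real n))"
              using Nnm S0 by (intro mult_left_mono) auto
            then show ?thesis using m0 n0 N0 th by (simp add: field_simps)
          qed
          then have "sqrt (sum lam I / (real m * real n * \<theta>)) \<le> sqrt (2 / \<theta>) * sqrt (sum lam I / real N)"
            unfolding real_sqrt_mult[symmetric] by (rule real_sqrt_le_mono)
          then have "96 / c * sqrt (sum lam I / (real m * real n * \<theta>)) \<le> 96 / c * (sqrt (2 / \<theta>) * sqrt (sum lam I / real N))"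
            using c by (intro mult_left_mono) auto
          also have "\<dots> = 96 / c * sqrt (2 / \<theta>) * sqrt (sum lam I / real N)" by simp
          also have "\<dots> \<le> C * sqrt (sum lam I / real N)" using C S0 by (intro mult_right_mono) auto
          finally show ?thesis .
        qed
        show "?accurate est P lam"
        proof (rule fin[OF est ac], rule estimates_mean_mono[OF estb[OF P Ps sq ev abs1 _ top]])
          show "I \<subseteq> {1..d}" by (auto simp: I_def)
          show "1 - \<delta> \<le> 1 - 2 * exp (- real n * t\<^sup>2 / 2)" using prob by simp
        qed (assumption | rule s1 s2 cf0)+
      qed
    qed
  qed
qed

end
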